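(* Let $(Y_j)_{j\in\mathbb{Z}}$, $f$, $(X_i)_{i\ge1}$ and $\delta>0$ satisfy all assumptions of the following setting: $(Y_j)$ is stationary and $\alpha$-mixing, $X_i=f((Y_{i+k})_{k\in\mathbb{Z}})$ with $f$ measurable, $E|X_1|^{2+\delta}<\infty$, $\sum_{k\ge1}\psi_k^{(1+\delta)/(2+\delta)}<\infty$, and $\alpha_k=O(k^{-\mu})$ for some $\mu>(2+\delta)^2/\delta$. Assume in addition that $\alpha_n=O(n^{-8})$, $\phi_m=O(m^{-12})$, and that the distribution function $F(x)=P(X_1\le x)$ is Lipschitz continuous. Let $(l_n)$ be a sequence of positive integers with $l_n\to\infty$ and $l_n=o(\sqrt n)$. Then $\hat D_n\to\sigma_F$ in $L_2$ as $n\to\infty$, where $\sigma_F\ge0$ is the square root of $\sigma_F^2$.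
   Context: $\mathcal{F}_k^m$ is the $\sigma$-field generated by $Y_k,\dots,Y_m$; $\alpha_k=\sup_{n\ge1}\sup_{A\in\mathcal{F}_{-\infty}^n,B\in\mathcal{F}_{n+k}^\infty}|P(A\cap B)-P(A)P(B)|$. The approximation coefficients are \[ \psi_m=E\big|X_i-E(X_i\mid Y_{i-m},\dots,Y_{i+m})\big|^{\frac{2+\delta}{1+\delta}},\qquad \phi_m=E\big|X_i-E(X_i\mid Y_{i-m},\dots,Y_{i+m})\big|. \] Let $F$ be the distribution function of $X_1$ and \[ \sigma_F^2=\mathrm{Var}(F(X_1))+2\sum_{k=2}^\infty\mathrm{Cov}(F(X_1),F(X_k)). \] Let $\hat F_n(x)=\frac1n\sum_{i=1}^n1_{\{X_i\le x\}}$, $k_n=[n/l_n]$, $\tilde U_n=\frac1n\sum_{j=1}^n\hat F_n(X_j)$, $\hat T_i(l)=\sum_{j=(i-1)l+1}^{il}\hat F_n(X_j)$, and \[ \hat D_n=\frac{1}{k_n}\sqrt{\frac{\pi}{2}}\sum_{i=1}^{k_n}\frac{|\hat T_i(l_n)-l_n\tilde U_n|}{\sqrt{l_n}}. \] *)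

theory Defs
  imports "HOL-Probability.Probability" "HOL-Library.Landau_Symbols"
begin

definition gen_events :: "'a measure \<Rightarrow> 's measure \<Rightarrow> (int \<Rightarrow> 'a \<Rightarrow> 's) \<Rightarrow> int set \<Rightarrow> 'a set set" where
  "gen_events M S Y I = {Y j -` A \<inter> space M | j A. j \<in> I \<and> A \<in> sets S}"

definition gen_sigma :: "'a measure \<Rightarrow> 's measure \<Rightarrow> (int \<Rightarrow> 'a \<Rightarrow> 's) \<Rightarrow> int set \<Rightarrow> 'a measure" where
  "gen_sigma M S Y I = sigma (space M) (gen_events M S Y I)"

definition alpha_mix :: "'a measure \<Rightarrow> 's measure \<Rightarrow> (int \<Rightarrow> 'a \<Rightarrow> 's) \<Rightarrow> nat \<Rightarrow> real" where
  "alpha_mix M S Y k = Sup {\<bar>measure M (A \<inter> B) - measure M A * measure M B\<bar> | n A B.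
      n \<ge> (1::int) \<and> A \<in> sets (gen_sigma M S Y {..n}) \<and> B \<in> sets (gen_sigma M S Y {n + int k..})}"

definition Xproc :: "((int \<Rightarrow> 's) \<Rightarrow> real) \<Rightarrow> (int \<Rightarrow> 'a \<Rightarrow> 's) \<Rightarrow> int \<Rightarrow> 'a \<Rightarrow> real" where
  "Xproc f Y i \<omega> = f (\<lambda>k. Y (i + k) \<omega>)"

definition approx_err :: "'a measure \<Rightarrow> 's measure \<Rightarrow> (int \<Rightarrow> 'a \<Rightarrow> 's) \<Rightarrow> ((int \<Rightarrow> 's) \<Rightarrow> real) \<Rightarrow> int \<Rightarrow> nat \<Rightarrow> 'a \<Rightarrow> real" where
  "approx_err M S Y f i m \<omega> = Xproc f Y i \<omega>
     - real_cond_exp M (gen_sigma M S Y {i - int m..i + int m}) (Xproc f Y i) \<omega>"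

text \<open>psi_m and phi_m (by stationarity independent of i; computed at i = 1)\<close>
definition psi_coef :: "'a measure \<Rightarrow> 's measure \<Rightarrow> (int \<Rightarrow> 'a \<Rightarrow> 's) \<Rightarrow> ((int \<Rightarrow> 's) \<Rightarrow> real) \<Rightarrow> real \<Rightarrow> nat \<Rightarrow> real" where
  "psi_coef M S Y f \<delta> m = (\<integral>\<omega>. \<bar>approx_err M S Y f 1 m \<omega>\<bar> powr ((2 + \<delta>) / (1 + \<delta>)) \<partial>M)"

definition phi_coef :: "'a measure \<Rightarrow> 's measure \<Rightarrow> (int \<Rightarrow> 'a \<Rightarrow> 's) \<Rightarrow> ((int \<Rightarrow> 's) \<Rightarrow> real) \<Rightarrow> nat \<Rightarrow> real" where
  "phi_coef M S Y f m = (\<integral>\<omega>. \<bar>approx_err M S Y f 1 m \<omega>\<bar> \<partial>M)"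

definition distF :: "'a measure \<Rightarrow> ('a \<Rightarrow> real) \<Rightarrow> real \<Rightarrow> real" where
  "distF M Z x = measure M {\<omega> \<in> space M. Z \<omega> \<le> x}"

definition covar :: "'a measure \<Rightarrow> ('a \<Rightarrow> real) \<Rightarrow> ('a \<Rightarrow> real) \<Rightarrow> real" where
  "covar M U V = (\<integral>\<omega>. (U \<omega> - (\<integral>\<eta>. U \<eta> \<partial>M)) * (V \<omega> - (\<integral>\<eta>. V \<eta> \<partial>M)) \<partial>M)"

definition sigmaF2 :: "'a measure \<Rightarrow> (nat \<Rightarrow> 'a \<Rightarrow> real) \<Rightarrow> real" where
  "sigmaF2 M X = (let G = (\<lambda>k \<omega>. distF M (X 1) (X k \<omega>)) in
     covar M (G 1) (G 1) + 2 * (\<Sum>k. covar M (G 1) (G (k + 2))))"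

definition Fhat :: "(nat \<Rightarrow> 'a \<Rightarrow> real) \<Rightarrow> nat \<Rightarrow> real \<Rightarrow> 'a \<Rightarrow> real" where
  "Fhat X n x \<omega> = (1 / real n) * (\<Sum>i = 1..n. if X i \<omega> \<le> x then 1 else 0)"

definition Utilde :: "(nat \<Rightarrow> 'a \<Rightarrow> real) \<Rightarrow> nat \<Rightarrow> 'a \<Rightarrow> real" where
  "Utilde X n \<omega> = (1 / real n) * (\<Sum>j = 1..n. Fhat X n (X j \<omega>) \<omega>)"

definition That :: "(nat \<Rightarrow> 'a \<Rightarrow> real) \<Rightarrow> nat \<Rightarrow> nat \<Rightarrow> nat \<Rightarrow> 'a \<Rightarrow> real" where
  "That X n l i \<omega> = (\<Sum>j = (i - 1) * l + 1..i * l. Fhat X n (X j \<omega>) \<omega>)"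

definition Dhat :: "(nat \<Rightarrow> 'a \<Rightarrow> real) \<Rightarrow> (nat \<Rightarrow> nat) \<Rightarrow> nat \<Rightarrow> 'a \<Rightarrow> real" where
  "Dhat X l n \<omega> = (let k = n div l n in
     (1 / real k) * sqrt (pi / 2) *
       (\<Sum>i = 1..k. \<bar>That X n (l n) i \<omega> - real (l n) * Utilde X n \<omega>\<bar> / sqrt (real (l n))))"

end

theory Submission
  imports Defs
begin

text \<open>
  Write \<open>U\<^sub>j = F(X\<^sub>j) - E F(X\<^sub>1)\<close>. Replacing \<open>X\<^sub>j\<close> by its conditional expectation given a window of the
  \<open>Y\<close> process makes bounded Lipschitz functionals (and, after smoothing the jump, indicators) amenable
  to the \<open>\<alpha>\<close>-mixing covariance inequality. This gives summable covariances, hence second moments of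
  partial sums that grow linearly, and the convergence of \<open>E(U\<^sub>1 + \<dots> + U\<^sub>l)\<^sup>2 / l\<close> to \<open>\<sigma>\<^sub>F\<^sup>2\<close>.
  A big-block, small-block argument for characteristic functions and Levy's continuity theorem then
  yield \<open>E|U\<^sub>1 + \<dots> + U\<^sub>l| / \<surd>l \<longlonglongrightarrow> \<sigma>\<^sub>F \<surd>(2/\<pi>)\<close>, while the normalised absolute block sums are nearly
  uncorrelated for non-adjacent blocks, so their mean concentrates. Finally, the empirical distribution
  function is exchanged for \<open>F\<close>: on a grid of about \<open>\<surd>n\<close> quantiles the second-moment bounds give
  \<open>E sup\<^sub>x |F\<^sub>n(x) - F(x)|\<^sup>2 = O(n\<^sup>-\<^sup>1\<^sup>/\<^sup>2)\<close>, which is enough precisely because \<open>l\<^sub>n = o(\<surd>n)\<close>.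
\<close>

section \<open>Covariance inequalities under strong mixing\<close>

text \<open>The process \<open>X\<close> inherits no mixing from \<open>Y\<close>: each
  \<open>X i\<close> may depend on the whole sequence, so every use of \<alpha>-mixing is paid for
  by an L1 window error. The predicate \<open>approximable\<close> isolates that payment for bounded
  functions, and its rate \<open>m^-6\<close> is the square root of the assumed
  \<open>m^-12\<close>, which is what discontinuous functions cost. From there on the argument works
  with bounded variables and second moments only. In the central limit step the third moment of a
  block is bounded by its length times its second moment, which is affordable because the blocks
  have length about \<open>l^(1/3)\<close>, well below \<open>sqrt l\<close>. The estimator
  evaluates a random function at the very sample points that define it, so pointwise bounds on
  \<open>Fhat - F\<close> do not suffice. A bound uniform in the argument is required, hence
  constants that do not depend on the threshold of an indicator. The error is multiplied by
  \<open>sqrt l\<close> through the block normalisation. The factor \<open>sqrt (pi / 2)\<close> in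
  \<open>Dhat\<close> is the reciprocal of the first absolute moment of the standard normal
  law.\<close>

lemma sets_vimage_algebra_obtain:
  assumes "B \<in> sets (vimage_algebra X h N)" "h \<in> X \<rightarrow> space N"
  obtains A where "A \<in> sets N" "B = h -` A \<inter> X"
  using assms by (auto simp: sets_vimage_algebra2)

text \<open>Level sets of simple approximations of \<open>u\<close> are preimages under
  \<open>h\<close>, so the approximations themselves factor through \<open>h\<close>, and limits
  preserve this. The factor \<open>g\<close> is what makes a conditional expectation given a window
  shiftable along the process.\<close>

lemma doob_dynkin_real:
  fixes u :: "'a \<Rightarrow> real"
  assumes u: "u \<in> borel_measurable (vimage_algebra X h N)" and h: "h \<in> X \<rightarrow> space N"
  obtains g where "g \<in> borel_measurable N" "\<And>x. x \<in> X \<Longrightarrow> u x = g (h x)"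
proof -
  obtain s where s: "\<And>i. simple_function (vimage_algebra X h N) (s i)"
    and lim: "\<And>x. x \<in> X \<Longrightarrow> (\<lambda>i. s i x) \<longlonglongrightarrow> u x"
    using borel_measurable_implies_sequence_metric[OF u, of 0] by auto
  have "\<exists>A. A \<in> sets N \<and> s i -` {v} \<inter> X = h -` A \<inter> X" for i v
    using simple_functionD(2)[OF s, of i "{v}"] h
    by (auto elim!: sets_vimage_algebra_obtain)
  then obtain A where A: "\<And>i v. A i v \<in> sets N" "\<And>i v. s i -` {v} \<inter> X = h -` A i v \<inter> X"
    by metis
  define t where "t i y = (\<Sum>v\<in>s i ` X. v * indicator (A i v) y)" for i y
  have t: "t i \<in> borel_measurable N" for i
    unfolding t_def using A(1) by measurable
  have ts: "t i (h x) = s i x" if "x \<in> X" for i x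
  proof -
    have fin: "finite (s i ` X)" using simple_functionD(1)[OF s, of i] by simp
    have "indicator (A i v) (h x) = (if v = s i x then 1 else 0 :: real)" for v
      using A(2)[of i v] that by (auto simp: indicator_def)
    then have "t i (h x) = (\<Sum>v\<in>s i ` X. if v = s i x then v else 0)"
      unfolding t_def by (intro sum.cong) auto
    also have "\<dots> = s i x" using fin that by (simp add: sum.delta)
    finally show ?thesis .
  qed
  \<comment> \<open>Off the range of \<open>h\<close> the sequence may diverge. There
    \<open>lim\<close> takes some default value, and measurability of the pointwise
    \<open>lim\<close> holds regardless.\<close>
  have "(\<lambda>y. lim (\<lambda>i. t i y)) \<in> borel_measurable N"
    by (rule borel_measurable_lim_metric[OF t])
  moreover have "u x = lim (\<lambda>i. t i (h x))" if "x \<in> X" for x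
    using lim[OF that] by (simp add: ts[OF that] limI)
  ultimately show ?thesis using that by blast
qed

text \<open>The count of thresholds \<open>i / N\<close> below \<open>u\<close> is the floor of
  \<open>N * u\<close>. This writes a function with values in the unit interval as an average of
  indicators up to \<open>1 / N\<close>, which reduces covariances of functions to covariances of
  events.\<close>

lemma abs_diff_count_le:
  fixes u :: real
  assumes "0 \<le> u" "u \<le> 1" "N > 0"
  shows "\<bar>u - (\<Sum>i = 1..N. of_bool (real i / real N \<le> u)) / real N\<bar> \<le> 1 / real N"
proof -
  define K where "K = nat \<lfloor>real N * u\<rfloor>"
  have K: "K \<le> N"
  proof -
    have "real N * u \<le> real N" using assms by (simp add: mult_left_le)
    then show ?thesis unfolding K_def by linarith
  qed
  have iff: "real i / real N \<le> u \<longleftrightarrow> i \<le> K" for i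
  proof -
    have "real i / real N \<le> u \<longleftrightarrow> real i \<le> real N * u"
      using assms by (simp add: divide_le_eq mult.commute)
    also have "\<dots> \<longleftrightarrow> i \<le> K"
      unfolding K_def using assms(1) by (auto simp: le_nat_iff le_floor_iff)
    finally show ?thesis .
  qed
  have "(\<Sum>i = 1..N. of_bool (real i / real N \<le> u)) = (\<Sum>i = 1..N. if i \<in> {1..K} then 1 else 0 :: real)"
    by (intro sum.cong refl) (auto simp: iff)
  also have "\<dots> = real (card ({1..N} \<inter> {1..K}))"
    by (simp only: sum.If_cases[OF finite_atLeastAtMost] Collect_mem_eq) simp
  also have "{1..N} \<inter> {1..K} = {1..K}" using K by auto
  finally have eq: "(\<Sum>i = 1..N. of_bool (real i / real N \<le> u)) = real_of_int \<lfloor>real N * u\<rfloor>"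
    using assms(1) by (simp add: K_def)
  have "u - real_of_int \<lfloor>real N * u\<rfloor> / real N = (real N * u - real_of_int \<lfloor>real N * u\<rfloor>) / real N"
    using assms(3) by (simp add: diff_divide_distrib)
  then have "\<bar>u - real_of_int \<lfloor>real N * u\<rfloor> / real N\<bar> = \<bar>real N * u - real_of_int \<lfloor>real N * u\<rfloor>\<bar> / real N"
    by (simp add: abs_divide)
  also have "\<dots> \<le> 1 / real N"
    by (intro divide_right_mono) linarith+
  finally show ?thesis by (simp only: eq)
qed

section \<open>Bounded random variables and perturbation of covariances\<close>

context prob_space
begin

lemma integrable_bounded:
  fixes U :: "'a \<Rightarrow> 'b::{banach,second_countable_topology}"
  assumes "U \<in> borel_measurable M" "\<And>x. x \<in> space M \<Longrightarrow> norm (U x) \<le> a"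
  shows "integrable M U"
  using assms by (intro integrable_const_bound[of _ a]) auto

lemma expectation_abs_le:
  fixes U :: "'a \<Rightarrow> real"
  assumes "U \<in> borel_measurable M" "\<And>x. x \<in> space M \<Longrightarrow> \<bar>U x\<bar> \<le> a"
  shows "\<bar>expectation U\<bar> \<le> a"
proof -
  have "integrable M U" using assms by (intro integrable_bounded) auto
  then have "expectation (\<lambda>x. \<bar>U x\<bar>) \<le> a"
    using assms by (intro integral_le_const) auto
  then show ?thesis using integral_abs_bound[of M U] by linarith
qed

text \<open>Boundedness turns L1 closeness into closeness of covariances: the split
  \<open>P Q - P' Q' = P (Q - Q') + Q' (P - P')\<close> is applied once under the expectation and
  once to the product of means, each at cost \<open>a\<close>. Every later replacement of
  \<open>X\<close> by window functions in a real covariance goes through this bound.\<close>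

lemma cov_perturb:
  fixes P P' Q Q' :: "'a \<Rightarrow> real"
  assumes [measurable]: "P \<in> borel_measurable M" "P' \<in> borel_measurable M"
      "Q \<in> borel_measurable M" "Q' \<in> borel_measurable M"
    and b: "\<And>x. x \<in> space M \<Longrightarrow> \<bar>P x\<bar> \<le> a" "\<And>x. x \<in> space M \<Longrightarrow> \<bar>P' x\<bar> \<le> a"
      "\<And>x. x \<in> space M \<Longrightarrow> \<bar>Q x\<bar> \<le> a" "\<And>x. x \<in> space M \<Longrightarrow> \<bar>Q' x\<bar> \<le> a"
  shows "\<bar>(expectation (\<lambda>x. P x * Q x) - expectation P * expectation Q)
       - (expectation (\<lambda>x. P' x * Q' x) - expectation P' * expectation Q')\<bar>
     \<le> 2 * a * (expectation (\<lambda>x. \<bar>P x - P' x\<bar>) + expectation (\<lambda>x. \<bar>Q x - Q' x\<bar>))"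
proof -
  have a: "0 \<le> a" using b(1) not_empty by fastforce
  have i: "integrable M P" "integrable M P'" "integrable M Q" "integrable M Q'"
    using b by (auto intro!: integrable_bounded[of _ a])
  have i2: "integrable M (\<lambda>x. P x * Q x)" "integrable M (\<lambda>x. P' x * Q' x)"
    using b a by (auto intro!: integrable_bounded[of _ "a * a"] mult_mono simp: abs_mult)
  let ?dP = "expectation (\<lambda>x. \<bar>P x - P' x\<bar>)" and ?dQ = "expectation (\<lambda>x. \<bar>Q x - Q' x\<bar>)"
  have pt: "\<bar>P x * Q x - P' x * Q' x\<bar> \<le> a * \<bar>P x - P' x\<bar> + a * \<bar>Q x - Q' x\<bar>" if "x \<in> space M" for x
  proof -
    have "P x * Q x - P' x * Q' x = P x * (Q x - Q' x) + Q' x * (P x - P' x)" by algebra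
    moreover have "\<bar>P x * (Q x - Q' x)\<bar> \<le> a * \<bar>Q x - Q' x\<bar>" "\<bar>Q' x * (P x - P' x)\<bar> \<le> a * \<bar>P x - P' x\<bar>"
      using b that by (auto simp: abs_mult intro!: mult_right_mono)
    ultimately show ?thesis by linarith
  qed
  have "\<bar>expectation (\<lambda>x. P x * Q x) - expectation (\<lambda>x. P' x * Q' x)\<bar>
      = \<bar>expectation (\<lambda>x. P x * Q x - P' x * Q' x)\<bar>"
    using i2 by simp
  also have "\<dots> \<le> expectation (\<lambda>x. \<bar>P x * Q x - P' x * Q' x\<bar>)" by simp
  also have "\<dots> \<le> expectation (\<lambda>x. a * \<bar>P x - P' x\<bar> + a * \<bar>Q x - Q' x\<bar>)"
    using i i2 pt by (intro integral_mono) auto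
  also have "\<dots> = a * (?dP + ?dQ)" using i by (simp add: algebra_simps)
  finally have 1: "\<bar>expectation (\<lambda>x. P x * Q x) - expectation (\<lambda>x. P' x * Q' x)\<bar> \<le> a * (?dP + ?dQ)" .
  have dP: "\<bar>expectation P - expectation P'\<bar> \<le> ?dP"
    using integral_abs_bound[of M "\<lambda>x. P x - P' x"] i by simp
  have dQ: "\<bar>expectation Q - expectation Q'\<bar> \<le> ?dQ"
    using integral_abs_bound[of M "\<lambda>x. Q x - Q' x"] i by simp
  have e: "\<bar>expectation P\<bar> \<le> a" "\<bar>expectation Q'\<bar> \<le> a"
    using b by (auto intro!: expectation_abs_le)
  have "expectation P * expectation Q - expectation P' * expectation Q'
     = expectation P * (expectation Q - expectation Q') + expectation Q' * (expectation P - expectation P')"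
    by algebra
  moreover have "\<bar>expectation P * (expectation Q - expectation Q')\<bar> \<le> a * ?dQ"
    "\<bar>expectation Q' * (expectation P - expectation P')\<bar> \<le> a * ?dP"
    using e dP dQ a by (auto simp: abs_mult intro!: mult_mono)
  ultimately have 2: "\<bar>expectation P * expectation Q - expectation P' * expectation Q'\<bar> \<le> a * (?dP + ?dQ)"
    by (simp add: algebra_simps)
  show ?thesis using 1 2 by (simp add: algebra_simps)
qed

end

section \<open>Generated sigma-fields, stationarity and window approximants\<close>

locale mixing_functional = prob_space M
  for M :: "'a measure" and S :: "'s measure" and Y :: "int \<Rightarrow> 'a \<Rightarrow> 's"
    and f :: "(int \<Rightarrow> 's) \<Rightarrow> real" +
  assumes Y_measurable [measurable]: "\<And>j. Y j \<in> measurable M S"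
    and stationary: "\<And>h. distr M (PiM UNIV (\<lambda>_. S)) (\<lambda>\<omega> k. Y (k + h) \<omega>)
                          = distr M (PiM UNIV (\<lambda>_. S)) (\<lambda>\<omega> k. Y k \<omega>)"
    and f_measurable [measurable]: "f \<in> borel_measurable (PiM UNIV (\<lambda>_. S))"
begin

abbreviation "\<F> I \<equiv> gen_sigma M S Y I"
abbreviation "\<alpha> \<equiv> alpha_mix M S Y"
abbreviation "X \<equiv> Xproc f Y"

lemma gen_events_subset: "gen_events M S Y I \<subseteq> Pow (space M)"
  by (auto simp: gen_events_def)

lemma space_F [simp]: "space (\<F> I) = space M"
  by (simp add: gen_sigma_def gen_events_subset)

lemma sets_F: "sets (\<F> I) = sigma_sets (space M) (gen_events M S Y I)"
  by (simp add: gen_sigma_def gen_events_subset)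

lemma sets_F_events: "sets (\<F> I) \<subseteq> events"
  unfolding sets_F
  by (rule sets.sigma_sets_subset) (auto simp: gen_events_def intro!: measurable_sets[OF Y_measurable])

lemma subalgebra_F: "subalgebra M (\<F> I)"
  by (simp add: subalgebra_def sets_F_events)

lemma sets_F_mono: "I \<subseteq> J \<Longrightarrow> sets (\<F> I) \<subseteq> sets (\<F> J)"
  unfolding sets_F by (intro sigma_sets_mono') (auto simp: gen_events_def)

lemma measurable_F_mono: "U \<in> measurable (\<F> I) N \<Longrightarrow> I \<subseteq> J \<Longrightarrow> U \<in> measurable (\<F> J) N"
  using sets_F_mono[of I J] by (auto simp: measurable_def)

lemma measurable_F: "U \<in> measurable (\<F> I) N \<Longrightarrow> U \<in> measurable M N"
  using sets_F_events[of I] by (auto simp: measurable_def)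

lemma Y_measurable_F: "j \<in> I \<Longrightarrow> Y j \<in> measurable (\<F> I) S"
  unfolding measurable_def
  using measurable_space[OF Y_measurable]
  by (auto simp: sets_F gen_events_def intro!: sigma_sets.Basic)

lemma F_vimage_algebra:
  "sets (\<F> I) \<subseteq> sets (vimage_algebra (space M) (\<lambda>\<omega>. \<lambda>j\<in>I. Y j \<omega>) (PiM I (\<lambda>_. S)))"
proof -
  let ?V = "vimage_algebra (space M) (\<lambda>\<omega>. \<lambda>j\<in>I. Y j \<omega>) (PiM I (\<lambda>_. S))"
  have h: "(\<lambda>\<omega>. \<lambda>j\<in>I. Y j \<omega>) \<in> space M \<rightarrow> space (PiM I (\<lambda>_. S))"
    using measurable_space[OF Y_measurable] by (auto simp: space_PiM)
  have "B \<in> sets ?V" if B: "B \<in> gen_events M S Y I" for B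
  proof -
    obtain j A where jA: "B = Y j -` A \<inter> space M" "j \<in> I" "A \<in> sets S"
      using B by (auto simp: gen_events_def)
    have "(\<lambda>\<omega>. (\<lambda>y. y j) (\<lambda>j\<in>I. Y j \<omega>)) \<in> measurable ?V S"
      by (rule measurable_compose[OF measurable_vimage_algebra1[OF h] measurable_component_singleton[OF jA(2)]])
    from measurable_sets[OF this jA(3)] show ?thesis using jA by simp
  qed
  then show ?thesis
    unfolding sets_F by (metis sets.sigma_sets_subset space_vimage_algebra subsetI)
qed

lemma process_measurable: "(\<lambda>\<omega> k. Y (k + h) \<omega>) \<in> measurable M (PiM UNIV (\<lambda>_. S))"
  by (rule measurable_PiM_single') (auto simp: measurable_space[OF Y_measurable])

lemma stationary_integral:
  fixes H :: "_ \<Rightarrow> 'b::{banach,second_countable_topology}"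
  assumes H: "H \<in> borel_measurable (PiM UNIV (\<lambda>_. S))"
  shows "expectation (\<lambda>\<omega>. H (\<lambda>k. Y (k + h) \<omega>)) = expectation (\<lambda>\<omega>. H (\<lambda>k. Y k \<omega>))"
    and "integrable M (\<lambda>\<omega>. H (\<lambda>k. Y (k + h) \<omega>)) \<longleftrightarrow> integrable M (\<lambda>\<omega>. H (\<lambda>k. Y k \<omega>))"
  using integral_distr[OF process_measurable H, of h] integral_distr[OF process_measurable H, of 0]
    integrable_distr_eq[OF process_measurable H, of h] integrable_distr_eq[OF process_measurable H, of 0]
  by (simp_all add: stationary)

lemma X_measurable [measurable]: "X i \<in> borel_measurable M"
proof -
  have "(\<lambda>\<omega>. f (\<lambda>k. Y (k + i) \<omega>)) \<in> borel_measurable M"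
    by (rule measurable_compose[OF process_measurable f_measurable])
  then show ?thesis by (simp add: Xproc_def[abs_def] add.commute)
qed

text \<open>Since \<open>f\<close> sees the path relative to the index \<open>i\<close>, shifting
  \<open>Y\<close> by \<open>h\<close> shifts \<open>X\<close> by \<open>h\<close>. A functional of
  \<open>X\<close> is thus a functional \<open>H\<close> of \<open>Y\<close>, to which stationarity
  of \<open>Y\<close> applies.\<close>

lemma stationary_X:
  fixes \<Phi> :: "_ \<Rightarrow> 'b::{banach,second_countable_topology}"
  assumes \<Phi>: "\<Phi> \<in> borel_measurable (PiM UNIV (\<lambda>_::int. borel :: real measure))"
  shows "expectation (\<lambda>\<omega>. \<Phi> (\<lambda>i. X (i + h) \<omega>)) = expectation (\<lambda>\<omega>. \<Phi> (\<lambda>i. X i \<omega>))"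
proof -
  define H where "H = (\<lambda>y. \<Phi> (\<lambda>i. f (\<lambda>k. y (i + k))))"
  have sh: "(\<lambda>y k. y (i + k)) \<in> measurable (PiM UNIV (\<lambda>_. S)) (PiM UNIV (\<lambda>_. S))" for i :: int
    by (rule measurable_PiM_single') (auto simp: space_PiM)
  have "(\<lambda>y i. f (\<lambda>k. y (i + k))) \<in> measurable (PiM UNIV (\<lambda>_. S)) (PiM UNIV (\<lambda>_::int. borel))"
    by (rule measurable_PiM_single') (auto intro: measurable_compose[OF sh f_measurable])
  from measurable_compose[OF this \<Phi>] have "H \<in> borel_measurable (PiM UNIV (\<lambda>_. S))"
    by (simp add: H_def)
  from stationary_integral(1)[OF this, of h] show ?thesis
    by (simp add: H_def Xproc_def[abs_def] algebra_simps)
qed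

text \<open>\<open>phi_coef\<close> is defined at index 1 only. Rather than showing that conditional
  expectations commute with shifts, the one at index 1 is factored as \<open>g\<close> of its
  window, and the same \<open>g\<close> is applied to the window shifted by \<open>i - 1\<close>.
  Stationarity then gives every index the same error.\<close>

lemma approximants:
  assumes int: "integrable M (X 1)"
  obtains Z :: "int \<Rightarrow> 'a \<Rightarrow> real" where
    "\<And>i. Z i \<in> borel_measurable (\<F> {i - int m..i + int m})"
    "\<And>i. integrable M (\<lambda>\<omega>. \<bar>X i \<omega> - Z i \<omega>\<bar>)"
    "\<And>i. expectation (\<lambda>\<omega>. \<bar>X i \<omega> - Z i \<omega>\<bar>) = phi_coef M S Y f m"
proof -
  let ?I = "{1 - int m..1 + int m}"
  define R where "R y = (\<lambda>j\<in>?I. y j)" for y :: "int \<Rightarrow> 's"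
  let ?N = "PiM ?I (\<lambda>_. S)"
  let ?E = "real_cond_exp M (\<F> ?I) (X 1)"
  interpret sub: finite_measure_subalgebra M "\<F> ?I"
    using subalgebra_F by unfold_locales
  have Ei: "integrable M ?E" using sub.real_cond_exp_int(1)[OF int] .
  have h: "(\<lambda>\<omega>. \<lambda>j\<in>?I. Y j \<omega>) \<in> space M \<rightarrow> space ?N"
    using measurable_space[OF Y_measurable] by (auto simp: space_PiM)
  have "?E \<in> borel_measurable (\<F> ?I)" by simp
  then have "?E \<in> borel_measurable (vimage_algebra (space M) (\<lambda>\<omega>. \<lambda>j\<in>?I. Y j \<omega>) ?N)"
    using F_vimage_algebra[of ?I] by (auto simp: measurable_def)
  from doob_dynkin_real[OF this h] obtain g where g: "g \<in> borel_measurable ?N"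
    and Eg: "\<And>\<omega>. \<omega> \<in> space M \<Longrightarrow> ?E \<omega> = g (\<lambda>j\<in>?I. Y j \<omega>)"
    by blast
  define Z where "Z i \<omega> = g (\<lambda>j\<in>?I. Y (j + (i - 1)) \<omega>)" for i \<omega>
  have "Z i \<in> borel_measurable (\<F> {i - int m..i + int m})" for i
    unfolding Z_def[abs_def]
    by (rule measurable_compose[OF _ g], rule measurable_restrict, rule Y_measurable_F) auto
  moreover
  define H where "H y = \<bar>f (\<lambda>k. y (1 + k)) - g (restrict y ?I)\<bar>" for y
  have sh: "(\<lambda>y k. y (1 + k)) \<in> measurable (PiM UNIV (\<lambda>_. S)) (PiM UNIV (\<lambda>_. S))"
    by (rule measurable_PiM_single') (auto simp: space_PiM)
  have rs: "(\<lambda>y. restrict y ?I) \<in> measurable (PiM UNIV (\<lambda>_. S)) ?N"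
    by (rule measurable_restrict_subset) auto
  have H: "H \<in> borel_measurable (PiM UNIV (\<lambda>_. S))"
    unfolding H_def[abs_def]
    using measurable_compose[OF sh f_measurable] measurable_compose[OF rs g] by measurable
  have HX: "H (\<lambda>k. Y (k + (i - 1)) \<omega>) = \<bar>X i \<omega> - Z i \<omega>\<bar>" for i \<omega>
    by (simp add: H_def Xproc_def Z_def algebra_simps)
  have H1: "H (\<lambda>k. Y k \<omega>) = \<bar>approx_err M S Y f 1 m \<omega>\<bar>" if "\<omega> \<in> space M" for \<omega>
    using Eg[OF that] by (simp add: H_def approx_err_def Xproc_def)
  have "integrable M (\<lambda>\<omega>. \<bar>approx_err M S Y f 1 m \<omega>\<bar>)"
    unfolding approx_err_def using int Ei by (intro integrable_abs Bochner_Integration.integrable_diff) auto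
  then have "integrable M (\<lambda>\<omega>. H (\<lambda>k. Y k \<omega>))"
    by (subst Bochner_Integration.integrable_cong[OF refl H1]) auto
  then have "integrable M (\<lambda>\<omega>. \<bar>X i \<omega> - Z i \<omega>\<bar>)" for i
    using stationary_integral(2)[OF H, of "i - 1"] by (simp add: HX)
  moreover have "expectation (\<lambda>\<omega>. \<bar>X i \<omega> - Z i \<omega>\<bar>) = phi_coef M S Y f m" for i
    using stationary_integral(1)[OF H, of "i - 1"] Bochner_Integration.integral_cong[OF refl H1]
    by (simp add: HX phi_coef_def)
  ultimately show ?thesis using that by blast
qed

section \<open>Covariance inequalities: from events to bounded functions\<close>

lemma alpha_mix_bound:
  assumes "1 \<le> n" "n + int k \<le> n'" "A \<in> sets (\<F> {..n})" "B \<in> sets (\<F> {n'..})"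
  shows "\<bar>prob (A \<inter> B) - prob A * prob B\<bar> \<le> \<alpha> k"
  unfolding alpha_mix_def
proof (rule cSup_upper)
  have "B \<in> sets (\<F> {n + int k..})" using sets_F_mono[of "{n'..}" "{n + int k..}"] assms by auto
  then show "\<bar>prob (A \<inter> B) - prob A * prob B\<bar> \<in> {\<bar>prob (A \<inter> B) - prob A * prob B\<bar> | n A B.
      n \<ge> (1::int) \<and> A \<in> sets (\<F> {..n}) \<and> B \<in> sets (\<F> {n + int k..})}"
    using assms by blast
  \<comment> \<open>A real \<open>Sup\<close> is an upper bound only for a set bounded above. Here 1
    bounds the set, both terms of each difference being in the unit interval.\<close>
  show "bdd_above {\<bar>prob (A \<inter> B) - prob A * prob B\<bar> | n A B.
      n \<ge> (1::int) \<and> A \<in> sets (\<F> {..n}) \<and> B \<in> sets (\<F> {n + int k..})}"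
  proof (rule bdd_aboveI[of _ 1], clarsimp)
    fix A B
    have "prob A * prob B \<le> 1" "0 \<le> prob A * prob B" by (auto intro: mult_le_one)
    then show "\<bar>prob (A \<inter> B) - prob A * prob B\<bar> \<le> 1"
      using measure_nonneg[of M "A \<inter> B"] prob_le_1[of "A \<inter> B"] by linarith
  qed
qed

lemma alpha_mix_nonneg: "0 \<le> \<alpha> k"
  using alpha_mix_bound[of 1 k "1 + int k" "{}" "{}"] by simp

text \<open>After discretisation the covariance is the average over \<open>N * N\<close> pairs of
  level sets, each pair contributing at most \<open>\<alpha> k\<close>, so the constant is exactly
  1. The discretisation costs \<open>4 / N\<close>, which disappears in the limit. The hypothesis
  \<open>1 <= n\<close> reflects the range of \<open>n\<close> in \<open>alpha_mix\<close>.\<close>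

lemma covariance_unit_interval:
  assumes n: "1 \<le> n" "n + int k \<le> n'"
    and UF: "U \<in> borel_measurable (\<F> {..n})" and VF: "V \<in> borel_measurable (\<F> {n'..})"
    and U: "\<And>\<omega>. \<omega> \<in> space M \<Longrightarrow> 0 \<le> U \<omega> \<and> U \<omega> \<le> (1::real)"
    and V: "\<And>\<omega>. \<omega> \<in> space M \<Longrightarrow> 0 \<le> V \<omega> \<and> V \<omega> \<le> (1::real)"
  shows "\<bar>expectation (\<lambda>\<omega>. U \<omega> * V \<omega>) - expectation U * expectation V\<bar> \<le> \<alpha> k"
proof -
  have [measurable]: "U \<in> borel_measurable M" "V \<in> borel_measurable M"
    using measurable_F UF VF by auto
  define D where "D N W \<omega> = (\<Sum>i = 1..N. of_bool (real i / real N \<le> W \<omega>)) / real N"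
    for N :: nat and W :: "'a \<Rightarrow> real" and \<omega>
  have D: "D N W \<in> borel_measurable M" "0 \<le> D N W \<omega>" "D N W \<omega> \<le> 1"
    if [measurable]: "W \<in> borel_measurable M" for N W \<omega>
  proof -
    show "D N W \<in> borel_measurable M" unfolding D_def by measurable
    show "0 \<le> D N W \<omega>" by (auto simp: D_def intro!: divide_nonneg_nonneg sum_nonneg)
    have "(\<Sum>i = 1..N. of_bool (real i / real N \<le> W \<omega>)) \<le> (\<Sum>i = 1..N. 1 :: real)"
      by (intro sum_mono) auto
    then show "D N W \<omega> \<le> 1" by (cases "N = 0") (auto simp: D_def)
  qed
  have close: "expectation (\<lambda>\<omega>. \<bar>W \<omega> - D N W \<omega>\<bar>) \<le> 1 / real N"
    if [measurable]: "W \<in> borel_measurable M" and W: "\<And>\<omega>. \<omega> \<in> space M \<Longrightarrow> 0 \<le> W \<omega> \<and> W \<omega> \<le> 1" and "N > 0" for W N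
  proof -
    have le: "\<bar>W \<omega> - D N W \<omega>\<bar> \<le> 1 / real N" if "\<omega> \<in> space M" for \<omega>
      unfolding D_def using W[OF that] \<open>N > 0\<close> by (intro abs_diff_count_le) auto
    note [measurable] = D(1)[OF that(1)]
    have "integrable M (\<lambda>\<omega>. \<bar>W \<omega> - D N W \<omega>\<bar>)"
      using le by (intro integrable_bounded[of _ "1 / real N"]) auto
    then show ?thesis using le by (intro integral_le_const) auto
  qed
  have disc: "\<bar>expectation (\<lambda>\<omega>. D N U \<omega> * D N V \<omega>) - expectation (D N U) * expectation (D N V)\<bar> \<le> \<alpha> k"
    if N: "N > 0" for N
  proof -
    define A where "A i = {\<omega> \<in> space M. real i / real N \<le> U \<omega>}" for i
    define B where "B i = {\<omega> \<in> space M. real i / real N \<le> V \<omega>}" for i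
    have AF: "A i \<in> sets (\<F> {..n})" for i
      unfolding A_def using borel_measurable_le[OF borel_measurable_const UF] by simp
    have BF: "B i \<in> sets (\<F> {n'..})" for i
      unfolding B_def using borel_measurable_le[OF borel_measurable_const VF] by simp
    have [measurable]: "A i \<in> events" "B i \<in> events" for i
      using AF BF sets_F_events by auto
    have Is: "integrable M (indicator C :: 'a \<Rightarrow> real)" if "C \<in> events" for C
      using that by (simp add: emeasure_eq_measure)
    have DU: "D N U \<omega> = (\<Sum>i = 1..N. indicator (A i) \<omega>) / real N" if "\<omega> \<in> space M" for \<omega>
      using that by (auto simp: D_def A_def indicator_def of_bool_def intro!: sum.cong)
    have DV: "D N V \<omega> = (\<Sum>i = 1..N. indicator (B i) \<omega>) / real N" if "\<omega> \<in> space M" for \<omega>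
      using that by (auto simp: D_def B_def indicator_def of_bool_def intro!: sum.cong)
    have EU: "expectation (D N U) = (\<Sum>i = 1..N. prob (A i)) / real N"
      by (subst Bochner_Integration.integral_cong[OF refl DU]) (auto simp: Is)
    have EV: "expectation (D N V) = (\<Sum>i = 1..N. prob (B i)) / real N"
      by (subst Bochner_Integration.integral_cong[OF refl DV]) (auto simp: Is)
    have DUV: "D N U \<omega> * D N V \<omega> = (\<Sum>i = 1..N. \<Sum>j = 1..N. indicator (A i \<inter> B j) \<omega>) / (real N * real N)"
      if "\<omega> \<in> space M" for \<omega>
      using that by (simp add: DU DV sum_product indicator_inter_arith)
    have EUV: "expectation (\<lambda>\<omega>. D N U \<omega> * D N V \<omega>)
        = (\<Sum>i = 1..N. \<Sum>j = 1..N. prob (A i \<inter> B j)) / (real N * real N)"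
      by (subst Bochner_Integration.integral_cong[OF refl DUV]) (auto simp: Is)
    have "\<bar>expectation (\<lambda>\<omega>. D N U \<omega> * D N V \<omega>) - expectation (D N U) * expectation (D N V)\<bar>
      = \<bar>\<Sum>i = 1..N. \<Sum>j = 1..N. (prob (A i \<inter> B j) - prob (A i) * prob (B j))\<bar> / (real N * real N)"
      by (simp add: EU EV EUV sum_product sum_subtractf abs_divide flip: diff_divide_distrib)
    also have "\<dots> \<le> (\<Sum>i = 1..N. \<Sum>j = 1..N. \<alpha> k) / (real N * real N)"
      using alpha_mix_bound[OF n AF BF]
      by (intro divide_right_mono order.trans[OF sum_abs] sum_mono) auto
    also have "\<dots> = \<alpha> k" using N by simp
    finally show ?thesis .
  qed
  have "\<bar>expectation (\<lambda>\<omega>. U \<omega> * V \<omega>) - expectation U * expectation V\<bar> \<le> \<alpha> k + 4 / real N" if N: "N > 0" for N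
  proof -
    have "\<bar>(expectation (\<lambda>x. U x * V x) - expectation U * expectation V)
       - (expectation (\<lambda>x. D N U x * D N V x) - expectation (D N U) * expectation (D N V))\<bar>
     \<le> 2 * 1 * (expectation (\<lambda>x. \<bar>U x - D N U x\<bar>) + expectation (\<lambda>x. \<bar>V x - D N V x\<bar>))"
      using U V D by (intro cov_perturb) (auto simp: abs_le_iff intro: order.trans[of _ 0])
    moreover have "expectation (\<lambda>x. \<bar>U x - D N U x\<bar>) \<le> 1 / real N" "expectation (\<lambda>x. \<bar>V x - D N V x\<bar>) \<le> 1 / real N"
      using U V N by (auto intro!: close)
    ultimately show ?thesis using disc[OF N] by (simp add: abs_le_iff)
  qed
  then have *: "\<forall>\<^sub>F N in sequentially. \<bar>expectation (\<lambda>\<omega>. U \<omega> * V \<omega>) - expectation U * expectation V\<bar> \<le> \<alpha> k + 4 / real N"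
    using eventually_gt_at_top[of "0::nat"] by (rule eventually_mono[rotated])
  have "(\<lambda>N. \<alpha> k + 4 / real N) \<longlonglongrightarrow> \<alpha> k + 0"
    by (intro tendsto_intros lim_const_over_n)
  then show ?thesis
    by (intro tendsto_lowerbound[OF _ *]) auto
qed

text \<open>The affine maps of \<open>[-a, a]\<close> and \<open>[-b, b]\<close> onto the unit
  interval scale covariances by \<open>1 / (2 a)\<close> and \<open>1 / (2 b)\<close>, whence
  \<open>4 * a * b\<close>.\<close>

lemma covariance_bounded:
  assumes n: "1 \<le> n" "n + int k \<le> n'"
    and UF: "U \<in> borel_measurable (\<F> {..n})" and VF: "V \<in> borel_measurable (\<F> {n'..})"
    and U: "\<And>\<omega>. \<omega> \<in> space M \<Longrightarrow> \<bar>U \<omega>\<bar> \<le> (a::real)"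
    and V: "\<And>\<omega>. \<omega> \<in> space M \<Longrightarrow> \<bar>V \<omega>\<bar> \<le> b"
    and ab: "0 < a" "0 < b"
  shows "\<bar>expectation (\<lambda>\<omega>. U \<omega> * V \<omega>) - expectation U * expectation V\<bar> \<le> 4 * a * b * \<alpha> k"
proof -
  have [measurable]: "U \<in> borel_measurable M" "V \<in> borel_measurable M"
    using measurable_F UF VF by auto
  let ?u = "\<lambda>\<omega>. (U \<omega> + a) / (2 * a)" and ?v = "\<lambda>\<omega>. (V \<omega> + b) / (2 * b)"
  have i: "integrable M U" "integrable M V"
    using U V by (auto intro!: integrable_bounded[of _ "max a b"] simp: le_max_iff_disj)
  have i2: "integrable M (\<lambda>\<omega>. U \<omega> * V \<omega>)"
    using U V ab by (auto intro!: integrable_bounded[of _ "a * b"] mult_mono simp: abs_mult)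
  have "\<bar>expectation (\<lambda>\<omega>. ?u \<omega> * ?v \<omega>) - expectation ?u * expectation ?v\<bar> \<le> \<alpha> k"
  proof (intro covariance_unit_interval[OF n])
    show "?u \<in> borel_measurable (\<F> {..n})" "?v \<in> borel_measurable (\<F> {n'..})"
      using UF VF by measurable
    show "0 \<le> ?u \<omega> \<and> ?u \<omega> \<le> 1" "0 \<le> ?v \<omega> \<and> ?v \<omega> \<le> 1" if "\<omega> \<in> space M" for \<omega>
      using U[OF that] V[OF that] ab by (auto simp: abs_le_iff)
  qed
  moreover have "expectation ?u = (expectation U + a) / (2 * a)" "expectation ?v = (expectation V + b) / (2 * b)"
    using i by (auto simp: prob_space)
  moreover have "expectation (\<lambda>\<omega>. ?u \<omega> * ?v \<omega>) = (expectation (\<lambda>\<omega>. U \<omega> * V \<omega>) + b * expectation U + a * expectation V + a * b) / (4 * a * b)"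
  proof -
    have "(\<lambda>\<omega>. ?u \<omega> * ?v \<omega>) = (\<lambda>\<omega>. (U \<omega> * V \<omega> + b * U \<omega> + a * V \<omega> + a * b) / (4 * a * b))"
      by (auto simp: field_simps)
    then show ?thesis using i i2 by (simp add: prob_space)
  qed
  ultimately have "\<bar>(expectation (\<lambda>\<omega>. U \<omega> * V \<omega>) - expectation U * expectation V) / (4 * a * b)\<bar> \<le> \<alpha> k"
    using ab by (simp add: field_simps)
  then show ?thesis using ab by (simp add: abs_divide divide_le_eq abs_mult mult_ac)
qed

text \<open>The real and the imaginary part of the covariance each combine two real covariances of
  size at most \<open>4 * \<alpha> k\<close>. Adding the two parts gives 16. The complex form serves
  characteristic functions.\<close>

lemma covariance_complex:
  fixes U V :: "'a \<Rightarrow> complex"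
  assumes n: "1 \<le> n" "n + int k \<le> n'"
    and UF: "U \<in> borel_measurable (\<F> {..n})" and VF: "V \<in> borel_measurable (\<F> {n'..})"
    and U: "\<And>\<omega>. \<omega> \<in> space M \<Longrightarrow> norm (U \<omega>) \<le> 1"
    and V: "\<And>\<omega>. \<omega> \<in> space M \<Longrightarrow> norm (V \<omega>) \<le> 1"
  shows "norm (expectation (\<lambda>\<omega>. U \<omega> * V \<omega>) - expectation U * expectation V) \<le> 16 * \<alpha> k"
proof -
  have [measurable]: "U \<in> borel_measurable M" "V \<in> borel_measurable M"
    using measurable_F UF VF by auto
  have c: "\<bar>expectation (\<lambda>\<omega>. p (U \<omega>) * q (V \<omega>)) - expectation (\<lambda>\<omega>. p (U \<omega>)) * expectation (\<lambda>\<omega>. q (V \<omega>))\<bar> \<le> 4 * \<alpha> k"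
    if "p = Re \<or> p = Im" "q = Re \<or> q = Im" for p q
  proof -
    have pq: "p \<in> borel_measurable borel" "q \<in> borel_measurable borel" "\<bar>p z\<bar> \<le> norm z" "\<bar>q z\<bar> \<le> norm z" for z
      using that abs_Re_le_cmod abs_Im_le_cmod by auto
    have "\<bar>p (U \<omega>)\<bar> \<le> 1" "\<bar>q (V \<omega>)\<bar> \<le> 1" if "\<omega> \<in> space M" for \<omega>
      using order.trans[OF pq(3) U[OF that]] order.trans[OF pq(4) V[OF that]] by auto
    then show ?thesis
      using covariance_bounded[OF n measurable_compose[OF UF pq(1)] measurable_compose[OF VF pq(2)], of 1 1]
      by simp
  qed
  have iU: "integrable M U" "integrable M V" "integrable M (\<lambda>\<omega>. U \<omega> * V \<omega>)"
    using U V by (auto intro!: integrable_bounded[of _ 1] mult_le_one simp: norm_mult)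
  let ?d = "\<lambda>p q. expectation (\<lambda>\<omega>. p (U \<omega>) * q (V \<omega>)) - expectation (\<lambda>\<omega>. p (U \<omega>)) * expectation (\<lambda>\<omega>. q (V \<omega>))"
  have ip: "integrable M (\<lambda>\<omega>. p (U \<omega>) * q (V \<omega>))" if "p = Re \<or> p = Im" "q = Re \<or> q = Im" for p q
  proof -
    have pq [measurable]: "p \<in> borel_measurable borel" "q \<in> borel_measurable borel" using that by auto
    have "\<bar>p (U \<omega>)\<bar> * \<bar>q (V \<omega>)\<bar> \<le> 1" if "\<omega> \<in> space M" for \<omega>
      using U[OF that] V[OF that] \<open>p = Re \<or> p = Im\<close> \<open>q = Re \<or> q = Im\<close>
      by (intro mult_le_one) (auto intro: order.trans[OF abs_Re_le_cmod] order.trans[OF abs_Im_le_cmod])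
    then show ?thesis by (intro integrable_bounded[of _ 1]) (auto simp: abs_mult)
  qed
  let ?D = "expectation (\<lambda>\<omega>. U \<omega> * V \<omega>) - expectation U * expectation V"
  have "Re ?D = ?d Re Re - ?d Im Im" "Im ?D = ?d Re Im + ?d Im Re"
  proof -
    have U: "Re (expectation U) = expectation (\<lambda>\<omega>. Re (U \<omega>))" "Im (expectation U) = expectation (\<lambda>\<omega>. Im (U \<omega>))"
      using iU(1) by simp_all
    have V: "Re (expectation V) = expectation (\<lambda>\<omega>. Re (V \<omega>))" "Im (expectation V) = expectation (\<lambda>\<omega>. Im (V \<omega>))"
      using iU(2) by simp_all
    have UV: "Re (expectation (\<lambda>\<omega>. U \<omega> * V \<omega>)) = expectation (\<lambda>\<omega>. Re (U \<omega> * V \<omega>))"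
      "Im (expectation (\<lambda>\<omega>. U \<omega> * V \<omega>)) = expectation (\<lambda>\<omega>. Im (U \<omega> * V \<omega>))"
      using integral_Re[OF iU(3)] integral_Im[OF iU(3)] by simp_all
    have "Re (expectation (\<lambda>\<omega>. U \<omega> * V \<omega>)) = expectation (\<lambda>\<omega>. Re (U \<omega>) * Re (V \<omega>)) - expectation (\<lambda>\<omega>. Im (U \<omega>) * Im (V \<omega>))"
      "Im (expectation (\<lambda>\<omega>. U \<omega> * V \<omega>)) = expectation (\<lambda>\<omega>. Re (U \<omega>) * Im (V \<omega>)) + expectation (\<lambda>\<omega>. Im (U \<omega>) * Re (V \<omega>))"
      unfolding UV by (simp_all only: times_complex.sel Bochner_Integration.integral_diff Bochner_Integration.integral_add ip simp_thms)
    then show "Re ?D = ?d Re Re - ?d Im Im" "Im ?D = ?d Re Im + ?d Im Re"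
      by (simp_all only: minus_complex.sel times_complex.sel U V)
  qed
  then have "\<bar>Re ?D\<bar> \<le> 8 * \<alpha> k" "\<bar>Im ?D\<bar> \<le> 8 * \<alpha> k"
    using c[OF disjI1[OF refl] disjI1[OF refl]] c[OF disjI2[OF refl] disjI2[OF refl]]
      c[OF disjI1[OF refl] disjI2[OF refl]] c[OF disjI2[OF refl] disjI1[OF refl]]
    by linarith+
  then show ?thesis using cmod_le[of ?D] by linarith
qed

end

section \<open>Covariances and variances of functionals of the process\<close>

text \<open>Dominated convergence for series. Term \<open>k\<close> stands for lag
  \<open>k + 1\<close>, which occurs \<open>n - 1 - k\<close> times on one side of the diagonal of
  an \<open>n\<close> by \<open>n\<close> matrix.\<close>

lemma suminf_weighted_tendsto:
  fixes c :: "nat \<Rightarrow> real"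
  assumes "summable (\<lambda>k. \<bar>c k\<bar>)"
  shows "(\<lambda>n. (\<Sum>k<n. (real n - 1 - real k) / real n * c k)) \<longlonglongrightarrow> suminf c"
proof -
  define a where "a k n = (if k < n then (real n - 1 - real k) / real n * c k else 0)" for k n
  have lim: "(\<lambda>n. a k n) \<longlonglongrightarrow> c k" for k
  proof -
    have "(\<lambda>n. (1 - (1 + real k) / real n) * c k) \<longlonglongrightarrow> (1 - 0) * c k"
      by (intro tendsto_intros lim_const_over_n)
    then show ?thesis
    proof (rule Lim_transform_eventually[OF tendsto_eq_rhs])
      show "\<forall>\<^sub>F n in sequentially. (1 - (1 + real k) / real n) * c k = a k n"
        using eventually_gt_at_top[of k] by eventually_elim (auto simp: a_def field_simps)
    qed simp
  qed
  have bd: "norm (a k n) \<le> \<bar>c k\<bar>" for k n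
  proof (cases "k < n")
    case True
    then have "\<bar>(real n - 1 - real k) / real n\<bar> \<le> 1" by (simp add: abs_le_iff divide_le_eq)
    from mult_right_mono[OF this, of "\<bar>c k\<bar>"] show ?thesis using True by (simp add: a_def abs_mult)
  qed (simp add: a_def)
  have "(\<lambda>n. suminf (\<lambda>k. a k n)) \<longlonglongrightarrow> suminf c"
    using tannerys_theorem[of a c sequentially "\<lambda>k. \<bar>c k\<bar>", OF lim _ assms]
      always_eventually[of "\<lambda>(k, n). norm (a k n) \<le> \<bar>c k\<bar>"] bd by simp
  moreover have "suminf (\<lambda>k. a k n) = (\<Sum>k<n. (real n - 1 - real k) / real n * c k)" for n
    by (subst suminf_finite[of "{..<n}"]) (auto simp: a_def)
  ultimately show ?thesis by simp
qed

text \<open>On each side of \<open>i\<close> the distance is injective in \<open>j\<close>, so each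
  side is a finite subsum of the series. The index set may have gaps, as the remainder outside the
  big blocks does.\<close>

lemma sum_abs_diff_le_suminf:
  fixes c :: "nat \<Rightarrow> real" and i :: nat
  assumes c: "summable c" "\<And>k. 0 \<le> c k" and J: "finite J"
  shows "(\<Sum>j\<in>J. c (nat \<bar>int i - int j\<bar>)) \<le> 2 * suminf c"
proof -
  have "(\<Sum>j\<in>J. c (nat \<bar>int i - int j\<bar>))
      = (\<Sum>j\<in>J \<inter> {j. j \<le> i}. c (i - j)) + (\<Sum>j\<in>J \<inter> - {j. j \<le> i}. c (j - i))"
    using J by (subst sum.If_cases[symmetric]) (auto intro!: sum.cong arg_cong[where f = c])
  also have "(\<Sum>j\<in>J \<inter> {j. j \<le> i}. c (i - j)) = sum c ((\<lambda>j. i - j) ` (J \<inter> {j. j \<le> i}))"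
    by (subst sum.reindex) (auto simp: inj_on_def)
  also have "\<dots> \<le> suminf c" using c J by (intro sum_le_suminf) auto
  also have "(\<Sum>j\<in>J \<inter> - {j. j \<le> i}. c (j - i)) = sum c ((\<lambda>j. j - i) ` (J \<inter> - {j. j \<le> i}))"
    by (subst sum.reindex) (auto simp: inj_on_def)
  also have "\<dots> \<le> suminf c" using c J by (intro sum_le_suminf) auto
  finally show ?thesis by simp
qed

text \<open>A matrix depending only on the distance to the diagonal is summed along diagonals. The
  induction adds one row and one column, which are equal by symmetry.\<close>

lemma double_sum_abs_diff:
  fixes c :: "nat \<Rightarrow> real"
  shows "(\<Sum>i = 1..n. \<Sum>j = 1..n. c (nat \<bar>int i - int j\<bar>))
    = real n * c 0 + 2 * (\<Sum>k<n. (real n - 1 - real k) * c (Suc k))"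
proof (induction n)
  case (Suc n)
  let ?g = "\<lambda>i j. c (nat \<bar>int i - int j\<bar>)"
  have r: "(\<Sum>j = 1..n. ?g (Suc n) j) = (\<Sum>k<n. c (Suc k))"
  proof -
    have "(\<Sum>j = 1..n. ?g (Suc n) j) = (\<Sum>j = 1..n. c (Suc n - j))"
      by (intro sum.cong refl arg_cong[where f = c]) auto
    also have "\<dots> = (\<Sum>k<n. c (Suc k))"
      by (rule sum.reindex_bij_witness[of _ "\<lambda>k. n - k" "\<lambda>j. n - j"]) (auto simp: Suc_diff_le)
    finally show ?thesis .
  qed
  have sym: "(\<Sum>i = 1..n. ?g i (Suc n)) = (\<Sum>j = 1..n. ?g (Suc n) j)"
    by (intro sum.cong refl arg_cong[where f = c]) auto
  have "(\<Sum>i = 1..Suc n. \<Sum>j = 1..Suc n. ?g i j)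
      = (\<Sum>i = 1..n. \<Sum>j = 1..n. ?g i j) + (\<Sum>i = 1..n. ?g i (Suc n)) + (\<Sum>j = 1..n. ?g (Suc n) j) + c 0"
    by (simp add: sum.distrib algebra_simps)
  also have "\<dots> = real (Suc n) * c 0 + 2 * ((\<Sum>k<n. (real n - 1 - real k) * c (Suc k)) + (\<Sum>k<n. c (Suc k)))"
    unfolding sym r Suc by (simp add: algebra_simps)
  also have "(\<Sum>k<n. (real n - 1 - real k) * c (Suc k)) + (\<Sum>k<n. c (Suc k))
      = (\<Sum>k<Suc n. (real (Suc n) - 1 - real k) * c (Suc k))"
    by (simp add: algebra_simps flip: sum.distrib)
  finally show ?case .
qed simp

section \<open>Functions approximable by windows of the Y process\<close>

locale lipschitz_mixing_functional = mixing_functional M S Y f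
  for M :: "'a measure" and S :: "'s measure" and Y :: "int \<Rightarrow> 'a \<Rightarrow> 's"
    and f :: "(int \<Rightarrow> 's) \<Rightarrow> real" +
  fixes K L :: real
  assumes X_integrable: "integrable M (X 1)"
    and alpha_le: "\<And>k. 1 \<le> k \<Longrightarrow> \<alpha> k \<le> K / real k ^ 8"
    and phi_le: "\<And>m. 1 \<le> m \<Longrightarrow> phi_coef M S Y f m \<le> K / real m ^ 12"
    and lipschitz: "L-lipschitz_on UNIV (distF M (X 1))"
begin

abbreviation "F \<equiv> distF M (X 1)"

lemma K_nonneg: "0 \<le> K"
  using alpha_le[of 1] alpha_mix_nonneg[of 1] by simp

lemma L_nonneg: "0 \<le> L"
  using lipschitz lipschitz_on_nonneg by blast

lemma F_bounds: "0 \<le> F x" "F x \<le> 1"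
  by (auto simp: distF_def)

lemma F_lipschitz: "\<bar>F x - F y\<bar> \<le> L * \<bar>x - y\<bar>"
  using lipschitz_onD[OF lipschitz, of x y] by (simp add: dist_real_def)

lemma F_continuous: "continuous_on UNIV F"
  using lipschitz by (rule lipschitz_on_continuous_on)

lemma F_measurable [measurable]: "F \<in> borel_measurable borel"
  by (rule borel_measurable_continuous_onI[OF F_continuous])

text \<open>Interface between the process and all later moment bounds. The approximant
  \<open>Q\<close> keeps the range of \<open>g\<close>, so the covariance inequality for the unit
  interval applies to it. The constant \<open>C\<close> is explicit so that families of functions
  can share one.\<close>

definition approximable :: "real \<Rightarrow> (real \<Rightarrow> real) \<Rightarrow> bool" where
  "approximable C g \<longleftrightarrow> g \<in> borel_measurable borel \<and> (\<forall>x. 0 \<le> g x \<and> g x \<le> 1) \<and>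
     (\<forall>m\<ge>1. \<forall>i. \<exists>Q\<in>borel_measurable (\<F> {i - int m..i + int m}).
        (\<forall>\<omega>. 0 \<le> Q \<omega> \<and> Q \<omega> \<le> 1) \<and> expectation (\<lambda>\<omega>. \<bar>g (X i \<omega>) - Q \<omega>\<bar>) \<le> C / real m ^ 6)"

lemma approximable_cdf: "approximable (L * K) F"
  unfolding approximable_def
proof (intro conjI allI impI)
  fix m :: nat and i :: int
  assume m: "1 \<le> m"
  obtain Z where Z: "\<And>i. Z i \<in> borel_measurable (\<F> {i - int m..i + int m})"
    "\<And>i. integrable M (\<lambda>\<omega>. \<bar>X i \<omega> - Z i \<omega>\<bar>)"
    "\<And>i. expectation (\<lambda>\<omega>. \<bar>X i \<omega> - Z i \<omega>\<bar>) = phi_coef M S Y f m"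
    by (rule approximants[OF X_integrable, of m]) (rule that)
  note [measurable] = measurable_F[OF Z(1)]
  have "expectation (\<lambda>\<omega>. \<bar>F (X i \<omega>) - F (Z i \<omega>)\<bar>) \<le> expectation (\<lambda>\<omega>. L * \<bar>X i \<omega> - Z i \<omega>\<bar>)"
  proof (intro integral_mono F_lipschitz integrable_mult_right Z(2) integrable_bounded[of _ 1])
    show "norm \<bar>F (X i \<omega>) - F (Z i \<omega>)\<bar> \<le> 1" for \<omega>
      using F_bounds[of "X i \<omega>"] F_bounds[of "Z i \<omega>"] by (simp add: abs_le_iff)
  qed measurable
  also have "\<dots> \<le> L * (K / real m ^ 12)"
    using mult_left_mono[OF phi_le[OF m] L_nonneg] Z(3) by simp
  \<comment> \<open>The Lipschitz case would allow the exponent 12. It is lowered to 6 so that the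
    distribution function and the indicators satisfy the same predicate.\<close>
  also have "\<dots> \<le> L * K / real m ^ 6"
    using m L_nonneg K_nonneg by (auto intro!: divide_left_mono power_increasing)
  finally have "expectation (\<lambda>\<omega>. \<bar>F (X i \<omega>) - F (Z i \<omega>)\<bar>) \<le> L * K / real m ^ 6" .
  then show "\<exists>Q\<in>borel_measurable (\<F> {i - int m..i + int m}).
        (\<forall>\<omega>. 0 \<le> Q \<omega> \<and> Q \<omega> \<le> 1) \<and> expectation (\<lambda>\<omega>. \<bar>F (X i \<omega>) - Q \<omega>\<bar>) \<le> L * K / real m ^ 6"
    using F_bounds measurable_compose[OF Z(1) F_measurable]
    by (intro bexI[of _ "\<lambda>\<omega>. F (Z i \<omega>)"]) auto
qed (auto simp: F_bounds)

lemma stationary_X1: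
  assumes [measurable]: "h \<in> borel_measurable (borel :: real measure)"
  shows "expectation (\<lambda>\<omega>. h (X i \<omega>) :: real) = expectation (\<lambda>\<omega>. h (X 1 \<omega>))"
  using stationary_X[of "\<lambda>y. h (y 1)" "i - 1"] by simp

lemma distF_X: "distF M (X i) = F"
proof
  fix x
  have "distF M (X i) x = expectation (\<lambda>\<omega>. indicator {..x} (X i \<omega>))" for i
  proof -
    have "(\<lambda>\<omega>. indicator {..x} (X i \<omega>) :: real) = indicator {\<omega>. X i \<omega> \<le> x}"
      by (auto simp: indicator_def)
    then show ?thesis by (simp add: distF_def Int_def conj_commute)
  qed
  from this[of i] this[of 1] show "distF M (X i) x = F x"
    using stationary_X1[of "indicator {..x}" i] by simp
qed

text \<open>Smoothing the jump at \<open>x\<close> over width \<open>m\<^sup>-\<^sup>6\<close> balances the cost \<open>L m\<^sup>-\<^sup>6\<close> of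
  smoothing against the approximation error \<open>m\<^sup>6 \<phi>\<^sub>m\<close>.\<close>
lemma approximable_indicator: "approximable (L + K) (\<lambda>y. if y \<le> x then 1 else 0)" (is "approximable _ ?g")
  unfolding approximable_def
proof (intro conjI allI impI)
  fix m :: nat and i :: int
  assume m: "1 \<le> m"
  obtain Z where Z: "\<And>i. Z i \<in> borel_measurable (\<F> {i - int m..i + int m})"
    "\<And>i. integrable M (\<lambda>\<omega>. \<bar>X i \<omega> - Z i \<omega>\<bar>)"
    "\<And>i. expectation (\<lambda>\<omega>. \<bar>X i \<omega> - Z i \<omega>\<bar>) = phi_coef M S Y f m"
    by (rule approximants[OF X_integrable, of m]) (rule that)
  note [measurable] = measurable_F[OF Z(1)]
  define N where "N = real m ^ 6"
  have N: "0 < N" using m by (simp add: N_def)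
  define h where "h z = max 0 (min 1 (1 + N * (x - z)))" for z
  have hm [measurable]: "h \<in> borel_measurable borel" unfolding h_def by measurable
  have h: "0 \<le> h z" "h z \<le> 1" for z by (auto simp: h_def)
  have hl: "\<bar>h y - h z\<bar> \<le> N * \<bar>y - z\<bar>" for y z
  proof -
    have "\<bar>h y - h z\<bar> \<le> \<bar>N * (x - y) - N * (x - z)\<bar>" by (auto simp: h_def)
    also have "\<dots> = N * \<bar>y - z\<bar>" using N by (simp add: abs_mult flip: right_diff_distrib)
    finally show ?thesis .
  qed
  \<comment> \<open>The ramp \<open>h\<close> equals 1 up to \<open>x\<close> and 0 beyond
    \<open>x + 1 / N\<close>, so it differs from the indicator only on an interval of length
    \<open>1 / N\<close>, which has probability at most \<open>L / N\<close>.\<close>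
  have gh: "\<bar>?g y - h y\<bar> \<le> indicator {..x + 1 / N} y - indicator {..x} y" for y
  proof -
    consider "y \<le> x" | "x < y" "y \<le> x + 1 / N" | "x + 1 / N < y" "x < y" using N by force
    then show ?thesis
    proof cases
      case 1
      then have "0 \<le> N * (x - y)" "y \<le> x + 1 / N" using N by (auto intro: add_increasing2)
      then show ?thesis using 1 by (simp add: h_def)
    next
      case 2
      then show ?thesis using h[of y] by simp
    next
      case 3
      then have "1 + N * (x - y) \<le> 0" using N by (simp add: field_simps)
      then show ?thesis using 3 by (simp add: h_def)
    qed
  qed
  have I: "expectation (\<lambda>\<omega>. indicator {..z} (X i \<omega>)) = F z" "integrable M (\<lambda>\<omega>. indicator {..z} (X i \<omega>) :: real)" for z
  proof -
    have "(\<lambda>\<omega>. indicator {..z} (X i \<omega>) :: real) = indicator {\<omega>. X i \<omega> \<le> z}"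
      by (auto simp: indicator_def)
    then show "expectation (\<lambda>\<omega>. indicator {..z} (X i \<omega>)) = F z"
      using distF_X[of i] by (simp add: distF_def Int_def conj_commute flip: distF_X[of i])
  qed (auto intro!: integrable_bounded[of _ 1])
  have "expectation (\<lambda>\<omega>. \<bar>?g (X i \<omega>) - h (Z i \<omega>)\<bar>)
      \<le> expectation (\<lambda>\<omega>. (indicator {..x + 1 / N} (X i \<omega>) - indicator {..x} (X i \<omega>)) + N * \<bar>X i \<omega> - Z i \<omega>\<bar>)"
  proof (rule integral_mono)
    show "integrable M (\<lambda>\<omega>. \<bar>?g (X i \<omega>) - h (Z i \<omega>)\<bar>)"
    proof (rule integrable_bounded[of _ 1])
      show "norm \<bar>?g (X i \<omega>) - h (Z i \<omega>)\<bar> \<le> 1" for \<omega>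
        using h[of "Z i \<omega>"] by (auto simp: abs_le_iff)
    qed measurable
    show "\<bar>?g (X i \<omega>) - h (Z i \<omega>)\<bar>
      \<le> indicator {..x + 1 / N} (X i \<omega>) - indicator {..x} (X i \<omega>) + N * \<bar>X i \<omega> - Z i \<omega>\<bar>" for \<omega>
      using gh[of "X i \<omega>"] hl[of "X i \<omega>" "Z i \<omega>"] by linarith
  qed (use I Z(2) in auto)
  also have "\<dots> = F (x + 1 / N) - F x + N * phi_coef M S Y f m"
    using I Z by simp
  also have "\<dots> \<le> L * (1 / N) + N * (K / real m ^ 12)"
    using F_lipschitz[of "x + 1 / N" x] N phi_le[OF m] by (intro add_mono mult_left_mono) auto
  also have "\<dots> = (L + K) / real m ^ 6"
  proof -
    have "real m ^ 12 = N * N" by (simp add: N_def flip: power_add)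
    then show ?thesis using N by (simp add: N_def[symmetric] field_simps)
  qed
  finally show "\<exists>Q\<in>borel_measurable (\<F> {i - int m..i + int m}).
        (\<forall>\<omega>. 0 \<le> Q \<omega> \<and> Q \<omega> \<le> 1) \<and> expectation (\<lambda>\<omega>. \<bar>?g (X i \<omega>) - Q \<omega>\<bar>) \<le> (L + K) / real m ^ 6"
    using h measurable_compose[OF Z(1) hm]
    by (intro bexI[of _ "\<lambda>\<omega>. h (Z i \<omega>)"]) auto
qed auto

section \<open>Autocovariances and second moments of partial sums\<close>

definition centred :: "(real \<Rightarrow> real) \<Rightarrow> nat \<Rightarrow> 'a \<Rightarrow> real" where
  "centred g j \<omega> = g (X (int j) \<omega>) - expectation (\<lambda>\<omega>. g (X 1 \<omega>))"

definition acov :: "(real \<Rightarrow> real) \<Rightarrow> nat \<Rightarrow> real" where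
  "acov g k = expectation (\<lambda>\<omega>. centred g 1 \<omega> * centred g (1 + k) \<omega>)"

definition long_run_variance :: "(real \<Rightarrow> real) \<Rightarrow> real" where
  "long_run_variance g = acov g 0 + 2 * (\<Sum>k. acov g (Suc k))"

text \<open>36 is the square of the 6 in \<open>k + 1 <= 6 * m\<close>, where \<open>m\<close> is a
  third of the lag. The summands \<open>K\<close> and \<open>4 * C\<close> come from mixing and from
  window replacement, and 9 covers the lags below 3 through \<open>(k + 1)^2 <= 9\<close>.\<close>

definition cov_const :: "real \<Rightarrow> real" where
  "cov_const C = 36 * (K + 4 * C) + 9"

definition moment_const :: "real \<Rightarrow> real" where
  "moment_const C = 2 * cov_const C * (\<Sum>k. 1 / (real k + 1)\<^sup>2)"

lemma summable_inverse_square: "summable (\<lambda>k. 1 / (real k + 1)\<^sup>2)"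
  using inverse_power_summable[of 2, where ?'a = real] summable_Suc_iff[of "\<lambda>k. inverse (real k ^ 2)"]
  by (simp add: field_simps)

context
  fixes g C
  assumes g: "approximable C g"
begin

lemma approximable_measurable [measurable]: "g \<in> borel_measurable borel"
  using g by (simp add: approximable_def)

lemma approximable_bounds: "0 \<le> g x" "g x \<le> 1"
  using g by (auto simp: approximable_def)

lemma approximable_const_nonneg: "0 \<le> C"
proof -
  obtain Q where "expectation (\<lambda>\<omega>. \<bar>g (X 1 \<omega>) - Q \<omega>\<bar>) \<le> C / real 1 ^ 6"
    using g unfolding approximable_def by blast
  from order.trans[OF _ this, of 0] show ?thesis by simp
qed

lemma integrable_g: "integrable M (\<lambda>\<omega>. g (X i \<omega>))"
  using approximable_bounds by (intro integrable_bounded[of _ 1]) auto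

lemma mean_g: "0 \<le> expectation (\<lambda>\<omega>. g (X 1 \<omega>))" "expectation (\<lambda>\<omega>. g (X 1 \<omega>)) \<le> 1"
  using integrable_g approximable_bounds by (auto intro!: integral_nonneg_AE integral_le_const)

lemma centred_measurable [measurable]: "centred g j \<in> borel_measurable M"
  unfolding centred_def[abs_def] by measurable

lemma centred_bound: "\<bar>centred g j \<omega>\<bar> \<le> 1"
  using approximable_bounds[of "X (int j) \<omega>"] mean_g by (auto simp: centred_def abs_le_iff)

lemma integrable_centred: "integrable M (centred g j)"
  using centred_bound by (intro integrable_bounded[of _ 1]) auto

lemma integrable_centred_mult: "integrable M (\<lambda>\<omega>. centred g i \<omega> * centred g j \<omega>)"
  using centred_bound by (intro integrable_bounded[of _ 1]) (auto simp: abs_mult intro!: mult_le_one)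

lemma expectation_centred: "expectation (centred g j) = 0"
  unfolding centred_def[abs_def] using integrable_g stationary_X1[of g "int j"] by (simp add: prob_space)

lemma stationary_centred_sum:
  fixes G :: "real \<Rightarrow> 'b::{banach,second_countable_topology}"
  assumes [measurable]: "G \<in> borel_measurable borel"
  shows "expectation (\<lambda>\<omega>. G (\<Sum>j\<in>J. centred g (j + h) \<omega>)) = expectation (\<lambda>\<omega>. G (\<Sum>j\<in>J. centred g j \<omega>))"
  using stationary_X[of "\<lambda>y. G (\<Sum>j\<in>J. (g (y (int j)) - expectation (\<lambda>\<omega>. g (X 1 \<omega>))))" "int h"]
  by (simp add: centred_def)

lemma expectation_centred_mult:
  assumes "1 \<le> i" "1 \<le> j"
  shows "expectation (\<lambda>\<omega>. centred g i \<omega> * centred g j \<omega>) = acov g (nat \<bar>int i - int j\<bar>)"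
proof -
  have "expectation (\<lambda>\<omega>. centred g i \<omega> * centred g (i + k) \<omega>) = acov g k" if "1 \<le> i" for i k
    using that stationary_X[of "\<lambda>y. (g (y 1) - expectation (\<lambda>\<omega>. g (X 1 \<omega>))) * (g (y (1 + int k)) - expectation (\<lambda>\<omega>. g (X 1 \<omega>)))" "int i - 1"]
    by (simp add: centred_def acov_def algebra_simps)
  from this[of i "j - i"] this[of j "i - j"] show ?thesis
    using assms by (cases "i \<le> j") (auto simp: mult.commute nat_diff_distrib' abs_if)
qed

lemma acov_eq: "acov g k = expectation (\<lambda>\<omega>. g (X 1 \<omega>) * g (X (1 + int k) \<omega>))
    - expectation (\<lambda>\<omega>. g (X 1 \<omega>)) * expectation (\<lambda>\<omega>. g (X (1 + int k) \<omega>))"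
proof -
  let ?m = "expectation (\<lambda>\<omega>. g (X 1 \<omega>))"
  have "integrable M (\<lambda>\<omega>. g (X 1 \<omega>) * g (X (1 + int k) \<omega>))"
    using approximable_bounds by (intro integrable_bounded[of _ 1]) (auto simp: abs_mult intro!: mult_le_one)
  moreover have "(\<lambda>\<omega>. centred g 1 \<omega> * centred g (1 + k) \<omega>)
     = (\<lambda>\<omega>. g (X 1 \<omega>) * g (X (1 + int k) \<omega>) - ?m * g (X 1 \<omega>) - ?m * g (X (1 + int k) \<omega>) + ?m * ?m)"
    by (auto simp: centred_def algebra_simps)
  ultimately show ?thesis
    using integrable_g stationary_X1[of g "1 + int k"] by (simp add: acov_def prob_space)
qed

lemma acov_le: "\<bar>acov g k\<bar> \<le> cov_const C / (real k + 1)\<^sup>2"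
proof (cases "k < 3")
  case True
  have "\<bar>acov g k\<bar> \<le> 1"
    unfolding acov_def using centred_bound
    by (intro expectation_abs_le) (auto simp: abs_mult intro!: mult_le_one)
  also have "1 \<le> 9 / (real k + 1)\<^sup>2"
    using True power_mono[of "real k + 1" 3 2] by simp
  also have "\<dots> \<le> cov_const C / (real k + 1)\<^sup>2"
    using K_nonneg approximable_const_nonneg by (intro divide_right_mono) (auto simp: cov_const_def)
  finally show ?thesis .
next
  case False
  \<comment> \<open>Windows of radius \<open>m\<close> around 1 and \<open>1 + k\<close> use up two
    thirds of the lag at most and leave a gap of at least \<open>m\<close> for mixing.\<close>
  define m where "m = k div 3"
  have m: "1 \<le> m" "2 * m + m \<le> k" "k + 1 \<le> 6 * m" using False unfolding m_def by presburger+
  obtain P where P: "P \<in> borel_measurable (\<F> {1 - int m..1 + int m})" "\<And>\<omega>. 0 \<le> P \<omega> \<and> P \<omega> \<le> 1"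
    "expectation (\<lambda>\<omega>. \<bar>g (X 1 \<omega>) - P \<omega>\<bar>) \<le> C / real m ^ 6"
    using g m(1) unfolding approximable_def by meson
  obtain Q where Q: "Q \<in> borel_measurable (\<F> {1 + int k - int m..1 + int k + int m})" "\<And>\<omega>. 0 \<le> Q \<omega> \<and> Q \<omega> \<le> 1"
    "expectation (\<lambda>\<omega>. \<bar>g (X (1 + int k) \<omega>) - Q \<omega>\<bar>) \<le> C / real m ^ 6"
    using g m(1) unfolding approximable_def by meson
  note [measurable] = measurable_F[OF P(1)] measurable_F[OF Q(1)]
  have "\<bar>expectation (\<lambda>\<omega>. P \<omega> * Q \<omega>) - expectation P * expectation Q\<bar> \<le> \<alpha> m"
    using P Q m
    by (intro covariance_unit_interval[of "1 + int m" _ "1 + int k - int m"])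
      (auto intro: measurable_F_mono)
  also have "\<dots> \<le> K / real m ^ 8" using alpha_le m by simp
  finally have 1: "\<bar>expectation (\<lambda>\<omega>. P \<omega> * Q \<omega>) - expectation P * expectation Q\<bar> \<le> K / real m ^ 8" .
  have 2: "\<bar>acov g k - (expectation (\<lambda>\<omega>. P \<omega> * Q \<omega>) - expectation P * expectation Q)\<bar>
     \<le> 2 * 1 * (expectation (\<lambda>\<omega>. \<bar>g (X 1 \<omega>) - P \<omega>\<bar>) + expectation (\<lambda>\<omega>. \<bar>g (X (1 + int k) \<omega>) - Q \<omega>\<bar>))"
    unfolding acov_eq using P(2) Q(2) approximable_bounds by (intro cov_perturb) auto
  have "\<bar>acov g k\<bar> \<le> K / real m ^ 8 + 4 * C / real m ^ 6"
    using 1 2 P(3) Q(3) by (simp add: abs_le_iff)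
  \<comment> \<open>Quadratic decay is all that is kept, being enough for absolutely summable
    covariances.\<close>
  also have "\<dots> \<le> K / (real m)\<^sup>2 + 4 * C / (real m)\<^sup>2"
    using m K_nonneg approximable_const_nonneg by (intro add_mono divide_left_mono power_increasing) auto
  also have "\<dots> = 36 * (K + 4 * C) / (6 * real m)\<^sup>2"
    using m by (simp add: power_mult_distrib field_simps)
  also have "\<dots> \<le> 36 * (K + 4 * C) / (real k + 1)\<^sup>2"
    using m K_nonneg approximable_const_nonneg by (intro divide_left_mono power_mono) auto
  also have "\<dots> \<le> cov_const C / (real k + 1)\<^sup>2"
    by (intro divide_right_mono) (auto simp: cov_const_def)
  finally show ?thesis .
qed

lemma cov_const_nonneg: "0 \<le> cov_const C"
  using K_nonneg approximable_const_nonneg by (simp add: cov_const_def)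

lemma moment_const_nonneg: "0 \<le> moment_const C"
  using cov_const_nonneg suminf_nonneg[OF summable_inverse_square] by (simp add: moment_const_def)

lemma summable_acov: "summable (\<lambda>k. \<bar>acov g k\<bar>)"
proof (rule summable_comparison_test')
  show "summable (\<lambda>k. cov_const C * (1 / (real k + 1)\<^sup>2))"
    by (rule summable_mult[OF summable_inverse_square])
  show "norm \<bar>acov g k\<bar> \<le> cov_const C * (1 / (real k + 1)\<^sup>2)" if "0 \<le> k" for k
    using acov_le[of k] by simp
qed

lemma integrable_centred_sum_sq: "finite J \<Longrightarrow> integrable M (\<lambda>\<omega>. (\<Sum>j\<in>J. centred g j \<omega>)\<^sup>2)"
  by (simp add: power2_eq_square sum_product integrable_centred_mult)

lemma second_moment_eq:
  assumes "finite J" "J \<subseteq> {1..}"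
  shows "expectation (\<lambda>\<omega>. (\<Sum>j\<in>J. centred g j \<omega>)\<^sup>2) = (\<Sum>i\<in>J. \<Sum>j\<in>J. acov g (nat \<bar>int i - int j\<bar>))"
proof -
  have "expectation (\<lambda>\<omega>. (\<Sum>j\<in>J. centred g j \<omega>)\<^sup>2) = (\<Sum>i\<in>J. \<Sum>j\<in>J. expectation (\<lambda>\<omega>. centred g i \<omega> * centred g j \<omega>))"
    by (simp add: power2_eq_square sum_product integrable_centred_mult)
  also have "\<dots> = (\<Sum>i\<in>J. \<Sum>j\<in>J. acov g (nat \<bar>int i - int j\<bar>))"
    using assms by (intro sum.cong refl expectation_centred_mult) auto
  finally show ?thesis .
qed

text \<open>Each row of the covariance matrix sums to at most \<open>moment_const C\<close>. Since
  \<open>J\<close> is arbitrary, the bound counts indices and ignores how they are spread.\<close>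

lemma second_moment_le:
  assumes J: "finite J" "J \<subseteq> {1..}"
  shows "expectation (\<lambda>\<omega>. (\<Sum>j\<in>J. centred g j \<omega>)\<^sup>2) \<le> moment_const C * real (card J)"
proof -
  have "(\<Sum>i\<in>J. \<Sum>j\<in>J. acov g (nat \<bar>int i - int j\<bar>))
      \<le> (\<Sum>i\<in>J. \<Sum>j\<in>J. cov_const C * (1 / (real (nat \<bar>int i - int j\<bar>) + 1)\<^sup>2))"
    using order.trans[OF abs_ge_self acov_le] by (intro sum_mono) (simp only: times_divide_eq_right mult_1_right)
  also have "\<dots> = (\<Sum>i\<in>J. cov_const C * (\<Sum>j\<in>J. 1 / (real (nat \<bar>int i - int j\<bar>) + 1)\<^sup>2))"
    by (simp add: sum_distrib_left)
  also have "\<dots> \<le> (\<Sum>i\<in>J. moment_const C)"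
  proof (rule sum_mono)
    fix i
    have "(\<Sum>j\<in>J. 1 / (real (nat \<bar>int i - int j\<bar>) + 1)\<^sup>2) \<le> 2 * (\<Sum>k. 1 / (real k + 1)\<^sup>2)"
      by (rule sum_abs_diff_le_suminf[OF summable_inverse_square _ J(1)]) simp
    from mult_left_mono[OF this cov_const_nonneg]
    show "cov_const C * (\<Sum>j\<in>J. 1 / (real (nat \<bar>int i - int j\<bar>) + 1)\<^sup>2) \<le> moment_const C"
      by (simp add: moment_const_def)
  qed
  finally show ?thesis by (simp add: second_moment_eq[OF J] mult.commute)
qed

text \<open>Counting by diagonals turns the normalised second moment into a Cesaro-weighted series
  of autocovariances. Nonnegativity of the long-run variance is then inherited from the second
  moments.\<close>

lemma second_moment_limit:
  "(\<lambda>l. expectation (\<lambda>\<omega>. (\<Sum>j = 1..l. centred g j \<omega>)\<^sup>2) / real l) \<longlonglongrightarrow> long_run_variance g"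
proof -
  have "summable (\<lambda>k. \<bar>acov g (Suc k)\<bar>)"
    using summable_Suc_iff[of "\<lambda>k. \<bar>acov g k\<bar>"] summable_acov by simp
  from suminf_weighted_tendsto[OF this]
  have "(\<lambda>l. acov g 0 + 2 * (\<Sum>k<l. (real l - 1 - real k) / real l * acov g (Suc k))) \<longlonglongrightarrow> long_run_variance g"
    unfolding long_run_variance_def by (intro tendsto_intros)
  then show ?thesis
  proof (rule Lim_transform_eventually)
    show "\<forall>\<^sub>F l in sequentially. acov g 0 + 2 * (\<Sum>k<l. (real l - 1 - real k) / real l * acov g (Suc k))
       = expectation (\<lambda>\<omega>. (\<Sum>j = 1..l. centred g j \<omega>)\<^sup>2) / real l"
      using eventually_gt_at_top[of 0]
    proof eventually_elim
      case (elim l)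
      have "expectation (\<lambda>\<omega>. (\<Sum>j = 1..l. centred g j \<omega>)\<^sup>2)
          = real l * acov g 0 + 2 * (\<Sum>k<l. (real l - 1 - real k) * acov g (Suc k))"
        using second_moment_eq[of "{1..l}"] double_sum_abs_diff[of "acov g" l] by simp
      then show ?case using elim by (simp add: add_divide_distrib flip: sum_divide_distrib)
    qed
  qed
qed

lemma long_run_variance_nonneg: "0 \<le> long_run_variance g"
  by (rule tendsto_lowerbound[OF second_moment_limit]) auto

end

text \<open>The series in \<open>sigmaF2\<close> begins with \<open>X 2\<close>, hence with lag 1.
  There each variable is centred at its own mean and here at the mean of index 1. Stationarity
  identifies the two.\<close>

lemma sigmaF2_eq: "sigmaF2 M (\<lambda>i. X (int i)) = long_run_variance F"
proof -
  have "covar M (\<lambda>\<omega>. F (X 1 \<omega>)) (\<lambda>\<omega>. F (X (int (Suc k)) \<omega>)) = acov F k" for k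
    using stationary_X1[of F "int (Suc k)"]
    by (simp add: covar_def acov_def centred_def)
  from this[of 0] this[of "Suc k" for k] show ?thesis
    by (simp add: sigmaF2_def long_run_variance_def)
qed

end

section \<open>The limit of absolute block sums\<close>

lemma norm_iexp_diff_le: "norm (iexp x - iexp y) \<le> \<bar>x - y\<bar>"
proof -
  have "iexp x - iexp y = iexp y * (iexp (x - y) - 1)"
    by (simp add: right_diff_distrib algebra_simps flip: exp_add)
  then have "norm (iexp x - iexp y) = norm (iexp (x - y) - 1)" by (simp add: norm_mult)
  also have "\<dots> \<le> \<bar>x - y\<bar>" using iexp_approx1[of "x - y" 0] by simp
  finally show ?thesis .
qed

lemma std_normal_abs_moment: "(\<integral>x. \<bar>x\<bar> \<partial>std_normal_distribution) = sqrt (2 / pi)"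
  "integrable std_normal_distribution (\<lambda>x. \<bar>x\<bar>)"
  using integral_std_normal_moment_abs_odd[of 0] integrable_std_normal_moment_abs[of 1]
  by (simp_all add: integral_density integrable_density)

lemma std_normal_square_moment: "(\<integral>x. x\<^sup>2 \<partial>std_normal_distribution) = 1"
  "integrable std_normal_distribution (\<lambda>x. x\<^sup>2)"
  using integral_std_normal_moment_even[of 1] integrable_std_normal_moment[of 2]
  by (simp_all add: integral_density integrable_density)

text \<open>Beyond \<open>b\<close> one has \<open>|x| <= x^2 / b\<close>. This is the pointwise
  form of uniform integrability from bounded second moments.\<close>

lemma abs_minus_min_le:
  fixes x b :: real
  assumes "0 < b"
  shows "\<bar>x\<bar> - min \<bar>x\<bar> b \<le> x\<^sup>2 / b"
proof (cases "\<bar>x\<bar> \<le> b")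
  case False
  then have "\<bar>x\<bar> * b \<le> \<bar>x\<bar> * \<bar>x\<bar>" by (intro mult_left_mono) auto
  then have "\<bar>x\<bar> \<le> x\<^sup>2 / b" using assms by (simp add: le_divide_eq power2_eq_square)
  then show ?thesis using assms by simp
qed (use assms in simp)

context prob_space
begin

lemma expectation_abs_le_sqrt:
  fixes U :: "'a \<Rightarrow> real"
  assumes [measurable]: "U \<in> borel_measurable M" and i: "integrable M (\<lambda>x. (U x)\<^sup>2)"
  shows "expectation (\<lambda>x. \<bar>U x\<bar>) \<le> sqrt (expectation (\<lambda>x. (U x)\<^sup>2))"
proof -
  have "integrable M U" using square_integrable_imp_integrable[OF assms] .
  then have "variance (\<lambda>x. \<bar>U x\<bar>) = expectation (\<lambda>x. (U x)\<^sup>2) - (expectation (\<lambda>x. \<bar>U x\<bar>))\<^sup>2"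
    using i by (subst variance_eq) auto
  with variance_positive[of "\<lambda>x. \<bar>U x\<bar>"] show ?thesis by (intro real_le_rsqrt) linarith
qed

lemma abs_mean_minus_truncated_le:
  fixes U :: "'a \<Rightarrow> real"
  assumes [measurable]: "U \<in> borel_measurable M" and i: "integrable M (\<lambda>x. (U x)\<^sup>2)" and b: "0 < b"
  shows "\<bar>expectation (\<lambda>x. \<bar>U x\<bar>) - expectation (\<lambda>x. min \<bar>U x\<bar> b)\<bar> \<le> expectation (\<lambda>x. (U x)\<^sup>2) / b"
proof -
  have U: "integrable M (\<lambda>x. \<bar>U x\<bar>)" using square_integrable_imp_integrable[OF assms(1,2)] by simp
  have m: "integrable M (\<lambda>x. min \<bar>U x\<bar> b)"
    using b by (intro integrable_bounded[of _ b]) auto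
  have "\<bar>expectation (\<lambda>x. \<bar>U x\<bar>) - expectation (\<lambda>x. min \<bar>U x\<bar> b)\<bar>
      = expectation (\<lambda>x. \<bar>U x\<bar> - min \<bar>U x\<bar> b)"
    using U m by (simp add: integral_mono)
  also have "\<dots> \<le> expectation (\<lambda>x. (U x)\<^sup>2 / b)"
    using U m i abs_minus_min_le[OF b] by (intro integral_mono) auto
  finally show ?thesis by simp
qed

text \<open>Bounded second moments make the \<open>|W\<^sub>n|\<close> uniformly integrable, so weak convergence carries
  over to first absolute moments.\<close>
lemma abs_mean_limit:
  fixes W :: "nat \<Rightarrow> 'a \<Rightarrow> real"
  assumes W [measurable]: "\<And>n. W n \<in> borel_measurable M"
    and i: "\<And>n. integrable M (\<lambda>x. (W n x)\<^sup>2)"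
    and D: "\<And>n. expectation (\<lambda>x. (W n x)\<^sup>2) \<le> D"
    and conv: "weak_conv_m (\<lambda>n. distr M borel (W n)) std_normal_distribution"
  shows "(\<lambda>n. expectation (\<lambda>x. \<bar>W n x\<bar>)) \<longlonglongrightarrow> sqrt (2 / pi)"
proof (rule tendstoI)
  fix e :: real assume e: "0 < e"
  interpret N: real_distribution std_normal_distribution by (rule real_dist_normal_dist)
  have D0: "0 \<le> D" using order.trans[OF _ D[of 0], of 0] by simp
  \<comment> \<open>Truncation at \<open>b\<close> costs at most \<open>D / b\<close> for
    \<open>W n\<close> and \<open>1 / b\<close> for the normal law, whose second moment is 1. Taking
    \<open>D + 2\<close> rather than \<open>D + 1\<close> makes the total strictly less than
    \<open>e / 2\<close>. The other half is left for weak convergence.\<close>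
  define b where "b = 2 * (D + 2) / e"
  have b: "0 < b" "(D + 1) / b < e / 2" using e D0 by (auto simp: b_def field_simps)
  have "(\<lambda>n. \<integral>x. min \<bar>x\<bar> b \<partial>distr M borel (W n)) \<longlonglongrightarrow> (\<integral>x. min \<bar>x\<bar> b \<partial>std_normal_distribution)"
    using b
    by (intro weak_conv_imp_integral_bdd_continuous_conv[OF _ real_dist_normal_dist conv, of _ b])
      (auto intro!: continuous_intros real_distribution_distr)
  then have "(\<lambda>n. expectation (\<lambda>x. min \<bar>W n x\<bar> b)) \<longlonglongrightarrow> (\<integral>x. min \<bar>x\<bar> b \<partial>std_normal_distribution)"
    by (simp add: integral_distr)
  from tendstoD[OF this, of "e / 2"] e
  have "\<forall>\<^sub>F n in sequentially. dist (expectation (\<lambda>x. min \<bar>W n x\<bar> b)) (\<integral>x. min \<bar>x\<bar> b \<partial>std_normal_distribution) < e / 2"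
    by simp
  then show "\<forall>\<^sub>F n in sequentially. dist (expectation (\<lambda>x. \<bar>W n x\<bar>)) (sqrt (2 / pi)) < e"
  proof eventually_elim
    case (elim n)
    have "\<bar>sqrt (2 / pi) - (\<integral>x. min \<bar>x\<bar> b \<partial>std_normal_distribution)\<bar> \<le> 1 / b"
      using N.abs_mean_minus_truncated_le[of "\<lambda>x. x" b] b std_normal_abs_moment std_normal_square_moment by simp
    moreover have "\<bar>expectation (\<lambda>x. \<bar>W n x\<bar>) - expectation (\<lambda>x. min \<bar>W n x\<bar> b)\<bar> \<le> D / b"
      using abs_mean_minus_truncated_le[OF W i b(1), of n] divide_right_mono[OF D[of n], of b] b by simp
    moreover have "D / b + 1 / b < e / 2" using b(2) by (simp add: add_divide_distrib)
    ultimately show ?case using elim unfolding dist_real_def by linarith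
  qed
qed

end

text \<open>Blocking scale: with \<open>q\<close> of order \<open>l\<^sup>1\<^sup>/\<^sup>6\<close>, big blocks of length \<open>q\<^sup>2\<close> are separated by
  gaps of length \<open>3 q\<close>.\<close>
definition block_scale :: "nat \<Rightarrow> nat" where
  "block_scale l = nat \<lfloor>root 6 (real l)\<rfloor>"

lemma block_scale_le: "block_scale l ^ 6 \<le> l"
proof -
  have "real (block_scale l) \<le> root 6 (real l)" by (simp add: block_scale_def)
  then have "real (block_scale l) ^ 6 \<le> root 6 (real l) ^ 6" by (intro power_mono) auto
  then have "real (block_scale l ^ 6) \<le> real l" by simp
  then show ?thesis by (simp only: of_nat_le_iff)
qed

lemma le_block_scale:
  assumes "1 \<le> block_scale l"
  shows "l \<le> 64 * block_scale l ^ 6"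
proof -
  have "root 6 (real l) \<le> real (block_scale l) + 1"
    unfolding block_scale_def by (simp add: of_nat_nat)
  also have "\<dots> \<le> 2 * real (block_scale l)" using assms by simp
  finally have "root 6 (real l) ^ 6 \<le> (2 * real (block_scale l)) ^ 6" by (intro power_mono) auto
  then have "real l \<le> real (64 * block_scale l ^ 6)" by (simp add: power_mult_distrib)
  then show ?thesis by (simp only: of_nat_le_iff)
qed

lemma filterlim_block_scale: "filterlim block_scale at_top at_top"
  unfolding filterlim_at_top
proof
  fix n
  show "\<forall>\<^sub>F l in sequentially. n \<le> block_scale l"
    using eventually_ge_at_top[of "n ^ 6"]
  proof eventually_elim
    case (elim l)
    have "root 6 (real n ^ 6) \<le> root 6 (real l)"
      using elim by (intro real_root_le_mono) (auto simp flip: of_nat_power)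
    then have "real n \<le> root 6 (real l)" by (simp add: real_root_power_cancel)
    then show ?case by (simp add: block_scale_def le_nat_floor)
  qed
qed

section \<open>Big blocks and the characteristic function of a partial sum\<close>

context lipschitz_mixing_functional
begin

context
  fixes g C
  assumes g: "approximable C g"
begin

lemma window_approximations:
  assumes "1 \<le> m"
  obtains W :: "int \<Rightarrow> 'a \<Rightarrow> real" where
    "\<And>i. W i \<in> borel_measurable (\<F> {i - int m..i + int m})"
    "\<And>i \<omega>. 0 \<le> W i \<omega>" "\<And>i \<omega>. W i \<omega> \<le> 1"
    "\<And>i. expectation (\<lambda>\<omega>. \<bar>g (X i \<omega>) - W i \<omega>\<bar>) \<le> C / real m ^ 6"
proof -
  have "\<forall>i. \<exists>Q. Q \<in> borel_measurable (\<F> {i - int m..i + int m}) \<and>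
        (\<forall>\<omega>. 0 \<le> Q \<omega> \<and> Q \<omega> \<le> 1) \<and> expectation (\<lambda>\<omega>. \<bar>g (X i \<omega>) - Q \<omega>\<bar>) \<le> C / real m ^ 6"
    using g assms unfolding approximable_def by blast
  from choice[OF this] show ?thesis using that by blast
qed

lemma centred_sum_bound: "\<bar>\<Sum>j\<in>J. centred g j \<omega>\<bar> \<le> real (card J)"
proof -
  have "\<bar>\<Sum>j\<in>J. centred g j \<omega>\<bar> \<le> (\<Sum>j\<in>J. 1)"
    by (intro order.trans[OF sum_abs] sum_mono centred_bound[OF g])
  then show ?thesis by simp
qed

lemma centred_sum_measurable [measurable]: "(\<lambda>\<omega>. \<Sum>j\<in>J. centred g j \<omega>) \<in> borel_measurable M"
  using centred_measurable[OF g] by measurable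

text \<open>A gap of \<open>3 * q\<close> accommodates the window to the right of one block, the
  window to the left of the next, and a distance of \<open>q\<close> for mixing. Factors have norm
  1, so the last one can be peeled off repeatedly at cost \<open>16 * \<alpha> q\<close> each. The
  window error is paid twice, for the expectation of the product and for the product of
  expectations.\<close>

lemma block_product_factorisation:
  fixes \<tau> :: real and q p s r :: nat
  assumes q: "1 \<le> q" and s: "p + 3 * q \<le> s"
  defines "B \<equiv> \<lambda>j \<omega>. \<Sum>i = 1..p. centred g (i + j * s) \<omega>"
  shows "norm (expectation (\<lambda>\<omega>. \<Prod>j<r. iexp (\<tau> * B j \<omega>)) - expectation (\<lambda>\<omega>. iexp (\<tau> * B 0 \<omega>)) ^ r)
    \<le> 2 * real r * \<bar>\<tau>\<bar> * real p * C / real q ^ 6 + 16 * real r * K / real q ^ 8"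
proof -
  define \<mu> where "\<mu> = expectation (\<lambda>\<omega>. g (X 1 \<omega>))"
  note [measurable] = centred_measurable[OF g] approximable_measurable[OF g]
  obtain W :: "int \<Rightarrow> 'a \<Rightarrow> real" where
    WF: "\<And>i. W i \<in> borel_measurable (\<F> {i - int q..i + int q})"
    and W: "\<And>i \<omega>. 0 \<le> W i \<omega>" "\<And>i \<omega>. W i \<omega> \<le> 1"
    "\<And>i. expectation (\<lambda>\<omega>. \<bar>g (X i \<omega>) - W i \<omega>\<bar>) \<le> C / real q ^ 6"
    by (rule window_approximations[OF q]) (rule that)
  note [measurable] = measurable_F[OF WF]
  define B' where "B' j \<omega> = (\<Sum>i = 1..p. W (int (i + j * s)) \<omega> - \<mu>)" for j \<omega>
  define Z where "Z j \<omega> = iexp (\<tau> * B j \<omega>)" for j \<omega>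
  define Z' where "Z' j \<omega> = iexp (\<tau> * B' j \<omega>)" for j \<omega>
  have [measurable]: "B j \<in> borel_measurable M" "B' j \<in> borel_measurable M" for j
    unfolding B_def B'_def by measurable
  have [measurable]: "Z j \<in> borel_measurable M" "Z' j \<in> borel_measurable M" for j
    unfolding Z_def Z'_def by measurable
  have nZ: "norm (Z j \<omega>) = 1" "norm (Z' j \<omega>) = 1" for j \<omega> by (auto simp: Z_def Z'_def)
  have nP: "norm (\<Prod>j<r. Z j \<omega>) = 1" "norm (\<Prod>j<r. Z' j \<omega>) = 1" for r \<omega>
    by (simp_all add: prod_norm[symmetric] nZ)
  have iZ: "integrable M (Z j)" "integrable M (Z' j)" for j
    using nZ by (auto intro!: integrable_bounded[of _ 1])
  have iP: "integrable M (\<lambda>\<omega>. \<Prod>j<r. Z j \<omega>)" "integrable M (\<lambda>\<omega>. \<Prod>j<r. Z' j \<omega>)" for r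
    using nP by (auto intro!: integrable_bounded[of _ 1])
  have nE: "norm (expectation (Z j)) \<le> 1" "norm (expectation (Z' j)) \<le> 1" for j
    using integral_norm_bound[of M "Z j"] integral_norm_bound[of M "Z' j"] by (simp_all add: nZ prob_space)
  have iW: "integrable M (\<lambda>\<omega>. \<bar>g (X i \<omega>) - W i \<omega>\<bar>)" for i
  proof (rule integrable_bounded[of _ 1])
    show "norm \<bar>g (X i \<omega>) - W i \<omega>\<bar> \<le> 1" for \<omega>
      using W(1)[of i \<omega>] W(2)[of i \<omega>] approximable_bounds[OF g, of "X i \<omega>"] by (simp add: abs_le_iff)
  qed measurable
  have close: "expectation (\<lambda>\<omega>. norm (Z j \<omega> - Z' j \<omega>)) \<le> \<bar>\<tau>\<bar> * real p * C / real q ^ 6" for j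
  proof -
    have pt: "norm (Z j \<omega> - Z' j \<omega>) \<le> (\<Sum>i = 1..p. \<bar>\<tau>\<bar> * \<bar>g (X (int (i + j * s)) \<omega>) - W (int (i + j * s)) \<omega>\<bar>)" for \<omega>
    proof -
      have "norm (Z j \<omega> - Z' j \<omega>) \<le> \<bar>\<tau> * (B j \<omega> - B' j \<omega>)\<bar>"
        using norm_iexp_diff_le[of "\<tau> * B j \<omega>" "\<tau> * B' j \<omega>"] by (simp add: Z_def Z'_def right_diff_distrib)
      also have "B j \<omega> - B' j \<omega> = (\<Sum>i = 1..p. g (X (int (i + j * s)) \<omega>) - W (int (i + j * s)) \<omega>)"
        by (simp add: B_def B'_def centred_def \<mu>_def flip: sum_subtractf)
      also have "\<bar>\<tau> * (\<Sum>i = 1..p. g (X (int (i + j * s)) \<omega>) - W (int (i + j * s)) \<omega>)\<bar>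
         \<le> \<bar>\<tau>\<bar> * (\<Sum>i = 1..p. \<bar>g (X (int (i + j * s)) \<omega>) - W (int (i + j * s)) \<omega>\<bar>)"
        unfolding abs_mult by (intro mult_left_mono sum_abs) auto
      finally show ?thesis by (simp add: sum_distrib_left)
    qed
    have "expectation (\<lambda>\<omega>. norm (Z j \<omega> - Z' j \<omega>))
       \<le> expectation (\<lambda>\<omega>. \<Sum>i = 1..p. \<bar>\<tau>\<bar> * \<bar>g (X (int (i + j * s)) \<omega>) - W (int (i + j * s)) \<omega>\<bar>)"
      using iZ iW by (intro integral_mono pt Bochner_Integration.integrable_sum integrable_mult_right integrable_norm
          Bochner_Integration.integrable_diff)
    also have "\<dots> = (\<Sum>i = 1..p. \<bar>\<tau>\<bar> * expectation (\<lambda>\<omega>. \<bar>g (X (int (i + j * s)) \<omega>) - W (int (i + j * s)) \<omega>\<bar>))"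
      using iW by (subst Bochner_Integration.integral_sum) auto
    also have "\<dots> \<le> (\<Sum>i = 1..p. \<bar>\<tau>\<bar> * (C / real q ^ 6))"
      by (intro sum_mono mult_left_mono W) auto
    finally show ?thesis by (simp add: mult_ac)
  qed
  have 1: "norm (expectation (\<lambda>\<omega>. \<Prod>j<r. Z j \<omega>) - expectation (\<lambda>\<omega>. \<Prod>j<r. Z' j \<omega>))
      \<le> real r * (\<bar>\<tau>\<bar> * real p * C / real q ^ 6)"
  proof -
    have "norm (expectation (\<lambda>\<omega>. \<Prod>j<r. Z j \<omega>) - expectation (\<lambda>\<omega>. \<Prod>j<r. Z' j \<omega>))
      = norm (expectation (\<lambda>\<omega>. (\<Prod>j<r. Z j \<omega>) - (\<Prod>j<r. Z' j \<omega>)))" using iP by simp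
    also have "\<dots> \<le> expectation (\<lambda>\<omega>. norm ((\<Prod>j<r. Z j \<omega>) - (\<Prod>j<r. Z' j \<omega>)))" by simp
    also have "\<dots> \<le> expectation (\<lambda>\<omega>. \<Sum>j<r. norm (Z j \<omega> - Z' j \<omega>))"
      using iP iZ by (intro integral_mono norm_prod_diff Bochner_Integration.integrable_sum integrable_norm
          Bochner_Integration.integrable_diff) (auto simp: nZ)
    also have "\<dots> = (\<Sum>j<r. expectation (\<lambda>\<omega>. norm (Z j \<omega> - Z' j \<omega>)))"
      using iZ by (subst Bochner_Integration.integral_sum) auto
    also have "\<dots> \<le> (\<Sum>j<r. \<bar>\<tau>\<bar> * real p * C / real q ^ 6)" by (intro sum_mono close)
    finally show ?thesis by simp
  qed
  have ZF: "Z' j \<in> borel_measurable (\<F> I)" if "{int (j * s) + 1 - int q..int (j * s) + int p + int q} \<subseteq> I" for j I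
  proof -
    have "W (int (i + j * s)) \<in> borel_measurable (\<F> I)" if "i \<in> {1..p}" for i
      using that \<open>_ \<subseteq> I\<close> by (intro measurable_F_mono[OF WF]) (auto simp: subset_eq)
    then show ?thesis unfolding Z'_def B'_def by measurable
  qed
  have 2: "norm (expectation (\<lambda>\<omega>. \<Prod>j<r. Z' j \<omega>) - (\<Prod>j<r. expectation (Z' j))) \<le> real r * (16 * \<alpha> q)" for r
  proof (induction r)
    case (Suc r)
    have "norm (expectation (\<lambda>\<omega>. (\<Prod>j<r. Z' j \<omega>) * Z' r \<omega>) - expectation (\<lambda>\<omega>. \<Prod>j<r. Z' j \<omega>) * expectation (Z' r)) \<le> 16 * \<alpha> q"
    \<comment> \<open>An empty past has no last block, and truncated subtraction would put the
      boundary \<open>n\<close> inside block 0. Otherwise the past ends at \<open>n\<close>, and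
      \<open>p + 3 * q <= s\<close> leaves the required distance \<open>q\<close>.\<close>
    proof (cases "r = 0")
      case True
      then show ?thesis using alpha_mix_nonneg by (simp add: prob_space)
    next
      case False
      define n where "n = int ((r - 1) * s) + int p + int q"
      have rs: "int (r * s) = int ((r - 1) * s) + int s" using False by (cases r) auto
      have "Z' j \<in> borel_measurable (\<F> {..n})" if "j < r" for j
      proof (rule ZF)
        have "j * s \<le> (r - 1) * s" using that by (intro mult_right_mono) auto
        then have "int (j * s) \<le> int ((r - 1) * s)" by (simp only: of_nat_le_iff)
        then show "{int (j * s) + 1 - int q..int (j * s) + int p + int q} \<subseteq> {..n}" by (auto simp: n_def)
      qed
      then have P: "(\<lambda>\<omega>. \<Prod>j<r. Z' j \<omega>) \<in> borel_measurable (\<F> {..n})" by measurable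
      have R: "Z' r \<in> borel_measurable (\<F> {int (r * s) + 1 - int q..})" by (rule ZF) auto
      show ?thesis
        using q s by (intro covariance_complex[OF _ _ P R]) (auto simp: nZ nP n_def rs simp del: of_nat_mult)
    qed
    moreover have "norm ((expectation (\<lambda>\<omega>. \<Prod>j<r. Z' j \<omega>) - (\<Prod>j<r. expectation (Z' j))) * expectation (Z' r)) \<le> real r * (16 * \<alpha> q)"
      using mult_mono[OF Suc nE(2)[of r]] alpha_mix_nonneg by (simp add: norm_mult)
    ultimately have "norm ((expectation (\<lambda>\<omega>. (\<Prod>j<r. Z' j \<omega>) * Z' r \<omega>) - expectation (\<lambda>\<omega>. \<Prod>j<r. Z' j \<omega>) * expectation (Z' r))
       + (expectation (\<lambda>\<omega>. \<Prod>j<r. Z' j \<omega>) - (\<Prod>j<r. expectation (Z' j))) * expectation (Z' r)) \<le> 16 * \<alpha> q + real r * (16 * \<alpha> q)"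
      by (rule order.trans[OF norm_triangle_ineq add_mono])
    then show ?case by (simp add: algebra_simps)
  qed (simp add: prob_space)
  \<comment> \<open>The window functions \<open>W i\<close> are chosen separately for each index, so
    the expectations of \<open>Z' j\<close> may differ with \<open>j\<close>. Stationarity
    identifies the factors only after returning to \<open>Z\<close>.\<close>
  have EZ: "expectation (Z j) = expectation (Z 0)" for j
    unfolding Z_def B_def
    using stationary_centred_sum[OF g, where G = "\<lambda>x. iexp (\<tau> * x)" and J = "{1..p}" and h = "j * s"] by simp
  have 3: "norm ((\<Prod>j<r. expectation (Z' j)) - (\<Prod>j<r. expectation (Z j))) \<le> real r * (\<bar>\<tau>\<bar> * real p * C / real q ^ 6)"
  proof -
    have "norm ((\<Prod>j<r. expectation (Z' j)) - (\<Prod>j<r. expectation (Z j))) \<le> (\<Sum>j<r. norm (expectation (Z' j) - expectation (Z j)))"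
      by (intro norm_prod_diff nE)
    also have "\<dots> \<le> (\<Sum>j<r. \<bar>\<tau>\<bar> * real p * C / real q ^ 6)"
    proof (rule sum_mono)
      fix j
      have "norm (expectation (Z' j) - expectation (Z j)) = norm (expectation (\<lambda>\<omega>. Z j \<omega> - Z' j \<omega>))"
        using iZ by (simp add: norm_minus_commute)
      also have "\<dots> \<le> expectation (\<lambda>\<omega>. norm (Z j \<omega> - Z' j \<omega>))" by simp
      also note close[of j]
      finally show "norm (expectation (Z' j) - expectation (Z j)) \<le> \<bar>\<tau>\<bar> * real p * C / real q ^ 6" .
    qed
    finally show ?thesis by simp
  qed
  have "(\<Prod>j<r. expectation (Z j)) = (\<Prod>j<r. expectation (Z 0))" by (rule prod.cong[OF refl EZ])
  then have "(\<Prod>j<r. expectation (Z j)) = expectation (Z 0) ^ r" by simp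
  then have "norm (expectation (\<lambda>\<omega>. \<Prod>j<r. Z j \<omega>) - expectation (Z 0) ^ r)
     \<le> real r * (\<bar>\<tau>\<bar> * real p * C / real q ^ 6) + real r * (16 * \<alpha> q) + real r * (\<bar>\<tau>\<bar> * real p * C / real q ^ 6)"
    using norm_triangle_le[OF add_mono[OF norm_triangle_le[OF add_mono[OF 1 2[of r]]] 3]]
    by (simp add: algebra_simps)
  also have "\<dots> \<le> real r * (\<bar>\<tau>\<bar> * real p * C / real q ^ 6) + real r * (16 * (K / real q ^ 8)) + real r * (\<bar>\<tau>\<bar> * real p * C / real q ^ 6)"
    using alpha_le[OF q] by (intro add_mono mult_left_mono) auto
  finally show ?thesis by (simp add: Z_def[abs_def] algebra_simps)
qed

text \<open>The omitted indices, gaps and an incomplete tail, form an irregular set, but the second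
  moment bound depends only on their number \<open>l - r * p\<close>.\<close>

lemma big_blocks_remainder:
  fixes \<tau> :: real and p s r l :: nat
  assumes s: "p \<le> s" and l: "r * s \<le> l"
  defines "B \<equiv> \<lambda>j \<omega>. \<Sum>i = 1..p. centred g (i + j * s) \<omega>"
  shows "norm (expectation (\<lambda>\<omega>. iexp (\<tau> * (\<Sum>j = 1..l. centred g j \<omega>))) - expectation (\<lambda>\<omega>. \<Prod>j<r. iexp (\<tau> * B j \<omega>)))
    \<le> \<bar>\<tau>\<bar> * sqrt (moment_const C * (real l - real r * real p))"
proof -
  note [measurable] = centred_measurable[OF g]
  let ?h = "\<lambda>(j, i). i + j * s"
  define J where "J = ?h ` ({..<r} \<times> {1..p})"
  have inj: "inj_on ?h ({..<r} \<times> {1..p})"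
  proof (rule inj_onI, clarsimp)
    fix j i j' i' :: nat
    assume *: "Suc 0 \<le> i" "i \<le> p" "Suc 0 \<le> i'" "i' \<le> p" "i + j * s = i' + j' * s"
    have "s > 0" using * s by linarith
    \<comment> \<open>Positions inside a block run from 1 to \<open>p\<close>, so
      \<open>i - 1 < s\<close> and division by \<open>s\<close> recovers the block number.\<close>
    have d: "(i + j * s - 1) div s = j" if "Suc 0 \<le> i" "i \<le> p" for i j
    proof -
      have "i + j * s - 1 = (i - 1) + j * s" using that by simp
      moreover have "((i - 1) + j * s) div s = j"
        using that s \<open>s > 0\<close> by (subst div_mult_self1) (auto intro!: div_less)
      ultimately show ?thesis by (simp only:)
    qed
    have "j = j'" using d[OF *(1,2), of j] d[OF *(3,4), of j'] *(5) by simp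
    then show "j = j' \<and> i = i'" using * by simp
  qed
  have J: "finite J" "J \<subseteq> {1..l}" "card J = r * p"
  proof -
    show "finite J" by (simp add: J_def)
    show "card J = r * p" using card_image[OF inj] by (simp add: J_def)
    show "J \<subseteq> {1..l}"
    proof
      fix x assume "x \<in> J"
      then obtain j i where *: "j < r" "1 \<le> i" "i \<le> p" "x = i + j * s" by (auto simp: J_def)
      have "(j + 1) * s \<le> r * s" using *(1) by (intro mult_right_mono) auto
      then show "x \<in> {1..l}" using * s l by simp
    qed
  qed
  have sumB: "(\<Sum>j<r. B j \<omega>) = (\<Sum>j\<in>J. centred g j \<omega>)" for \<omega>
    unfolding J_def B_def by (subst sum.reindex[OF inj]) (simp add: sum.cartesian_product case_prod_unfold)
  let ?R = "{1..l} - J"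
  have diff: "(\<Sum>j = 1..l. centred g j \<omega>) - (\<Sum>j<r. B j \<omega>) = (\<Sum>j\<in>?R. centred g j \<omega>)" for \<omega>
    unfolding sumB using J by (subst sum_diff) auto
  have cardR: "real (card ?R) = real l - real r * real p"
    using J card_mono[OF _ J(2)] by (simp add: card_Diff_subset of_nat_diff)
  have prod: "(\<Prod>j<r. iexp (\<tau> * B j \<omega>)) = iexp (\<tau> * (\<Sum>j<r. B j \<omega>))" for \<omega>
    by (simp add: exp_sum[symmetric] sum_distrib_left)
  have [measurable]: "B j \<in> borel_measurable M" for j unfolding B_def by measurable
  have i: "integrable M (\<lambda>\<omega>. iexp (U \<omega>))" if [measurable]: "U \<in> borel_measurable M" for U :: "'a \<Rightarrow> real"
    by (intro integrable_bounded[of _ 1]) auto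
  have "norm (expectation (\<lambda>\<omega>. iexp (\<tau> * (\<Sum>j = 1..l. centred g j \<omega>))) - expectation (\<lambda>\<omega>. iexp (\<tau> * (\<Sum>j<r. B j \<omega>))))
      = norm (expectation (\<lambda>\<omega>. iexp (\<tau> * (\<Sum>j = 1..l. centred g j \<omega>)) - iexp (\<tau> * (\<Sum>j<r. B j \<omega>))))"
    by (intro arg_cong[where f = norm] Bochner_Integration.integral_diff[symmetric] i) measurable
  also have "\<dots> \<le> expectation (\<lambda>\<omega>. norm (iexp (\<tau> * (\<Sum>j = 1..l. centred g j \<omega>)) - iexp (\<tau> * (\<Sum>j<r. B j \<omega>))))"
    by (rule integral_norm_bound)
  also have "\<dots> \<le> expectation (\<lambda>\<omega>. \<bar>\<tau>\<bar> * \<bar>\<Sum>j\<in>?R. centred g j \<omega>\<bar>)"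
  proof (rule integral_mono)
    show "integrable M (\<lambda>\<omega>. norm (iexp (\<tau> * (\<Sum>j = 1..l. centred g j \<omega>)) - iexp (\<tau> * (\<Sum>j<r. B j \<omega>))))"
      by (intro integrable_norm Bochner_Integration.integrable_diff i) measurable
    show "integrable M (\<lambda>\<omega>. \<bar>\<tau>\<bar> * \<bar>\<Sum>j\<in>?R. centred g j \<omega>\<bar>)"
      by (intro integrable_mult_right integrable_abs Bochner_Integration.integrable_sum integrable_centred[OF g])
    show "norm (iexp (\<tau> * (\<Sum>j = 1..l. centred g j \<omega>)) - iexp (\<tau> * (\<Sum>j<r. B j \<omega>))) \<le> \<bar>\<tau>\<bar> * \<bar>\<Sum>j\<in>?R. centred g j \<omega>\<bar>" for \<omega>
      using norm_iexp_diff_le[of "\<tau> * (\<Sum>j = 1..l. centred g j \<omega>)" "\<tau> * (\<Sum>j<r. B j \<omega>)"]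
      by (simp only: right_diff_distrib[symmetric] diff abs_mult)
  qed
  also have "\<dots> = \<bar>\<tau>\<bar> * expectation (\<lambda>\<omega>. \<bar>\<Sum>j\<in>?R. centred g j \<omega>\<bar>)" by simp
  also have "\<dots> \<le> \<bar>\<tau>\<bar> * sqrt (moment_const C * (real l - real r * real p))"
  proof (rule mult_left_mono)
    have "expectation (\<lambda>\<omega>. \<bar>\<Sum>j\<in>?R. centred g j \<omega>\<bar>) \<le> sqrt (expectation (\<lambda>\<omega>. (\<Sum>j\<in>?R. centred g j \<omega>)\<^sup>2))"
      by (intro expectation_abs_le_sqrt integrable_centred_sum_sq[OF g]) auto
    also have "\<dots> \<le> sqrt (moment_const C * (real l - real r * real p))"
      using second_moment_le[OF g, where J = ?R] unfolding cardR by (intro real_sqrt_le_mono) force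
    finally show "expectation (\<lambda>\<omega>. \<bar>\<Sum>j\<in>?R. centred g j \<omega>\<bar>) \<le> sqrt (moment_const C * (real l - real r * real p))" .
  qed auto
  finally show ?thesis by (simp only: prod)
qed

text \<open>The third absolute moment is controlled without any higher moment inequality: a block
  sum is bounded by its length \<open>p\<close>, so \<open>|B|^3 <= p * B^2\<close>, and the second
  moment supplies another factor \<open>p\<close>.\<close>

lemma block_taylor:
  fixes \<tau> :: real and p :: nat
  shows "norm (expectation (\<lambda>\<omega>. iexp (\<tau> * (\<Sum>i = 1..p. centred g i \<omega>)))
      - (1 - \<tau>\<^sup>2 * expectation (\<lambda>\<omega>. (\<Sum>i = 1..p. centred g i \<omega>)\<^sup>2) / 2))
    \<le> \<bar>\<tau>\<bar> ^ 3 * moment_const C * (real p)\<^sup>2 / 6"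
proof -
  note [measurable] = centred_measurable[OF g]
  let ?B = "\<lambda>\<omega>. \<Sum>i = 1..p. centred g i \<omega>"
  have sq: "integrable M (\<lambda>\<omega>. (?B \<omega>)\<^sup>2)" by (rule integrable_centred_sum_sq[OF g]) simp
  have E0: "expectation ?B = 0"
    using integrable_centred[OF g] expectation_centred[OF g] by simp
  have "norm (char (distr M borel ?B) \<tau> - (1 - \<tau>\<^sup>2 * expectation (\<lambda>\<omega>. (?B \<omega>)\<^sup>2) / 2))
     \<le> \<tau>\<^sup>2 / 6 * expectation (\<lambda>\<omega>. min (6 * (?B \<omega>)\<^sup>2) (\<bar>\<tau>\<bar> * \<bar>?B \<omega>\<bar> ^ 3))"
    using integrable_centred[OF g] E0 sq by (intro char_approx3') auto
  also have "\<dots> \<le> \<tau>\<^sup>2 / 6 * expectation (\<lambda>\<omega>. \<bar>\<tau>\<bar> * real p * (?B \<omega>)\<^sup>2)"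
  proof (intro mult_left_mono integral_mono)
    show "integrable M (\<lambda>\<omega>. min (6 * (?B \<omega>)\<^sup>2) (\<bar>\<tau>\<bar> * \<bar>?B \<omega>\<bar> ^ 3))"
      using sq by (intro Bochner_Integration.integrable_bound[OF integrable_mult_right[OF sq, of 6]]) auto
    show "min (6 * (?B \<omega>)\<^sup>2) (\<bar>\<tau>\<bar> * \<bar>?B \<omega>\<bar> ^ 3) \<le> \<bar>\<tau>\<bar> * real p * (?B \<omega>)\<^sup>2" for \<omega>
    proof -
      have "\<bar>?B \<omega>\<bar> * (?B \<omega>)\<^sup>2 \<le> real p * (?B \<omega>)\<^sup>2"
        using centred_sum_bound[where J = "{1..p}" and \<omega> = \<omega>] by (intro mult_right_mono) auto
      moreover have "\<bar>?B \<omega>\<bar> ^ 3 = \<bar>?B \<omega>\<bar> * (?B \<omega>)\<^sup>2"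
        by (simp add: power2_eq_square power3_eq_cube flip: abs_mult)
      ultimately have "\<bar>\<tau>\<bar> * \<bar>?B \<omega>\<bar> ^ 3 \<le> \<bar>\<tau>\<bar> * (real p * (?B \<omega>)\<^sup>2)" by (intro mult_left_mono) auto
      then show ?thesis by (simp add: min.coboundedI2 mult.assoc)
    qed
  qed (use sq in auto)
  also have "\<dots> = \<tau>\<^sup>2 / 6 * (\<bar>\<tau>\<bar> * real p * expectation (\<lambda>\<omega>. (?B \<omega>)\<^sup>2))" by simp
  also have "\<dots> \<le> \<tau>\<^sup>2 / 6 * (\<bar>\<tau>\<bar> * real p * (moment_const C * real p))"
    using second_moment_le[OF g, where J = "{1..p}"] by (intro mult_left_mono) auto
  also have "\<dots> = \<bar>\<tau>\<bar> ^ 3 * moment_const C * (real p)\<^sup>2 / 6"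
    by (simp add: power2_eq_square power3_eq_cube)
  finally show ?thesis by (simp add: char_def integral_distr)
qed

lemma characteristic_function_limit:
  fixes t :: real
  shows "(\<lambda>l. expectation (\<lambda>\<omega>. iexp (t / sqrt (real l) * (\<Sum>j = 1..l. centred g j \<omega>))))
     \<longlonglongrightarrow> complex_of_real (exp (- (t\<^sup>2 * long_run_variance g / 2)))"
proof -
  define v where "v = long_run_variance g"
  define A where "A = moment_const C"
  have v0: "0 \<le> v" and A0: "0 \<le> A" and C0: "0 \<le> C"
    using long_run_variance_nonneg[OF g] moment_const_nonneg[OF g] approximable_const_nonneg[OF g]
    by (simp_all add: v_def A_def)
  define q where "q = block_scale"
  define p where "p l = (q l)\<^sup>2" for l
  define s where "s l = p l + 3 * q l" for l
  define r where "r l = l div s l" for l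
  define V where "V n = expectation (\<lambda>\<omega>. (\<Sum>j = 1..n. centred g j \<omega>)\<^sup>2)" for n
  define \<phi> where "\<phi> l = expectation (\<lambda>\<omega>. iexp (t / sqrt (real l) * (\<Sum>j = 1..l. centred g j \<omega>)))" for l
  \<comment> \<open>The exact block variance is replaced by its limiting share \<open>v / r\<close>,
    so that the classical limit of \<open>(1 + x / r)^r\<close> applies. The discrepancy
    \<open>r * V p / l - v\<close> vanishes because \<open>r * p / l\<close> tends to 1.\<close>
  define w where "w l = 1 + (- (t\<^sup>2 * v / 2)) / real (r l)" for l
  \<comment> \<open>The terms stand for the indices outside big blocks, window replacement, mixing,
    the Taylor remainder and the variance discrepancy. With \<open>q^6 <= l <= 64 * q^6\<close> the
    middle three are of order \<open>sqrt l / q^6\<close>, \<open>r / q^8\<close> and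
    \<open>q^2 / sqrt l\<close>, each at most a multiple of \<open>1 / q\<close>. The constants are
    \<open>16 = 2 * 8\<close> and \<open>1024 = 16 * 64\<close>.\<close>
  define err where "err l = \<bar>t\<bar> * sqrt (A * (7 / real (q l))) + 16 * \<bar>t\<bar> * C * (1 / real (q l))
      + 1024 * K * (1 / real (q l)) + \<bar>t\<bar> ^ 3 * A * (1 / real (q l))
      + t\<^sup>2 / 2 * \<bar>real (r l) * V (p l) / real l - v\<bar>" for l
  have qtop: "filterlim q at_top at_top" unfolding q_def by (rule filterlim_block_scale)
  have arith: "r l * s l \<le> l" "q l \<le> r l" "real l - real (r l) * real (p l) \<le> real l * (7 / real (q l))"
      "0 \<le> real l - real (r l) * real (p l)" "real (r l) * real (p l) \<le> real l"
      "sqrt (real l) \<le> 8 * real (q l) ^ 3" "real (q l) ^ 3 \<le> sqrt (real l)"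
      "real (r l) \<le> 64 * real (q l) ^ 4" if q2: "2 \<le> q l" for l
  proof -
    have lo: "q l ^ 6 \<le> l" and hi: "l \<le> 64 * q l ^ 6"
      using block_scale_le[of l] le_block_scale[of l] q2 by (auto simp: q_def)
    have rlo: "real (q l) ^ 6 \<le> real l" and rhi: "real l \<le> 64 * real (q l) ^ 6"
    proof -
      have "real (q l ^ 6) \<le> real l" "real l \<le> real (64 * q l ^ 6)"
        using lo hi by (simp_all only: of_nat_le_iff)
      then show "real (q l) ^ 6 \<le> real l" "real l \<le> 64 * real (q l) ^ 6" by simp_all
    qed
    have sp: "0 < s l" using q2 by (simp add: s_def)
    show rs: "r l * s l \<le> l" by (simp add: r_def)
    have rs': "l < r l * s l + s l" using dividend_less_div_times[OF sp, of l] by (simp add: r_def)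
    have s4: "s l \<le> 4 * (q l)\<^sup>2"
      using q2 by (simp add: s_def p_def power2_eq_square)
    \<comment> \<open>For \<open>q l >= 2\<close> one has \<open>4 <= q l ^ 3\<close>, so
      \<open>4 * q l ^ 3 <= q l ^ 6 <= l\<close>. Hence at least \<open>q l\<close> periods fit, and
      their number tends to infinity.\<close>
    have "q l * s l \<le> q l * (4 * (q l)\<^sup>2)" using s4 by simp
    also have "\<dots> = 2\<^sup>2 * q l ^ 3" by (simp add: power2_eq_square power3_eq_cube)
    also have "\<dots> \<le> q l ^ 3 * q l ^ 3"
      using power_mono[OF q2, of 3] by (intro mult_right_mono) auto
    also have "\<dots> \<le> l" using lo by (simp flip: power_add)
    finally show "q l \<le> r l" using sp by (simp add: r_def less_eq_div_iff_mult_less_eq)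
    have qpos: "0 < real (q l)" using q2 by simp
    have rp: "r l * p l \<le> l" using rs by (rule order.trans[rotated]) (simp add: s_def)
    then have "real (r l * p l) \<le> real l" by (simp only: of_nat_le_iff)
    then show rpl': "real (r l) * real (p l) \<le> real l" by simp
    then show "0 \<le> real l - real (r l) * real (p l)" by simp
    have rpl: "real (r l) * real (q l) \<le> real l / real (q l)"
      using rpl' qpos by (simp add: p_def le_divide_eq power2_eq_square mult.assoc)
    have "real (s l) \<le> real (4 * (q l)\<^sup>2)" using s4 by (simp only: of_nat_le_iff)
    also have "\<dots> = 4 * (real (q l))\<^sup>2" by simp
    also have "\<dots> \<le> 4 * (real l / real (q l))"
    proof -
      have "(real (q l))\<^sup>2 * real (q l) \<le> real (q l) ^ 6"
        using q2 power_increasing[of 3 6 "real (q l)"] by (simp add: power2_eq_square power3_eq_cube)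
      from order.trans[OF this rlo] have "(real (q l))\<^sup>2 \<le> real l / real (q l)" using qpos by (simp add: le_divide_eq)
      then show ?thesis by simp
    qed
    finally have sl: "real (s l) \<le> 4 * (real l / real (q l))" .
    have "real l \<le> real (r l * s l + s l)" using rs' by (simp only: of_nat_le_iff)
    also have "\<dots> = real (r l) * real (p l) + 3 * (real (r l) * real (q l)) + real (s l)"
      by (simp add: s_def algebra_simps)
    \<comment> \<open>7 is 3 + 4: the gaps contribute \<open>3 * q\<close> for each of
      \<open>r\<close> periods, and the incomplete last period is shorter than
      \<open>s <= 4 * q^2\<close>.\<close>
    finally have "real l - real (r l) * real (p l) \<le> 7 * (real l / real (q l))"
      using sl rpl by linarith
    then show "real l - real (r l) * real (p l) \<le> real l * (7 / real (q l))" by (simp add: mult.commute)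
    have q6: "(real (q l) ^ 3)\<^sup>2 = real (q l) ^ 6" "64 * real (q l) ^ 4 * (real (q l))\<^sup>2 = 64 * real (q l) ^ 6"
      by (simp_all flip: power_mult power_add)
    show "sqrt (real l) \<le> 8 * real (q l) ^ 3"
      using rhi by (intro real_le_lsqrt) (simp_all add: power_mult_distrib q6)
    show "real (q l) ^ 3 \<le> sqrt (real l)"
      using rlo by (intro real_le_rsqrt) (simp add: q6)
    have "real (r l) * (real (q l))\<^sup>2 \<le> 64 * real (q l) ^ 4 * (real (q l))\<^sup>2"
      unfolding q6 using order.trans[OF \<open>real (r l) * real (p l) \<le> real l\<close> rhi] by (simp add: p_def)
    then show "real (r l) \<le> 64 * real (q l) ^ 4" using qpos by (simp add: mult_le_cancel_right)
  qed
  have q2: "\<forall>\<^sub>F l in sequentially. 2 \<le> q l"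
    using qtop unfolding filterlim_at_top by blast
  have ptop: "filterlim p at_top at_top"
  proof (rule filterlim_at_top_mono[OF qtop])
    show "\<forall>\<^sub>F l in sequentially. q l \<le> p l" by (simp add: p_def power2_eq_square)
  qed
  have rtop: "filterlim r at_top at_top"
    by (rule filterlim_at_top_mono[OF qtop]) (use q2 arith(2) in \<open>auto elim: eventually_mono\<close>)
  have invq: "(\<lambda>l. 1 / real (q l)) \<longlonglongrightarrow> 0"
    using tendsto_compose_filtermap filterlim_compose[OF lim_1_over_n qtop] by blast
  have ratio: "(\<lambda>l. real (r l) * real (p l) / real l) \<longlonglongrightarrow> 1"
  proof (rule tendsto_sandwich)
    show "\<forall>\<^sub>F l in sequentially. 1 - 7 * (1 / real (q l)) \<le> real (r l) * real (p l) / real l"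
      using q2 eventually_gt_at_top[of 0]
      by eventually_elim (use arith(3) in \<open>simp add: field_simps\<close>)
    show "\<forall>\<^sub>F l in sequentially. real (r l) * real (p l) / real l \<le> 1"
      using q2 eventually_gt_at_top[of 0]
      by eventually_elim (use arith(5) in \<open>simp add: divide_le_eq\<close>)
    have "(\<lambda>l. 1 - 7 * (1 / real (q l))) \<longlonglongrightarrow> 1 - 7 * 0" by (intro tendsto_intros invq)
    then show "(\<lambda>l. 1 - 7 * (1 / real (q l))) \<longlonglongrightarrow> 1" by simp
  qed simp
  have Vlim: "(\<lambda>l. real (r l) * V (p l) / real l) \<longlonglongrightarrow> v"
  proof -
    have "(\<lambda>l. V (p l) / real (p l)) \<longlonglongrightarrow> v"
      using filterlim_compose[OF second_moment_limit[OF g] ptop] by (simp add: V_def v_def)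
    from tendsto_mult[OF ratio this] have "(\<lambda>l. real (r l) * real (p l) / real l * (V (p l) / real (p l))) \<longlonglongrightarrow> v" by simp
    then show ?thesis
    proof (rule Lim_transform_eventually)
      show "\<forall>\<^sub>F l in sequentially. real (r l) * real (p l) / real l * (V (p l) / real (p l)) = real (r l) * V (p l) / real l"
        using q2 by eventually_elim (auto simp: p_def)
    qed
  qed
  have "err \<longlonglongrightarrow> \<bar>t\<bar> * sqrt (A * (7 * 0)) + 16 * \<bar>t\<bar> * C * 0 + 1024 * K * 0 + \<bar>t\<bar> ^ 3 * A * 0 + t\<^sup>2 / 2 * \<bar>v - v\<bar>"
  proof -
    have "(\<lambda>l. 7 / real (q l)) \<longlonglongrightarrow> 7 * 0" using tendsto_mult_left[OF invq, of 7] by simp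
    then show ?thesis unfolding err_def[abs_def] by (intro tendsto_intros invq Vlim)
  qed
  then have err0: "err \<longlonglongrightarrow> 0" by simp
  have "\<forall>\<^sub>F l in sequentially. norm (\<phi> l - complex_of_real (w l) ^ r l) \<le> err l"
  proof -
    have "\<forall>\<^sub>F l in sequentially. nat \<lceil>t\<^sup>2 * v\<rceil> \<le> r l"
      using rtop unfolding filterlim_at_top by blast
    with q2 show ?thesis
    proof eventually_elim
      case (elim l)
      note ar = arith[OF elim(1)]
      have qpos: "0 < real (q l)" "1 \<le> real (q l)" using elim(1) by auto
      have lpos: "0 < real l"
        using block_scale_le[of l] elim(1) by (cases "l = 0") (auto simp: q_def)
      have sl: "0 < sqrt (real l)" using lpos by simp
      have rpos: "0 < real (r l)" using ar(2) elim(1) by simp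
      define \<tau> where "\<tau> = t / sqrt (real l)"
      have \<tau>2: "\<tau>\<^sup>2 = t\<^sup>2 / real l" by (simp add: \<tau>_def power_divide)
      have a\<tau>: "\<bar>\<tau>\<bar> = \<bar>t\<bar> / sqrt (real l)" by (simp add: \<tau>_def abs_divide)
      let ?Z = "expectation (\<lambda>\<omega>. iexp (\<tau> * (\<Sum>i = 1..p l. centred g i \<omega>)))"
      let ?P = "expectation (\<lambda>\<omega>. \<Prod>j<r l. iexp (\<tau> * (\<Sum>i = 1..p l. centred g (i + j * s l) \<omega>)))"
      have e1: "norm (\<phi> l - ?P) \<le> \<bar>t\<bar> * sqrt (A * (7 / real (q l)))"
      proof -
        have "norm (\<phi> l - ?P) \<le> \<bar>\<tau>\<bar> * sqrt (A * (real l - real (r l) * real (p l)))"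
          unfolding \<phi>_def \<tau>_def A_def using ar(1) by (intro big_blocks_remainder) (simp_all add: s_def)
        also have "\<dots> \<le> \<bar>\<tau>\<bar> * sqrt (A * (real l * (7 / real (q l))))"
          using ar(3) A0 by (intro mult_left_mono real_sqrt_le_mono) auto
        also have "\<dots> = \<bar>t\<bar> * sqrt (A * (7 / real (q l)))"
        proof -
          have "A * (real l * (7 / real (q l))) = real l * (A * (7 / real (q l)))" by simp
          then show ?thesis using sl by (simp only: a\<tau> real_sqrt_mult[of "real l"]) simp
        qed
        finally show ?thesis .
      qed
      have e2: "norm (?P - ?Z ^ r l) \<le> 16 * \<bar>t\<bar> * C * (1 / real (q l)) + 1024 * K * (1 / real (q l))"
      proof -
        have "norm (?P - ?Z ^ r l) \<le> 2 * real (r l) * \<bar>\<tau>\<bar> * real (p l) * C / real (q l) ^ 6 + 16 * real (r l) * K / real (q l) ^ 8"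
          using block_product_factorisation[of "q l" "p l" "s l" \<tau> "r l"] elim(1) by (simp add: s_def)
        also have "2 * real (r l) * \<bar>\<tau>\<bar> * real (p l) * C / real (q l) ^ 6
            = (real (r l) * real (p l)) * (2 * \<bar>\<tau>\<bar> * C / real (q l) ^ 6)" by simp
        also have "\<dots> \<le> real l * (2 * \<bar>\<tau>\<bar> * C / real (q l) ^ 6)"
          using ar(5) C0 by (intro mult_right_mono) auto
        also have "\<dots> = 2 * \<bar>t\<bar> * C * (sqrt (real l) / real (q l) ^ 6)"
        proof -
          have "real l * \<bar>\<tau>\<bar> = \<bar>t\<bar> * sqrt (real l)" using real_div_sqrt[of "real l"] unfolding a\<tau> by (metis mult.commute of_nat_0_le_iff times_divide_eq_right)
          moreover have "real l * (2 * \<bar>\<tau>\<bar> * C / real (q l) ^ 6) = 2 * (real l * \<bar>\<tau>\<bar>) * C / real (q l) ^ 6" by simp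
          ultimately show ?thesis by simp
        qed
        also have "\<dots> \<le> 2 * \<bar>t\<bar> * C * (8 * (1 / real (q l)))"
        proof (rule mult_left_mono)
          have "sqrt (real l) / real (q l) ^ 6 \<le> 8 * real (q l) ^ 3 / real (q l) ^ 6"
            using ar(6) by (intro divide_right_mono) auto
          also have "\<dots> = 8 * (1 / real (q l) ^ 3)"
            using qpos by (simp add: field_simps flip: power_add)
          also have "\<dots> \<le> 8 * (1 / real (q l) ^ 1)"
            using qpos power_increasing[of 1 3 "real (q l)"] by (intro mult_left_mono divide_left_mono) auto
          finally show "sqrt (real l) / real (q l) ^ 6 \<le> 8 * (1 / real (q l))" by simp
        qed (use C0 in auto)
        also have "16 * real (r l) * K / real (q l) ^ 8 \<le> 1024 * K * (1 / real (q l))"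
        proof -
          have "16 * real (r l) * K / real (q l) ^ 8 \<le> 16 * (64 * real (q l) ^ 4) * K / real (q l) ^ 8"
            using ar(8) K_nonneg by (intro divide_right_mono mult_right_mono) auto
          also have "\<dots> = 1024 * K * (1 / real (q l) ^ 4)"
            using qpos by (simp add: field_simps flip: power_add)
          also have "\<dots> \<le> 1024 * K * (1 / real (q l) ^ 1)"
            using qpos K_nonneg power_increasing[of 1 4 "real (q l)"] by (intro mult_left_mono divide_left_mono) auto
          finally show ?thesis by simp
        qed
        finally show ?thesis by simp
      qed
      have nZ: "norm ?Z \<le> 1"
        using integral_norm_bound[of M "\<lambda>\<omega>. iexp (\<tau> * (\<Sum>i = 1..p l. centred g i \<omega>))"] by (simp add: prob_space)
      \<comment> \<open>Comparing \<open>r\<close>-th powers by \<open>r\<close> times the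
        difference of the bases requires both bases in the unit disc. Once
        \<open>r >= t^2 * v\<close>, the number \<open>w l\<close> lies between 0 and 1.\<close>
      have nw: "norm (complex_of_real (w l)) \<le> 1"
      proof -
        have "t\<^sup>2 * v \<le> real (r l)" using elim(2) by (simp add: nat_le_iff ceiling_le_iff)
        then have "t\<^sup>2 * v / 2 / real (r l) \<le> 1" "0 \<le> t\<^sup>2 * v / 2 / real (r l)"
          using rpos v0 by (simp_all add: divide_le_eq)
        then show ?thesis unfolding norm_of_real w_def by (simp add: abs_le_iff)
      qed
      have e3: "norm (?Z ^ r l - complex_of_real (w l) ^ r l)
          \<le> \<bar>t\<bar> ^ 3 * A * (1 / real (q l)) + t\<^sup>2 / 2 * \<bar>real (r l) * V (p l) / real l - v\<bar>"
      proof -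
        have "norm (?Z ^ r l - complex_of_real (w l) ^ r l) \<le> real (r l) * norm (?Z - complex_of_real (w l))"
          by (rule norm_power_diff[OF nZ nw])
        also have "\<dots> \<le> real (r l) * (norm (?Z - (1 - \<tau>\<^sup>2 * V (p l) / 2)) + \<bar>(1 - \<tau>\<^sup>2 * V (p l) / 2) - w l\<bar>)"
        proof (rule mult_left_mono)
          have "norm (complex_of_real (1 - \<tau>\<^sup>2 * V (p l) / 2 - w l)) = \<bar>(1 - \<tau>\<^sup>2 * V (p l) / 2) - w l\<bar>"
            by (rule norm_of_real)
          then show "norm (?Z - complex_of_real (w l)) \<le> norm (?Z - (1 - \<tau>\<^sup>2 * V (p l) / 2)) + \<bar>(1 - \<tau>\<^sup>2 * V (p l) / 2) - w l\<bar>"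
            using norm_triangle_ineq[of "?Z - (1 - \<tau>\<^sup>2 * V (p l) / 2)" "complex_of_real (1 - \<tau>\<^sup>2 * V (p l) / 2 - w l)"]
            by simp
        qed simp
        also have "\<dots> \<le> real (r l) * (\<bar>\<tau>\<bar> ^ 3 * A * (real (p l))\<^sup>2 / 6 + \<bar>(1 - \<tau>\<^sup>2 * V (p l) / 2) - w l\<bar>)"
          using block_taylor[of \<tau> "p l"] by (intro mult_left_mono add_right_mono) (auto simp: V_def A_def)
        also have "\<dots> = real (r l) * real (p l) * (\<bar>\<tau>\<bar> ^ 3 * A * real (p l) / 6)
            + \<bar>real (r l) * ((1 - \<tau>\<^sup>2 * V (p l) / 2) - w l)\<bar>"
        proof -
          have "real (r l) * \<bar>x\<bar> = \<bar>real (r l) * x\<bar>" for x by (simp add: abs_mult)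
          then show ?thesis unfolding distrib_left power2_eq_square by simp
        qed
        also have "real (r l) * ((1 - \<tau>\<^sup>2 * V (p l) / 2) - w l) = - (t\<^sup>2 / 2 * (real (r l) * V (p l) / real l - v))"
          using rpos by (simp add: \<tau>2 w_def field_simps)
        also have "\<bar>\<dots>\<bar> = t\<^sup>2 / 2 * \<bar>real (r l) * V (p l) / real l - v\<bar>" by (simp add: abs_mult)
        also have "real (r l) * real (p l) * (\<bar>\<tau>\<bar> ^ 3 * A * real (p l) / 6) \<le> real l * (\<bar>\<tau>\<bar> ^ 3 * A * real (p l) / 6)"
          using ar(5) A0 by (intro mult_right_mono) auto
        also have "\<dots> = \<bar>t\<bar> ^ 3 * A * (real (p l) / sqrt (real l)) / 6"
        proof -
          have "real l * \<bar>\<tau>\<bar> ^ 3 = \<bar>t\<bar> ^ 3 * (real l / sqrt (real l) ^ 3)" by (simp add: a\<tau> power_divide)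
          also have "real l / sqrt (real l) ^ 3 = 1 / sqrt (real l)"
            using lpos by (simp add: power3_eq_cube)
          finally have *: "real l * \<bar>\<tau>\<bar> ^ 3 = \<bar>t\<bar> ^ 3 * (1 / sqrt (real l))" .
          have "real l * (\<bar>\<tau>\<bar> ^ 3 * A * real (p l) / 6) = (real l * \<bar>\<tau>\<bar> ^ 3) * A * real (p l) / 6" by simp
          then show ?thesis unfolding * by simp
        qed
        also have "\<dots> \<le> \<bar>t\<bar> ^ 3 * A * (1 / real (q l)) / 6"
        proof -
          have "real (p l) / sqrt (real l) \<le> 1 / real (q l)"
            using ar(7) qpos lpos by (simp add: p_def field_simps power2_eq_square power3_eq_cube)
          then show ?thesis using A0 by (intro divide_right_mono mult_left_mono) auto
        qed
        also have "\<dots> \<le> \<bar>t\<bar> ^ 3 * A * (1 / real (q l))"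
        proof -
          have "x / 6 \<le> x" if "0 \<le> x" for x :: real using that by simp
          moreover have "0 \<le> \<bar>t\<bar> ^ 3 * A * (1 / real (q l))"
            using A0 by (intro mult_nonneg_nonneg) auto
          ultimately show ?thesis by blast
        qed
        finally show ?thesis by simp
      qed
      show ?case
        unfolding err_def
        using norm_triangle_le[OF add_mono[OF norm_triangle_le[OF add_mono[OF e1 e2]] e3]]
        by (simp add: algebra_simps)
    qed
  qed
  then have "(\<lambda>l. \<phi> l - complex_of_real (w l) ^ r l) \<longlonglongrightarrow> 0"
    by (rule Lim_null_comparison[OF _ err0])
  moreover have "(\<lambda>l. complex_of_real (w l) ^ r l) \<longlonglongrightarrow> complex_of_real (exp (- (t\<^sup>2 * v / 2)))"
  proof -
    have "(\<lambda>l. w l ^ r l) \<longlonglongrightarrow> exp (- (t\<^sup>2 * v / 2))"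
      unfolding w_def by (rule filterlim_compose[OF tendsto_exp_limit_sequentially rtop])
    then have "(\<lambda>l. complex_of_real (w l ^ r l)) \<longlonglongrightarrow> complex_of_real (exp (- (t\<^sup>2 * v / 2)))"
      by (intro tendsto_of_real)
    then show ?thesis by simp
  qed
  ultimately have "(\<lambda>l. (\<phi> l - complex_of_real (w l) ^ r l) + complex_of_real (w l) ^ r l)
      \<longlonglongrightarrow> 0 + complex_of_real (exp (- (t\<^sup>2 * v / 2)))"
    by (rule tendsto_add)
  then show ?thesis by (simp add: \<phi>_def v_def)
qed

text \<open>Normalisation by \<open>sqrt (l * v)\<close> is impossible when the long-run variance
  vanishes. In that case the L2 bound already forces the limit 0. Otherwise the characteristic
  functions are evaluated at \<open>t / sqrt v\<close>, where the limit is the standard normal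
  one.\<close>

lemma abs_sum_limit:
  "(\<lambda>l. expectation (\<lambda>\<omega>. \<bar>\<Sum>j = 1..l. centred g j \<omega>\<bar>) / sqrt (real l))
    \<longlonglongrightarrow> sqrt (long_run_variance g) * sqrt (2 / pi)"
proof (cases "long_run_variance g = 0")
  case True
  have "(\<lambda>l. sqrt (expectation (\<lambda>\<omega>. (\<Sum>j = 1..l. centred g j \<omega>)\<^sup>2) / real l)) \<longlonglongrightarrow> sqrt 0"
    using second_moment_limit[OF g] unfolding True by (rule tendsto_real_sqrt)
  then have "(\<lambda>l. sqrt (expectation (\<lambda>\<omega>. (\<Sum>j = 1..l. centred g j \<omega>)\<^sup>2) / real l)) \<longlonglongrightarrow> 0" by simp
  then have "(\<lambda>l. expectation (\<lambda>\<omega>. \<bar>\<Sum>j = 1..l. centred g j \<omega>\<bar>) / sqrt (real l)) \<longlonglongrightarrow> 0"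
  proof (rule Lim_null_comparison[rotated], intro always_eventually allI)
    fix l
    have "expectation (\<lambda>\<omega>. \<bar>\<Sum>j = 1..l. centred g j \<omega>\<bar>) \<le> sqrt (expectation (\<lambda>\<omega>. (\<Sum>j = 1..l. centred g j \<omega>)\<^sup>2))"
      by (intro expectation_abs_le_sqrt integrable_centred_sum_sq[OF g]) auto
    then show "norm (expectation (\<lambda>\<omega>. \<bar>\<Sum>j = 1..l. centred g j \<omega>\<bar>) / sqrt (real l))
        \<le> sqrt (expectation (\<lambda>\<omega>. (\<Sum>j = 1..l. centred g j \<omega>)\<^sup>2) / real l)"
      by (simp add: real_sqrt_divide divide_right_mono)
  qed
  then show ?thesis using True by simp
next
  case False
  define v where "v = long_run_variance g"
  have v: "0 < v" using False long_run_variance_nonneg[OF g] by (simp add: v_def)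
  define W where "W l \<omega> = (\<Sum>j = 1..l. centred g j \<omega>) / sqrt (real l * v)" for l \<omega>
  have W [measurable]: "W l \<in> borel_measurable M" for l unfolding W_def by measurable
  have Wsq: "(W l \<omega>)\<^sup>2 = (\<Sum>j = 1..l. centred g j \<omega>)\<^sup>2 / (real l * v)" for l \<omega>
    using v by (simp add: W_def power_divide)
  have "(\<lambda>l. expectation (\<lambda>\<omega>. \<bar>W l \<omega>\<bar>)) \<longlonglongrightarrow> sqrt (2 / pi)"
  proof (rule abs_mean_limit[OF W])
    show "integrable M (\<lambda>\<omega>. (W l \<omega>)\<^sup>2)" for l
      unfolding Wsq by (intro integrable_divide integrable_centred_sum_sq[OF g]) auto
    show "expectation (\<lambda>\<omega>. (W l \<omega>)\<^sup>2) \<le> moment_const C / v" for l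
    proof (cases "l = 0")
      case True
      then show ?thesis using v moment_const_nonneg[OF g] by (simp add: W_def)
    next
      case False
      have "expectation (\<lambda>\<omega>. (\<Sum>j = 1..l. centred g j \<omega>)\<^sup>2) \<le> moment_const C * real l"
        using second_moment_le[OF g, where J = "{1..l}"] by simp
      then show ?thesis unfolding Wsq using False v by (simp add: divide_le_eq mult_ac)
    qed
    show "weak_conv_m (\<lambda>l. distr M borel (W l)) std_normal_distribution"
    proof (rule levy_continuity)
      fix t
      have "char (distr M borel (W l)) t
          = expectation (\<lambda>\<omega>. iexp (t / sqrt v / sqrt (real l) * (\<Sum>j = 1..l. centred g j \<omega>)))" for l
        by (simp add: char_def integral_distr W_def real_sqrt_mult mult_ac)
      moreover have "complex_of_real (exp (- ((t / sqrt v)\<^sup>2 * v / 2))) = char std_normal_distribution t"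
        using v by (simp add: char_std_normal_distribution power_divide)
      ultimately show "(\<lambda>l. char (distr M borel (W l)) t) \<longlonglongrightarrow> char std_normal_distribution t"
        using characteristic_function_limit[of "t / sqrt v"] by (simp add: v_def)
    qed (auto intro!: real_dist_normal_dist real_distribution_distr)
  qed
  from tendsto_mult_left[OF this, of "sqrt v"]
  show ?thesis
    using v by (simp add: W_def real_sqrt_mult abs_divide v_def[symmetric])
qed

end

end

section \<open>Mean square convergence of the estimator\<close>

text \<open>The finitely many indices below the threshold of the Landau bound are absorbed by adding
  all their values \<open>|h n| * n^d\<close> to the constant. This makes the bound valid from index
  1 on.\<close>

lemma bigo_powr_bound:
  fixes h :: "nat \<Rightarrow> real"
  assumes "h \<in> O(\<lambda>n. real n powr (- real d))"
  obtains K where "\<And>n. 1 \<le> n \<Longrightarrow> h n \<le> K / real n ^ d"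
proof -
  obtain c where c: "\<forall>\<^sub>F n in sequentially. norm (h n) \<le> c * norm (real n powr (- real d))"
    using assms by (auto elim: landau_o.bigE)
  then obtain n0 where n0: "\<And>n. n0 \<le> n \<Longrightarrow> norm (h n) \<le> c * norm (real n powr (- real d))"
    by (auto simp: eventually_sequentially)
  define K where "K = \<bar>c\<bar> + (\<Sum>n<n0. \<bar>h n\<bar> * real n ^ d)"
  have "h n \<le> K / real n ^ d" if n: "1 \<le> n" for n
  proof (cases "n < n0")
    case True
    then have "\<bar>h n\<bar> * real n ^ d \<le> (\<Sum>n<n0. \<bar>h n\<bar> * real n ^ d)"
      by (intro member_le_sum) auto
    moreover have "h n * real n ^ d \<le> \<bar>h n\<bar> * real n ^ d" by (intro mult_right_mono) auto
    ultimately have "h n * real n ^ d \<le> K" unfolding K_def by linarith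
    then show ?thesis using n by (simp add: le_divide_eq)
  next
    case False
    have "h n \<le> c * norm (real n powr (- real d))" using n0[of n] False by simp
    also have "\<dots> = c / real n ^ d"
      using n by (simp add: powr_minus powr_realpow divide_inverse)
    also have "\<dots> \<le> K / real n ^ d"
    proof (rule divide_right_mono)
      have "0 \<le> (\<Sum>n<n0. \<bar>h n\<bar> * real n ^ d)" by (intro sum_nonneg) auto
      then show "c \<le> K" unfolding K_def by linarith
    qed simp
    finally show ?thesis .
  qed
  then show ?thesis by (rule that)
qed

text \<open>Flat pieces of \<open>F\<close> are why the neighbouring grid points have to be chosen with a strict
  inequality between the values of \<open>F\<close>, at the cost of a second \<open>1 / N\<close>.\<close>
lemma grid_deviation:
  fixes F G :: "real \<Rightarrow> real"
  assumes F: "mono F" and G: "mono G" "\<And>y. 0 \<le> G y" "\<And>y. G y \<le> 1"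
    and F0: "0 \<le> F y" "F y \<le> 1" and N: "1 \<le> N" and e: "0 \<le> e"
    and x: "\<And>a. a \<in> {1..<N} \<Longrightarrow> F (x a) = real a / real N"
      "\<And>a. a \<in> {1..<N} \<Longrightarrow> \<bar>G (x a) - F (x a)\<bar> \<le> e"
  shows "\<bar>G y - F y\<bar> \<le> e + 2 / real N"
proof -
  have less: "u < v" if "F u < F v" for u v
    using that monoD[OF F, of v u] by (meson linorder_not_less)
  define j where "j = nat \<lfloor>real N * F y\<rfloor>"
  have N0: "0 < real N" using N by simp
  have "real j = real_of_int \<lfloor>real N * F y\<rfloor>" using F0(1) by (simp add: j_def)
  then have "real j \<le> real N * F y" "real N * F y < real j + 1" by linarith+
  then have j: "real j / real N \<le> F y" "F y < (real j + 1) / real N"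
    using N0 by (simp_all add: divide_le_eq less_divide_eq mult.commute)
  have "real j \<le> real N" using order.trans[OF j(1) F0(2)] N0 by (simp add: divide_le_eq)
  then have jN: "j \<le> N" by simp
  have up: "G y \<le> F y + e + 2 / real N"
  \<comment> \<open>The grid contains the levels from 1 to \<open>N - 1\<close> only. Where the
    upper neighbour \<open>j + 1\<close> is missing, \<open>G y <= 1\<close> takes its place. Below,
    the neighbour is \<open>j - 1\<close>, so for \<open>j < 2\<close> the fallback is
    \<open>0 <= G y\<close>.\<close>
  proof (cases "j + 1 < N")
    case True
    then have a: "j + 1 \<in> {1..<N}" by simp
    have Fx: "F (x (j + 1)) = (real j + 1) / real N" unfolding x(1)[OF a] by simp
    have "y < x (j + 1)" using j(2) unfolding Fx[symmetric] by (rule less)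
    then have "G y \<le> G (x (j + 1))" by (intro monoD[OF G(1)]) simp
    also have "\<dots> \<le> (real j + 1) / real N + e" using x(2)[OF a] unfolding Fx by linarith
    finally have "G y \<le> real j / real N + 1 / real N + e" by (simp add: add_divide_distrib)
    moreover have "1 / real N \<le> 2 / real N" by (intro divide_right_mono) auto
    ultimately show ?thesis using j(1) by linarith
  next
    case False
    then have "real N - 1 \<le> real j" by simp
    then have "(real N - 1) / real N \<le> real j / real N" by (rule divide_right_mono) simp
    then have "1 - 1 / real N \<le> real j / real N" using N0 by (simp add: diff_divide_distrib)
    moreover have "1 / real N \<le> 2 / real N" by (intro divide_right_mono) auto
    ultimately show ?thesis using j(1) G(3)[of y] e by linarith
  qed
  have lo: "F y \<le> G y + e + 2 / real N"
  proof (cases "j < 2")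
    case True
    then have "(real j + 1) / real N \<le> 2 / real N" by (intro divide_right_mono) auto
    then show ?thesis using j G(2)[of y] e by linarith
  next
    case False
    then have a: "j - 1 \<in> {1..<N}" using jN by auto
    have Fx: "F (x (j - 1)) = (real j - 1) / real N" unfolding x(1)[OF a] using False by simp
    have "(real j - 1) / real N < real j / real N" using N0 by (intro divide_strict_right_mono) auto
    then have "F (x (j - 1)) < F y" using j(1) unfolding Fx by linarith
    then have "G (x (j - 1)) \<le> G y" using less[of "x (j - 1)" y] by (intro monoD[OF G(1)]) simp
    moreover have "(real j - 1) / real N - e \<le> G (x (j - 1))" using x(2)[OF a] unfolding Fx by linarith
    moreover have "(real j + 1) / real N = (real j - 1) / real N + 2 / real N" by (simp flip: add_divide_distrib)
    ultimately show ?thesis using j(2) by linarith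
  qed
  show ?thesis using up lo by (simp add: abs_le_iff)
qed

lemma card_neighbours_le: "card {j \<in> {..<k}. \<bar>int i - int j\<bar> \<le> 1} \<le> 3"
proof -
  have "{j \<in> {..<k}. \<bar>int i - int j\<bar> \<le> 1} \<subseteq> {i - 1, i, i + 1}" by auto
  from card_mono[OF _ this] have "card {j \<in> {..<k}. \<bar>int i - int j\<bar> \<le> 1} \<le> card {i - 1, i, i + 1}" by simp
  also have "\<dots> \<le> 3" by (simp add: card_insert_if)
  finally show ?thesis .
qed

lemma sum_square_le_three: "(a + b + c)\<^sup>2 \<le> 3 * (a\<^sup>2 + b\<^sup>2 + c\<^sup>2)" for a b c :: real
proof -
  have "0 \<le> (a - b)\<^sup>2 + (b - c)\<^sup>2 + (a - c)\<^sup>2" by simp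
  then show ?thesis by (simp add: power2_eq_square algebra_simps)
qed

lemma sum_square_le_two: "(a + b)\<^sup>2 \<le> 2 * a\<^sup>2 + 2 * b\<^sup>2" for a b :: real
proof -
  have "0 \<le> (a - b)\<^sup>2" by simp
  then show ?thesis by (simp add: power2_eq_square algebra_simps)
qed

section \<open>Absolute block sums and concentration of their mean\<close>

context lipschitz_mixing_functional
begin

abbreviation "XN \<equiv> \<lambda>i. X (int i)"

text \<open>Blocks are counted from 0 here, so block \<open>i\<close> covers
  \<open>i * l + 1\<close> to \<open>(i + 1) * l\<close> and corresponds to \<open>That\<close> at
  \<open>Suc i\<close>.\<close>

definition block_abs :: "(real \<Rightarrow> real) \<Rightarrow> nat \<Rightarrow> nat \<Rightarrow> 'a \<Rightarrow> real" where
  "block_abs g l i \<omega> = \<bar>\<Sum>j = 1..l. centred g (j + i * l) \<omega>\<bar> / sqrt (real l)"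

context
  fixes g C
  assumes g: "approximable C g"
begin

lemma block_abs_measurable [measurable]: "block_abs g l i \<in> borel_measurable M"
  unfolding block_abs_def[abs_def] using centred_measurable[OF g] by measurable

lemma block_abs_bound: "\<bar>block_abs g l i \<omega>\<bar> \<le> sqrt (real l)"
proof -
  have "\<bar>\<Sum>j = 1..l. centred g (j + i * l) \<omega>\<bar> \<le> (\<Sum>j = 1..l. 1)"
    by (intro order.trans[OF sum_abs] sum_mono centred_bound[OF g])
  then have "block_abs g l i \<omega> \<le> real l / sqrt (real l)"
    unfolding block_abs_def by (intro divide_right_mono) auto
  moreover have "0 \<le> block_abs g l i \<omega>" by (simp add: block_abs_def)
  ultimately show ?thesis by (simp add: real_div_sqrt)
qed

lemma integrable_block_abs: "integrable M (block_abs g l i)"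
  using block_abs_bound by (intro integrable_bounded[of _ "sqrt (real l)"]) auto

lemma integrable_block_abs_mult: "integrable M (\<lambda>\<omega>. block_abs g l i \<omega> * block_abs g l j \<omega>)"
  using block_abs_bound by (intro integrable_bounded[of _ "sqrt (real l) * sqrt (real l)"])
    (auto simp del: real_sqrt_mult_self simp: abs_mult intro!: mult_mono)

lemma stationary_block_abs:
  assumes [measurable]: "G \<in> borel_measurable (borel :: real measure)"
  shows "expectation (\<lambda>\<omega>. G (block_abs g l i \<omega>) :: real) = expectation (\<lambda>\<omega>. G (block_abs g l 0 \<omega>))"
  using stationary_centred_sum[OF g, where G = "\<lambda>x. G (\<bar>x\<bar> / sqrt (real l))" and J = "{1..l}" and h = "i * l"]
  by (simp add: block_abs_def)

lemma block_abs_second_moment: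
  assumes "1 \<le> l"
  shows "expectation (\<lambda>\<omega>. (block_abs g l i \<omega>)\<^sup>2) \<le> moment_const C"
proof -
  have "expectation (\<lambda>\<omega>. (block_abs g l i \<omega>)\<^sup>2) = expectation (\<lambda>\<omega>. (block_abs g l 0 \<omega>)\<^sup>2)"
    using stationary_block_abs[of "\<lambda>x. x\<^sup>2"] by simp
  also have "\<dots> = expectation (\<lambda>\<omega>. (\<Sum>j = 1..l. centred g j \<omega>)\<^sup>2) / real l"
    by (simp add: block_abs_def power_divide)
  also have "\<dots> \<le> moment_const C"
    using second_moment_le[OF g, where J = "{1..l}"] assms by (simp add: divide_le_eq)
  finally show ?thesis .
qed

text \<open>Both the mixed moment and the product of means lie between 0 and
  \<open>moment_const C\<close>, so their difference does too in absolute value. Adjacent blocks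
  have no gap for mixing to act on, and this bound replaces it.\<close>

lemma block_abs_covariance_near:
  assumes "1 \<le> l"
  shows "\<bar>expectation (\<lambda>\<omega>. block_abs g l i \<omega> * block_abs g l j \<omega>)
      - expectation (block_abs g l i) * expectation (block_abs g l j)\<bar> \<le> moment_const C"
proof -
  let ?Z = "block_abs g l"
  have nn: "0 \<le> ?Z i \<omega>" for i \<omega> by (simp add: block_abs_def)
  have sq: "integrable M (\<lambda>\<omega>. (?Z i \<omega>)\<^sup>2)" for i
    using integrable_block_abs_mult[of l i i] by (simp add: power2_eq_square)
  have m: "0 \<le> expectation (?Z i)" "(expectation (?Z i))\<^sup>2 \<le> moment_const C" for i
  proof -
    show "0 \<le> expectation (?Z i)" using nn by simp
    have "expectation (?Z i) \<le> sqrt (expectation (\<lambda>\<omega>. (?Z i \<omega>)\<^sup>2))"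
      using expectation_abs_le_sqrt[OF block_abs_measurable sq, of i] nn[of i] by simp
    then have "(expectation (?Z i))\<^sup>2 \<le> expectation (\<lambda>\<omega>. (?Z i \<omega>)\<^sup>2)"
      using power_mono[OF _ \<open>0 \<le> expectation (?Z i)\<close>, of _ 2] by fastforce
    then show "(expectation (?Z i))\<^sup>2 \<le> moment_const C"
      using block_abs_second_moment[OF assms] by (rule order.trans)
  qed
  have "expectation (\<lambda>\<omega>. ?Z i \<omega> * ?Z j \<omega>) \<le> expectation (\<lambda>\<omega>. ((?Z i \<omega>)\<^sup>2 + (?Z j \<omega>)\<^sup>2) / 2)"
  proof (intro integral_mono integrable_block_abs_mult)
    show "?Z i \<omega> * ?Z j \<omega> \<le> ((?Z i \<omega>)\<^sup>2 + (?Z j \<omega>)\<^sup>2) / 2" for \<omega>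
      using sum_squares_bound[of "?Z i \<omega>" "?Z j \<omega>"] by simp
  qed (use sq in auto)
  also have "\<dots> \<le> moment_const C"
    using sq block_abs_second_moment[OF assms, of i] block_abs_second_moment[OF assms, of j] by simp
  finally have 1: "expectation (\<lambda>\<omega>. ?Z i \<omega> * ?Z j \<omega>) \<le> moment_const C" .
  have 2: "0 \<le> expectation (\<lambda>\<omega>. ?Z i \<omega> * ?Z j \<omega>)" using nn by simp
  have 3: "0 \<le> expectation (?Z i) * expectation (?Z j)" using m(1) by simp
  have "expectation (?Z i) * expectation (?Z j) = (expectation (?Z i))\<^sup>2"
    using stationary_block_abs[of "\<lambda>x. x" l i] stationary_block_abs[of "\<lambda>x. x" l j]
    by (simp add: power2_eq_square)
  then have 4: "expectation (?Z i) * expectation (?Z j) \<le> moment_const C" using m(2) by simp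
  show ?thesis using 1 2 3 4 by linarith
qed

text \<open>A whole block lies between the two, wide enough for two windows of radius
  \<open>l div 3\<close> and a mixing distance of the same size. The normalised sums are bounded by
  \<open>sqrt l\<close> only, so both errors carry a factor \<open>l\<close>, which the decay in
  \<open>m\<close> outweighs. With \<open>l <= 5 * m\<close> the constant is
  \<open>4 * 5 = 20\<close>.\<close>

lemma block_abs_covariance_far:
  assumes l: "3 \<le> l" and ij: "i + 2 \<le> j"
  shows "\<bar>expectation (\<lambda>\<omega>. block_abs g l i \<omega> * block_abs g l j \<omega>)
      - expectation (block_abs g l i) * expectation (block_abs g l j)\<bar> \<le> 20 * (C + K) / real (l div 3)"
proof -
  define m where "m = l div 3"
  have m: "1 \<le> m" "2 * m + m \<le> l" "l \<le> 5 * m" using l unfolding m_def by presburger+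
  define \<mu> where "\<mu> = expectation (\<lambda>\<omega>. g (X 1 \<omega>))"
  note [measurable] = centred_measurable[OF g] approximable_measurable[OF g]
  obtain W :: "int \<Rightarrow> 'a \<Rightarrow> real" where
    WF: "\<And>i. W i \<in> borel_measurable (\<F> {i - int m..i + int m})"
    and W: "\<And>i \<omega>. 0 \<le> W i \<omega>" "\<And>i \<omega>. W i \<omega> \<le> 1"
    "\<And>i. expectation (\<lambda>\<omega>. \<bar>g (X i \<omega>) - W i \<omega>\<bar>) \<le> C / real m ^ 6"
    by (rule window_approximations[OF g m(1)]) (rule that)
  note [measurable] = measurable_F[OF WF]
  let ?Z = "block_abs g l"
  define Z' where "Z' i \<omega> = \<bar>\<Sum>j = 1..l. W (int (j + i * l)) \<omega> - \<mu>\<bar> / sqrt (real l)" for i \<omega>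
  have C0: "0 \<le> C" by (rule approximable_const_nonneg[OF g])
  have ls: "0 < sqrt (real l)" using l by simp
  have Z'm [measurable]: "Z' i \<in> borel_measurable M" for i unfolding Z'_def by measurable
  have Z'F: "Z' i \<in> borel_measurable (\<F> I)" if "{int (i * l) + 1 - int m..int (i * l) + int l + int m} \<subseteq> I" for i I
  proof -
    have "W (int (j + i * l)) \<in> borel_measurable (\<F> I)" if "j \<in> {1..l}" for j
      using that \<open>_ \<subseteq> I\<close> by (intro measurable_F_mono[OF WF]) (auto simp: subset_eq)
    then show ?thesis unfolding Z'_def by measurable
  qed
  have Z'b: "\<bar>Z' i \<omega>\<bar> \<le> sqrt (real l)" for i \<omega>
  proof -
    have "\<bar>W i \<omega> - \<mu>\<bar> \<le> 1" for i
      using W(1)[of i \<omega>] W(2)[of i \<omega>] mean_g[OF g] by (simp add: \<mu>_def abs_le_iff)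
    then have "\<bar>\<Sum>j = 1..l. W (int (j + i * l)) \<omega> - \<mu>\<bar> \<le> (\<Sum>j = 1..l. 1)"
      by (intro order.trans[OF sum_abs] sum_mono)
    then have "Z' i \<omega> \<le> real l / sqrt (real l)"
      unfolding Z'_def by (intro divide_right_mono) auto
    moreover have "0 \<le> Z' i \<omega>" by (simp add: Z'_def)
    ultimately show ?thesis by (simp add: real_div_sqrt)
  qed
  have iW: "integrable M (\<lambda>\<omega>. \<bar>g (X i \<omega>) - W i \<omega>\<bar>)" for i
  proof (rule integrable_bounded[of _ 1])
    show "norm \<bar>g (X i \<omega>) - W i \<omega>\<bar> \<le> 1" for \<omega>
      using W(1)[of i \<omega>] W(2)[of i \<omega>] approximable_bounds[OF g, of "X i \<omega>"] by (simp add: abs_le_iff)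
  qed measurable
  have close: "expectation (\<lambda>\<omega>. \<bar>?Z i \<omega> - Z' i \<omega>\<bar>) \<le> sqrt (real l) * (C / real m ^ 6)" for i
  proof -
    have pt: "\<bar>?Z i \<omega> - Z' i \<omega>\<bar> \<le> (\<Sum>j = 1..l. \<bar>g (X (int (j + i * l)) \<omega>) - W (int (j + i * l)) \<omega>\<bar>) / sqrt (real l)" for \<omega>
    proof -
      let ?a = "\<Sum>j = 1..l. centred g (j + i * l) \<omega>" and ?b = "\<Sum>j = 1..l. W (int (j + i * l)) \<omega> - \<mu>"
      have "\<bar>?Z i \<omega> - Z' i \<omega>\<bar> = \<bar>\<bar>?a\<bar> - \<bar>?b\<bar>\<bar> / sqrt (real l)"
        by (simp add: block_abs_def Z'_def abs_divide flip: diff_divide_distrib)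
      also have "\<dots> \<le> \<bar>?a - ?b\<bar> / sqrt (real l)"
        by (intro divide_right_mono abs_triangle_ineq3) auto
      also have "?a - ?b = (\<Sum>j = 1..l. g (X (int (j + i * l)) \<omega>) - W (int (j + i * l)) \<omega>)"
        by (simp add: centred_def \<mu>_def flip: sum_subtractf)
      also have "\<bar>\<dots>\<bar> / sqrt (real l) \<le> (\<Sum>j = 1..l. \<bar>g (X (int (j + i * l)) \<omega>) - W (int (j + i * l)) \<omega>\<bar>) / sqrt (real l)"
        by (intro divide_right_mono sum_abs) auto
      finally show ?thesis .
    qed
    have Z'i: "integrable M (Z' i)" using Z'b by (intro integrable_bounded[of _ "sqrt (real l)"]) auto
    have iS: "integrable M (\<lambda>\<omega>. (\<Sum>j = 1..l. \<bar>g (X (int (j + i * l)) \<omega>) - W (int (j + i * l)) \<omega>\<bar>) / sqrt (real l))"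
      by (intro integrable_divide Bochner_Integration.integrable_sum iW)
    have "expectation (\<lambda>\<omega>. \<bar>?Z i \<omega> - Z' i \<omega>\<bar>)
        \<le> expectation (\<lambda>\<omega>. (\<Sum>j = 1..l. \<bar>g (X (int (j + i * l)) \<omega>) - W (int (j + i * l)) \<omega>\<bar>) / sqrt (real l))"
      by (intro integral_mono[OF _ iS pt] integrable_abs Bochner_Integration.integrable_diff integrable_block_abs Z'i)
    also have "\<dots> = (\<Sum>j = 1..l. expectation (\<lambda>\<omega>. \<bar>g (X (int (j + i * l)) \<omega>) - W (int (j + i * l)) \<omega>\<bar>)) / sqrt (real l)"
      using iW by (simp add: Bochner_Integration.integral_sum del: of_nat_add of_nat_mult)
    also have "\<dots> \<le> (\<Sum>j = 1..l. C / real m ^ 6) / sqrt (real l)"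
      by (intro divide_right_mono sum_mono W) auto
    also have "\<dots> = real l / sqrt (real l) * (C / real m ^ 6)" by simp
    finally show ?thesis by (simp only: real_div_sqrt[OF of_nat_0_le_iff])
  qed
  have "\<bar>expectation (\<lambda>\<omega>. Z' i \<omega> * Z' j \<omega>) - expectation (Z' i) * expectation (Z' j)\<bar>
      \<le> 4 * sqrt (real l) * sqrt (real l) * \<alpha> m"
  proof (rule covariance_bounded[OF _ _ Z'F Z'F Z'b Z'b ls ls])
    have "(i + 2) * l \<le> j * l" using ij by (intro mult_right_mono) auto
    then have "int (i * l) + 2 * int l \<le> int (j * l)" by (simp add: algebra_simps flip: of_nat_mult)
    then show "(int (i * l) + int l + int m) + int m \<le> int (j * l) + 1 - int m" using m by linarith
    show "1 \<le> int (i * l) + int l + int m" using m by linarith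
  qed auto
  also have "\<dots> = 4 * real l * \<alpha> m" by simp
  also have "\<dots> \<le> 4 * real l * (K / real m ^ 8)" using alpha_le[OF m(1)] by (intro mult_left_mono) auto
  finally have 1: "\<bar>expectation (\<lambda>\<omega>. Z' i \<omega> * Z' j \<omega>) - expectation (Z' i) * expectation (Z' j)\<bar> \<le> 4 * real l * (K / real m ^ 8)" .
  have 2: "\<bar>(expectation (\<lambda>\<omega>. ?Z i \<omega> * ?Z j \<omega>) - expectation (?Z i) * expectation (?Z j))
       - (expectation (\<lambda>\<omega>. Z' i \<omega> * Z' j \<omega>) - expectation (Z' i) * expectation (Z' j))\<bar>
     \<le> 2 * sqrt (real l) * (expectation (\<lambda>\<omega>. \<bar>?Z i \<omega> - Z' i \<omega>\<bar>) + expectation (\<lambda>\<omega>. \<bar>?Z j \<omega> - Z' j \<omega>\<bar>))"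
    using Z'b block_abs_bound by (intro cov_perturb) auto
  also have "\<dots> \<le> 2 * sqrt (real l) * (sqrt (real l) * (C / real m ^ 6) + sqrt (real l) * (C / real m ^ 6))"
    by (intro mult_left_mono add_mono close) auto
  also have "\<dots> = 4 * real l * (C / real m ^ 6)"
  proof -
    have "2 * sqrt (real l) * (sqrt (real l) * c + sqrt (real l) * c) = 4 * (sqrt (real l) * sqrt (real l)) * c" for c
      by (simp add: algebra_simps del: real_sqrt_mult_self)
    then show ?thesis by simp
  qed
  finally have "\<bar>expectation (\<lambda>\<omega>. ?Z i \<omega> * ?Z j \<omega>) - expectation (?Z i) * expectation (?Z j)\<bar>
      \<le> 4 * real l * (C / real m ^ 6) + 4 * real l * (K / real m ^ 8)"
    using 1 by linarith
  also have "\<dots> \<le> 4 * real l * (C / real m ^ 2) + 4 * real l * (K / real m ^ 2)"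
    using m C0 K_nonneg by (intro add_mono mult_left_mono divide_left_mono power_increasing) auto
  also have "\<dots> = 4 * real l * ((C + K) / real m ^ 2)" by (simp add: add_divide_distrib algebra_simps)
  also have "\<dots> \<le> 4 * (5 * real m) * ((C + K) / real m ^ 2)"
    using m(3) C0 K_nonneg by (intro mult_right_mono mult_left_mono) auto
  also have "\<dots> = 20 * (C + K) / real m" using m(1) by (simp add: power2_eq_square)
  finally show ?thesis by (simp add: m_def)
qed

text \<open>Each row has at most three near entries, giving the \<open>1 / k\<close> term after
  division by \<open>k^2\<close>. The far entries are bounded uniformly in the block distance by a
  quantity that vanishes as \<open>l\<close> grows.\<close>

lemma block_mean_variance:
  assumes l: "3 \<le> l" and k: "1 \<le> k"
  shows "expectation (\<lambda>\<omega>. ((\<Sum>i<k. block_abs g l i \<omega>) / real k - expectation (block_abs g l 0))\<^sup>2)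
    \<le> 3 * moment_const C / real k + 20 * (C + K) / real (l div 3)"
proof -
  let ?Z = "block_abs g l"
  define \<mu> where "\<mu> = expectation (?Z 0)"
  define \<epsilon> where "\<epsilon> = 20 * (C + K) / real (l div 3)"
  have \<epsilon>: "0 \<le> \<epsilon>" using approximable_const_nonneg[OF g] K_nonneg by (simp add: \<epsilon>_def)
  have A: "0 \<le> moment_const C" by (rule moment_const_nonneg[OF g])
  have EZ: "expectation (?Z i) = \<mu>" for i
    using stationary_block_abs[of "\<lambda>x. x" l i] by (simp add: \<mu>_def)
  have i: "integrable M (\<lambda>\<omega>. (?Z i \<omega> - \<mu>) * (?Z j \<omega> - \<mu>))" for i j
    using integrable_block_abs integrable_block_abs_mult by (simp add: algebra_simps)
  have cov: "expectation (\<lambda>\<omega>. (?Z i \<omega> - \<mu>) * (?Z j \<omega> - \<mu>))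
      = expectation (\<lambda>\<omega>. ?Z i \<omega> * ?Z j \<omega>) - expectation (?Z i) * expectation (?Z j)" for i j
    using integrable_block_abs integrable_block_abs_mult EZ by (simp add: algebra_simps prob_space)
  have le: "expectation (\<lambda>\<omega>. (?Z i \<omega> - \<mu>) * (?Z j \<omega> - \<mu>)) \<le> (if \<bar>int i - int j\<bar> \<le> 1 then moment_const C else 0) + \<epsilon>" for i j
  proof -
    consider "\<bar>int i - int j\<bar> \<le> 1" | "i + 2 \<le> j" | "j + 2 \<le> i" by linarith
    then show ?thesis
    proof cases
      case 1
      then show ?thesis using block_abs_covariance_near[of l i j] l \<epsilon> unfolding cov by (simp add: abs_le_iff)
    next
      case 2
      then show ?thesis using block_abs_covariance_far[OF l 2] A unfolding cov \<epsilon>_def by (simp add: abs_le_iff)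
    next
      case 3
      then show ?thesis using block_abs_covariance_far[OF l 3] A unfolding cov \<epsilon>_def by (simp add: abs_le_iff mult.commute)
    qed
  qed
  have eq: "((\<Sum>i<k. ?Z i \<omega>) / real k - \<mu>)\<^sup>2 = (\<Sum>i<k. \<Sum>j<k. (?Z i \<omega> - \<mu>) * (?Z j \<omega> - \<mu>)) / (real k)\<^sup>2" for \<omega>
  proof -
    have "(\<Sum>i<k. ?Z i \<omega>) / real k - \<mu> = (\<Sum>i<k. ?Z i \<omega> - \<mu>) / real k"
      using k by (simp add: sum_subtractf diff_divide_distrib)
    then show ?thesis by (simp add: power_divide power2_eq_square sum_product)
  qed
  have "expectation (\<lambda>\<omega>. ((\<Sum>i<k. ?Z i \<omega>) / real k - \<mu>)\<^sup>2)
      = (\<Sum>i<k. \<Sum>j<k. expectation (\<lambda>\<omega>. (?Z i \<omega> - \<mu>) * (?Z j \<omega> - \<mu>))) / (real k)\<^sup>2"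
    unfolding eq using i by simp
  also have "\<dots> \<le> (\<Sum>i<k. 3 * moment_const C + real k * \<epsilon>) / (real k)\<^sup>2"
  proof (intro divide_right_mono sum_mono)
    fix i
    have "(\<Sum>j<k. expectation (\<lambda>\<omega>. (?Z i \<omega> - \<mu>) * (?Z j \<omega> - \<mu>)))
        \<le> (\<Sum>j<k. (if \<bar>int i - int j\<bar> \<le> 1 then moment_const C else 0) + \<epsilon>)"
      by (intro sum_mono le)
    also have "\<dots> = real (card {j \<in> {..<k}. \<bar>int i - int j\<bar> \<le> 1}) * moment_const C + real k * \<epsilon>"
      by (simp add: sum.distrib sum.If_cases Int_def)
    also have "\<dots> \<le> 3 * moment_const C + real k * \<epsilon>"
      using card_neighbours_le[of k i] A by (intro add_right_mono mult_right_mono) auto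
    finally show "(\<Sum>j<k. expectation (\<lambda>\<omega>. (?Z i \<omega> - \<mu>) * (?Z j \<omega> - \<mu>))) \<le> 3 * moment_const C + real k * \<epsilon>" .
  qed simp
  also have "\<dots> = 3 * moment_const C / real k + \<epsilon>"
    using k by (simp add: power2_eq_square field_simps)
  finally show ?thesis by (simp add: \<mu>_def \<epsilon>_def)
qed

end

section \<open>Uniform deviation of the empirical distribution function\<close>

lemma F_mono: "mono F"
  by (auto intro!: monoI finite_measure_mono simp: distF_def)

text \<open>Continuity and the limits of a distribution function at infinity give all interior
  levels by the intermediate value theorem. The levels 0 and 1 need not be attained, hence the
  strict inequalities.\<close>

lemma F_quantile:
  assumes "0 < u" "u < 1"
  obtains x where "F x = u"
proof -
  interpret D: real_distribution "distr M borel (X 1)" by (rule real_distribution_distr) simp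
  have "cdf (distr M borel (X 1)) = F"
    by (rule ext) (simp add: cdf_def distF_def measure_distr vimage_def Int_def conj_commute)
  then have "(F \<longlongrightarrow> 0) at_bot" "(F \<longlongrightarrow> 1) at_top"
    using D.cdf_lim_at_bot D.cdf_lim_at_top_prob by simp_all
  then have "\<forall>\<^sub>F x in at_bot. F x < u" "\<forall>\<^sub>F x in at_top. u < F x"
    using assms by (auto dest: order_tendstoD)
  then obtain a b where ab: "F a < u" "u < F b"
    by (auto simp: eventually_at_bot_linorder eventually_at_top_linorder)
  then have "a \<le> b" using monoD[OF F_mono, of b a] by linarith
  then show ?thesis
    using IVT'[of F a u b] ab continuous_on_subset[OF F_continuous, of "{a..b}"] that by auto
qed

lemma Fhat_bounds: "0 \<le> Fhat XN n x \<omega>" "Fhat XN n x \<omega> \<le> 1"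
proof -
  show "0 \<le> Fhat XN n x \<omega>" by (auto simp: Fhat_def intro!: sum_nonneg divide_nonneg_nonneg)
  have "(\<Sum>i = 1..n. if X (int i) \<omega> \<le> x then 1 else 0) \<le> (\<Sum>i = 1..n. 1 :: real)" by (intro sum_mono) auto
  then show "Fhat XN n x \<omega> \<le> 1" by (cases "n = 0") (auto simp: Fhat_def)
qed

lemma Fhat_mono: "mono (\<lambda>x. Fhat XN n x \<omega>)"
  unfolding Fhat_def by (intro monoI mult_left_mono sum_mono) auto

lemma Fhat_measurable [measurable]: "Fhat XN n x \<in> borel_measurable M"
  unfolding Fhat_def[abs_def] by measurable

text \<open>\<open>Fhat - F\<close> at a fixed point is a normalised sum of centred indicators. The
  constant is the same for every \<open>x\<close>, so the bounds can be added over a grid.\<close>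

lemma Fhat_second_moment:
  assumes n: "1 \<le> n"
  shows "integrable M (\<lambda>\<omega>. (Fhat XN n x \<omega> - F x)\<^sup>2)"
    "expectation (\<lambda>\<omega>. (Fhat XN n x \<omega> - F x)\<^sup>2) \<le> moment_const (L + K) / real n"
proof -
  let ?g = "\<lambda>y. if y \<le> x then 1 else 0 :: real"
  note ap = approximable_indicator[of x]
  have "expectation (\<lambda>\<omega>. ?g (X 1 \<omega>)) = expectation (\<lambda>\<omega>. indicator {\<omega>. X 1 \<omega> \<le> x} \<omega>)"
    by (intro Bochner_Integration.integral_cong) (auto simp: indicator_def)
  also have "\<dots> = F x" by (simp add: distF_def Int_def conj_commute)
  finally have eq: "Fhat XN n x \<omega> - F x = (\<Sum>i = 1..n. centred ?g i \<omega>) / real n" for \<omega>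
    using n by (simp add: Fhat_def centred_def sum_subtractf diff_divide_distrib)
  show "integrable M (\<lambda>\<omega>. (Fhat XN n x \<omega> - F x)\<^sup>2)"
    unfolding eq power_divide by (intro integrable_divide integrable_centred_sum_sq[OF ap]) auto
  have "expectation (\<lambda>\<omega>. (Fhat XN n x \<omega> - F x)\<^sup>2) = expectation (\<lambda>\<omega>. (\<Sum>i = 1..n. centred ?g i \<omega>)\<^sup>2) / (real n)\<^sup>2"
    unfolding eq power_divide by simp
  also have "\<dots> \<le> moment_const (L + K) * real n / (real n)\<^sup>2"
    using second_moment_le[OF ap, where J = "{1..n}"] by (intro divide_right_mono) auto
  also have "\<dots> = moment_const (L + K) / real n" by (simp add: power2_eq_square)
  finally show "expectation (\<lambda>\<omega>. (Fhat XN n x \<omega> - F x)\<^sup>2) \<le> moment_const (L + K) / real n" .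
qed

text \<open>A measurable majorant \<open>\<Delta>\<close> takes the place of the supremum over
  uncountably many points. On the grid, the root of the sum of squares dominates the largest
  deviation and has a computable second moment. Squaring the grid error \<open>2 / N\<close>
  together with that root produces the factors 2 and 8.\<close>

lemma uniform_deviation:
  assumes n: "1 \<le> n" and N: "1 \<le> N"
  obtains \<Delta> where "\<Delta> \<in> borel_measurable M" "\<And>\<omega>. 0 \<le> \<Delta> \<omega>"
    "\<And>x \<omega>. \<bar>Fhat XN n x \<omega> - F x\<bar> \<le> \<Delta> \<omega>"
    "integrable M (\<lambda>\<omega>. (\<Delta> \<omega>)\<^sup>2)"
    "expectation (\<lambda>\<omega>. (\<Delta> \<omega>)\<^sup>2) \<le> 2 * real N * moment_const (L + K) / real n + 8 / (real N)\<^sup>2"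
proof -
  have "\<exists>y. F y = real a / real N" if "a \<in> {1..<N}" for a
    using F_quantile[of "real a / real N"] that by auto
  then obtain x where x: "\<And>a. a \<in> {1..<N} \<Longrightarrow> F (x a) = real a / real N" by metis
  define R where "R \<omega> = (\<Sum>a = 1..<N. (Fhat XN n (x a) \<omega> - F (x a))\<^sup>2)" for \<omega>
  define \<Delta> where "\<Delta> \<omega> = sqrt (R \<omega>) + 2 / real N" for \<omega>
  have [measurable]: "R \<in> borel_measurable M" unfolding R_def by measurable
  have [measurable]: "\<Delta> \<in> borel_measurable M" unfolding \<Delta>_def by measurable
  have R0: "0 \<le> R \<omega>" for \<omega> unfolding R_def by (intro sum_nonneg) auto
  have iR: "integrable M R" unfolding R_def[abs_def] by (intro Bochner_Integration.integrable_sum Fhat_second_moment n)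
  have A: "0 \<le> moment_const (L + K)" by (rule moment_const_nonneg[OF approximable_indicator])
  have ER: "expectation R \<le> real N * (moment_const (L + K) / real n)"
  proof -
    have "expectation R = (\<Sum>a = 1..<N. expectation (\<lambda>\<omega>. (Fhat XN n (x a) \<omega> - F (x a))\<^sup>2))"
      unfolding R_def[abs_def] by (intro Bochner_Integration.integral_sum Fhat_second_moment n)
    also have "\<dots> \<le> (\<Sum>a = 1..<N. moment_const (L + K) / real n)"
      by (intro sum_mono Fhat_second_moment n)
    also have "\<dots> = real (N - 1) * (moment_const (L + K) / real n)" by simp
    also have "\<dots> \<le> real N * (moment_const (L + K) / real n)"
      using A by (intro mult_right_mono) auto
    finally show ?thesis .
  qed
  have le: "(\<Delta> \<omega>)\<^sup>2 \<le> 2 * R \<omega> + 8 / (real N)\<^sup>2" for \<omega>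
    using sum_square_le_two[of "sqrt (R \<omega>)" "2 / real N"] R0[of \<omega>] by (simp add: \<Delta>_def power_divide)
  have i\<Delta>: "integrable M (\<lambda>\<omega>. (\<Delta> \<omega>)\<^sup>2)"
  proof (rule Bochner_Integration.integrable_bound)
    show "integrable M (\<lambda>\<omega>. 2 * R \<omega> + 8 / (real N)\<^sup>2)" using iR by simp
    show "AE \<omega> in M. norm ((\<Delta> \<omega>)\<^sup>2) \<le> norm (2 * R \<omega> + 8 / (real N)\<^sup>2)"
      using le R0 by (intro AE_I2) (auto intro: order.trans[OF _ abs_ge_self])
  qed measurable
  have dev: "\<bar>Fhat XN n y \<omega> - F y\<bar> \<le> \<Delta> \<omega>" for y \<omega>
    unfolding \<Delta>_def
  proof (rule grid_deviation[OF F_mono Fhat_mono Fhat_bounds(1) Fhat_bounds(2) F_bounds N _ x])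
    show "0 \<le> sqrt (R \<omega>)" using R0 by simp
    show "\<bar>Fhat XN n (x a) \<omega> - F (x a)\<bar> \<le> sqrt (R \<omega>)" if "a \<in> {1..<N}" for a
    proof (rule real_le_rsqrt)
      have "(Fhat XN n (x a) \<omega> - F (x a))\<^sup>2 \<le> R \<omega>"
        unfolding R_def using that by (intro member_le_sum[where f = "\<lambda>a. (Fhat XN n (x a) \<omega> - F (x a))\<^sup>2"]) auto
      then show "\<bar>Fhat XN n (x a) \<omega> - F (x a)\<bar>\<^sup>2 \<le> R \<omega>" by simp
    qed
  qed
  have "expectation (\<lambda>\<omega>. (\<Delta> \<omega>)\<^sup>2) \<le> expectation (\<lambda>\<omega>. 2 * R \<omega> + 8 / (real N)\<^sup>2)"
    using iR i\<Delta> le by (intro integral_mono) auto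
  also have "\<dots> = 2 * expectation R + 8 / (real N)\<^sup>2" using iR by (simp add: prob_space)
  also have "\<dots> \<le> 2 * (real N * (moment_const (L + K) / real n)) + 8 / (real N)\<^sup>2"
    using ER by simp
  finally have "expectation (\<lambda>\<omega>. (\<Delta> \<omega>)\<^sup>2) \<le> 2 * real N * moment_const (L + K) / real n + 8 / (real N)\<^sup>2"
    by simp
  moreover have "0 \<le> \<Delta> \<omega>" for \<omega> using R0 by (simp add: \<Delta>_def)
  ultimately show ?thesis using that[of \<Delta>] dev i\<Delta> by auto
qed

section \<open>Comparison of the estimator with the mean of absolute block sums\<close>

lemma Dhat_measurable: "Dhat XN l n \<in> borel_measurable M"
  unfolding Dhat_def[abs_def] Let_def That_def Utilde_def Fhat_def by measurable

text \<open>The unknown mean of \<open>F (X 1)\<close> cancels between the block sum and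
  \<open>l\<close> times the overall average. What remains is the empirical error once in each of
  them and the fluctuation of the overall average.\<close>

lemma That_deviation:
  assumes n: "1 \<le> n" and \<Delta>: "\<And>x. \<bar>Fhat XN n x \<omega> - F x\<bar> \<le> \<Delta>"
  shows "\<bar>(That XN n l (Suc i) \<omega> - real l * Utilde XN n \<omega>) - (\<Sum>j = 1..l. centred F (j + i * l) \<omega>)\<bar>
    \<le> real l * (2 * \<Delta> + \<bar>(\<Sum>j = 1..n. centred F j \<omega>) / real n\<bar>)"
proof -
  define \<mu> where "\<mu> = expectation (\<lambda>\<omega>. F (X 1 \<omega>))"
  define e where "e j = Fhat XN n (X (int j) \<omega>) \<omega> - F (X (int j) \<omega>)" for j
  have e: "\<bar>e j\<bar> \<le> \<Delta>" for j unfolding e_def by (rule \<Delta>)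
  have Fe: "Fhat XN n (X (int j) \<omega>) \<omega> = e j + centred F j \<omega> + \<mu>" for j
    by (simp add: e_def centred_def \<mu>_def)
  have "That XN n l (Suc i) \<omega> = (\<Sum>j = 1..l. Fhat XN n (X (int (j + i * l)) \<omega>) \<omega>)"
    unfolding That_def
    by (rule sum.reindex_bij_witness[of _ "\<lambda>j. j + i * l" "\<lambda>j. j - i * l"]) auto
  also have "\<dots> = (\<Sum>j = 1..l. e (j + i * l)) + (\<Sum>j = 1..l. centred F (j + i * l) \<omega>) + real l * \<mu>"
    unfolding Fe by (simp add: sum.distrib)
  finally have T: "That XN n l (Suc i) \<omega> = (\<Sum>j = 1..l. e (j + i * l)) + (\<Sum>j = 1..l. centred F (j + i * l) \<omega>) + real l * \<mu>" .
  have U: "Utilde XN n \<omega> = (\<Sum>j = 1..n. e j) / real n + (\<Sum>j = 1..n. centred F j \<omega>) / real n + \<mu>"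
    unfolding Utilde_def Fe using n by (simp add: sum.distrib add_divide_distrib)
  have "\<bar>\<Sum>j = 1..l. e (j + i * l)\<bar> \<le> (\<Sum>j = 1..l. \<Delta>)"
    by (intro order.trans[OF sum_abs] sum_mono e)
  then have s1: "\<bar>\<Sum>j = 1..l. e (j + i * l)\<bar> \<le> real l * \<Delta>" by simp
  have "\<bar>\<Sum>j = 1..n. e j\<bar> \<le> (\<Sum>j = 1..n. \<Delta>)"
    by (intro order.trans[OF sum_abs] sum_mono e)
  then have "\<bar>\<Sum>j = 1..n. e j\<bar> \<le> real n * \<Delta>" by simp
  then have "\<bar>(\<Sum>j = 1..n. e j) / real n\<bar> \<le> \<Delta>"
    using n by (simp add: abs_divide divide_le_eq mult.commute)
  then have s2: "\<bar>real l * ((\<Sum>j = 1..n. e j) / real n)\<bar> \<le> real l * \<Delta>"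
    unfolding abs_mult by (intro mult_mono) auto
  have eq: "(That XN n l (Suc i) \<omega> - real l * Utilde XN n \<omega>) - (\<Sum>j = 1..l. centred F (j + i * l) \<omega>)
     = (\<Sum>j = 1..l. e (j + i * l)) - real l * ((\<Sum>j = 1..n. e j) / real n) - real l * ((\<Sum>j = 1..n. centred F j \<omega>) / real n)"
    unfolding T U by (simp only: distrib_left)
  have H: "\<bar>real l * ((\<Sum>j = 1..n. centred F j \<omega>) / real n)\<bar> = real l * \<bar>(\<Sum>j = 1..n. centred F j \<omega>) / real n\<bar>"
    unfolding abs_mult by simp
  have "\<bar>a - b - c\<bar> \<le> y * (2 * \<Delta> + z)" if "\<bar>a\<bar> \<le> y * \<Delta>" "\<bar>b\<bar> \<le> y * \<Delta>" "\<bar>c\<bar> = y * z" for a b c y z :: real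
  proof -
    have "y * (2 * \<Delta> + z) = y * \<Delta> + y * \<Delta> + y * z" by (simp add: algebra_simps)
    then show ?thesis using that by linarith
  qed
  from this[OF s1 s2 H] show ?thesis unfolding eq .
qed

text \<open>Each block is off by at most \<open>l\<close> times the uniform error, and the
  normalisation leaves \<open>l / sqrt l = sqrt l\<close>. In mean square this is \<open>l\<close>
  times the squared uniform error, the source of the ratio \<open>l / sqrt n\<close>.\<close>

lemma Dhat_deviation:
  assumes n: "1 \<le> n" and l: "1 \<le> l n" "1 \<le> n div l n" and \<Delta>: "\<And>x. \<bar>Fhat XN n x \<omega> - F x\<bar> \<le> \<Delta>"
  shows "\<bar>Dhat XN l n \<omega> - sqrt (pi / 2) * ((\<Sum>i<n div l n. block_abs F (l n) i \<omega>) / real (n div l n))\<bar>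
    \<le> sqrt (pi / 2) * (sqrt (real (l n)) * (2 * \<Delta> + \<bar>(\<Sum>j = 1..n. centred F j \<omega>) / real n\<bar>))"
proof -
  define k where "k = n div l n"
  define c where "c = sqrt (pi / 2)"
  have c: "0 \<le> c" by (simp add: c_def)
  let ?d = "2 * \<Delta> + \<bar>(\<Sum>j = 1..n. centred F j \<omega>) / real n\<bar>"
  let ?t = "\<lambda>i. \<bar>That XN n (l n) (Suc i) \<omega> - real (l n) * Utilde XN n \<omega>\<bar> / sqrt (real (l n))"
  have D: "Dhat XN l n \<omega> = c * ((\<Sum>i<k. ?t i) / real k)"
    unfolding Dhat_def Let_def k_def[symmetric] c_def[symmetric]
    by (simp add: sum.atLeast1_atMost_eq lessThan_Suc_atMost)
  have "\<bar>?t i - block_abs F (l n) i \<omega>\<bar> \<le> sqrt (real (l n)) * ?d" for i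
  proof -
    have "\<bar>?t i - block_abs F (l n) i \<omega>\<bar>
       = \<bar>\<bar>That XN n (l n) (Suc i) \<omega> - real (l n) * Utilde XN n \<omega>\<bar> - \<bar>\<Sum>j = 1..l n. centred F (j + i * l n) \<omega>\<bar>\<bar> / sqrt (real (l n))"
      by (simp add: block_abs_def abs_divide flip: diff_divide_distrib)
    also have "\<dots> \<le> \<bar>(That XN n (l n) (Suc i) \<omega> - real (l n) * Utilde XN n \<omega>) - (\<Sum>j = 1..l n. centred F (j + i * l n) \<omega>)\<bar> / sqrt (real (l n))"
      by (intro divide_right_mono abs_triangle_ineq3) auto
    also have "\<dots> \<le> real (l n) * ?d / sqrt (real (l n))"
      by (intro divide_right_mono That_deviation n \<Delta>) auto
    also have "\<dots> = (real (l n) / sqrt (real (l n))) * ?d" by simp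
    also have "\<dots> = sqrt (real (l n)) * ?d" by (simp only: real_div_sqrt[OF of_nat_0_le_iff])
    finally show ?thesis .
  qed
  then have "(\<Sum>i<k. \<bar>?t i - block_abs F (l n) i \<omega>\<bar>) \<le> (\<Sum>i<k. sqrt (real (l n)) * ?d)"
    by (intro sum_mono)
  then have "\<bar>\<Sum>i<k. ?t i - block_abs F (l n) i \<omega>\<bar> \<le> real k * (sqrt (real (l n)) * ?d)"
    by (intro order.trans[OF sum_abs]) simp
  then have "\<bar>(\<Sum>i<k. ?t i - block_abs F (l n) i \<omega>) / real k\<bar> \<le> sqrt (real (l n)) * ?d"
    using l(2) by (simp add: k_def[symmetric] abs_divide divide_le_eq mult.commute)
  from mult_left_mono[OF this c]
  have "\<bar>c * ((\<Sum>i<k. ?t i - block_abs F (l n) i \<omega>) / real k)\<bar> \<le> c * (sqrt (real (l n)) * ?d)"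
    using c by (simp only: abs_mult abs_of_nonneg)
  moreover have "c * ((\<Sum>i<k. ?t i - block_abs F (l n) i \<omega>) / real k)
      = Dhat XN l n \<omega> - c * ((\<Sum>i<k. block_abs F (l n) i \<omega>) / real k)"
    unfolding D sum_subtractf diff_divide_distrib right_diff_distrib by (rule refl)
  ultimately show ?thesis by (simp only: k_def c_def)
qed

text \<open>The error splits into the exchange of the empirical for the true distribution function,
  the fluctuation of the block mean about its expectation, and the bias of that expectation. The
  outer factor 3 comes from squaring the three-term sum.\<close>

lemma mean_square_error_bound:
  assumes n: "1 \<le> n" and l: "3 \<le> l n" "real (l n) \<le> sqrt (real n)"
  defines "v \<equiv> long_run_variance F" and "\<rho> \<equiv> real (l n) / sqrt (real n)"
  shows "expectation (\<lambda>\<omega>. (Dhat XN l n \<omega> - sqrt v)\<^sup>2)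
    \<le> 3 * ((pi / 2) * (32 * moment_const (L + K) + 64 + 2 * moment_const (L * K)) * \<rho>
      + (pi / 2) * (6 * moment_const (L * K) * \<rho> + 20 * (L * K + K) / real (l n div 3))
      + (sqrt (pi / 2) * expectation (block_abs F (l n) 0) - sqrt v)\<^sup>2)"
proof -
  note ap = approximable_cdf
  define A where "A = moment_const (L * K)"
  define A' where "A' = moment_const (L + K)"
  have A: "0 \<le> A" "0 \<le> A'"
    using moment_const_nonneg[OF ap] moment_const_nonneg[OF approximable_indicator] by (simp_all add: A_def A'_def)
  define c where "c = sqrt (pi / 2)"
  have c2: "c\<^sup>2 = pi / 2" by (simp add: c_def)
  define k where "k = n div l n"
  define \<mu> where "\<mu> = expectation (block_abs F (l n) 0)"
  \<comment> \<open>Rounding up gives \<open>N^2 >= n\<close>, so the grid term is at most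
    \<open>8 / n\<close>, while \<open>N <= 2 * sqrt n\<close> keeps the term linear in
    \<open>N\<close> of order \<open>1 / sqrt n\<close>.\<close>
  define N where "N = nat \<lceil>sqrt (real n)\<rceil>"
  have sn: "1 \<le> sqrt (real n)" using n by simp
  have nn: "real n = sqrt (real n) * sqrt (real n)" by simp
  have N: "sqrt (real n) \<le> real N" "real N \<le> 2 * sqrt (real n)" "1 \<le> N"
    using sn unfolding N_def by linarith+
  have "sqrt (real n) * 1 \<le> sqrt (real n) * sqrt (real n)" using sn by (intro mult_left_mono) auto
  then have "real (l n) \<le> real n" using l(2) by simp
  then have ln: "l n \<le> n" by simp
  have k: "1 \<le> k" using ln l(1) by (simp add: k_def less_eq_div_iff_mult_less_eq)
  \<comment> \<open>Rounding in \<open>n div l n\<close> loses less than one block, and there is at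
    least one, so \<open>n < 2 * k * l n\<close>.\<close>
  have kl: "1 / real k \<le> 2 * \<rho>"
  proof -
    have "n < l n + k * l n" using dividend_less_div_times[of "l n" n] l(1) by (simp add: k_def)
    also have "\<dots> \<le> k * l n + k * l n" using k by simp
    finally have "real n \<le> real (2 * (k * l n))" by (simp only: of_nat_le_iff)
    then have "1 / real k \<le> 2 * real (l n) / real n" using k n by (simp add: field_simps)
    also have "\<dots> \<le> 2 * \<rho>"
    proof -
      have "real (l n) / real n \<le> real (l n) / sqrt (real n)"
        using \<open>sqrt (real n) * 1 \<le> _\<close> sn by (intro divide_left_mono) auto
      then show ?thesis by (simp add: \<rho>_def)
    qed
    finally show ?thesis .
  qed
  have ln_n: "real (l n) / real n \<le> \<rho>"
    unfolding \<rho>_def using \<open>sqrt (real n) * 1 \<le> _\<close> sn by (intro divide_left_mono) auto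
  obtain \<Delta> where \<Delta>m: "\<Delta> \<in> borel_measurable M" and \<Delta>0: "\<And>\<omega>. 0 \<le> \<Delta> \<omega>"
    and \<Delta>: "\<And>x \<omega>. \<bar>Fhat XN n x \<omega> - F x\<bar> \<le> \<Delta> \<omega>"
    and \<Delta>i: "integrable M (\<lambda>\<omega>. (\<Delta> \<omega>)\<^sup>2)"
    and E\<Delta>': "expectation (\<lambda>\<omega>. (\<Delta> \<omega>)\<^sup>2) \<le> 2 * real N * moment_const (L + K) / real n + 8 / (real N)\<^sup>2"
    by (rule uniform_deviation[OF n N(3)]) (rule that)
  note E\<Delta> = E\<Delta>'[folded A'_def]
  define H where "H \<omega> = (\<Sum>j = 1..n. centred F j \<omega>) / real n" for \<omega>
  have Hi: "integrable M (\<lambda>\<omega>. (H \<omega>)\<^sup>2)"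
    unfolding H_def power_divide by (intro integrable_divide integrable_centred_sum_sq[OF ap]) auto
  have EH: "expectation (\<lambda>\<omega>. (H \<omega>)\<^sup>2) \<le> A / real n"
  proof -
    have "expectation (\<lambda>\<omega>. (H \<omega>)\<^sup>2) = expectation (\<lambda>\<omega>. (\<Sum>j = 1..n. centred F j \<omega>)\<^sup>2) / (real n)\<^sup>2"
      unfolding H_def power_divide by simp
    also have "\<dots> \<le> A * real n / (real n)\<^sup>2"
      using second_moment_le[OF ap, where J = "{1..n}"] by (intro divide_right_mono) (auto simp: A_def)
    also have "\<dots> = A / real n" by (simp add: power2_eq_square)
    finally show ?thesis .
  qed
  define D where "D \<omega> = (\<Sum>i<k. block_abs F (l n) i \<omega>) / real k" for \<omega>
  have Dm [measurable]: "D \<in> borel_measurable M"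
    unfolding D_def[abs_def] using block_abs_measurable[OF ap] by measurable
  have Di: "integrable M (\<lambda>\<omega>. (D \<omega> - \<mu>)\<^sup>2)"
  proof (rule integrable_bounded)
    show "norm ((D \<omega> - \<mu>)\<^sup>2) \<le> (sqrt (real (l n)) + \<bar>\<mu>\<bar>)\<^sup>2" for \<omega>
    proof -
      have "\<bar>\<Sum>i<k. block_abs F (l n) i \<omega>\<bar> \<le> (\<Sum>i<k. sqrt (real (l n)))"
        by (intro order.trans[OF sum_abs] sum_mono block_abs_bound[OF ap])
      then have "\<bar>D \<omega>\<bar> \<le> sqrt (real (l n))" using k by (simp add: D_def abs_divide divide_le_eq mult.commute)
      then have "\<bar>D \<omega> - \<mu>\<bar> \<le> sqrt (real (l n)) + \<bar>\<mu>\<bar>" by linarith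
      from power_mono[OF this, of 2] show ?thesis by simp
    qed
  qed measurable
  have VD: "expectation (\<lambda>\<omega>. (D \<omega> - \<mu>)\<^sup>2) \<le> 6 * A * \<rho> + 20 * (L * K + K) / real (l n div 3)"
  proof -
    have "expectation (\<lambda>\<omega>. (D \<omega> - \<mu>)\<^sup>2) \<le> 3 * A / real k + 20 * (L * K + K) / real (l n div 3)"
      unfolding D_def \<mu>_def A_def by (rule block_mean_variance[OF ap l(1) k])
    also have "3 * A / real k \<le> 6 * A * \<rho>"
      using mult_left_mono[OF kl, of "3 * A"] A by simp
    finally show ?thesis by simp
  qed
  have pt: "(Dhat XN l n \<omega> - sqrt v)\<^sup>2
      \<le> 3 * (c\<^sup>2 * real (l n) * (8 * (\<Delta> \<omega>)\<^sup>2 + 2 * (H \<omega>)\<^sup>2) + c\<^sup>2 * (D \<omega> - \<mu>)\<^sup>2 + (c * \<mu> - sqrt v)\<^sup>2)" for \<omega>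
  proof -
    have "\<bar>Dhat XN l n \<omega> - c * D \<omega>\<bar> \<le> c * (sqrt (real (l n)) * (2 * \<Delta> \<omega> + \<bar>H \<omega>\<bar>))"
      using Dhat_deviation[where l = l, OF n _ _ \<Delta>] l(1) k by (simp add: c_def D_def k_def H_def)
    from power_mono[OF this, of 2]
    have "(Dhat XN l n \<omega> - c * D \<omega>)\<^sup>2 \<le> c\<^sup>2 * real (l n) * (2 * \<Delta> \<omega> + \<bar>H \<omega>\<bar>)\<^sup>2"
      by (simp add: power_mult_distrib mult.assoc)
    also have "\<dots> \<le> c\<^sup>2 * real (l n) * (8 * (\<Delta> \<omega>)\<^sup>2 + 2 * (H \<omega>)\<^sup>2)"
      using sum_square_le_two[of "2 * \<Delta> \<omega>" "\<bar>H \<omega>\<bar>"] by (intro mult_left_mono) (auto simp: power_mult_distrib)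
    finally have 1: "(Dhat XN l n \<omega> - c * D \<omega>)\<^sup>2 \<le> c\<^sup>2 * real (l n) * (8 * (\<Delta> \<omega>)\<^sup>2 + 2 * (H \<omega>)\<^sup>2)" .
    have "(Dhat XN l n \<omega> - sqrt v)\<^sup>2 = ((Dhat XN l n \<omega> - c * D \<omega>) + c * (D \<omega> - \<mu>) + (c * \<mu> - sqrt v))\<^sup>2"
      by (simp add: algebra_simps)
    also have "\<dots> \<le> 3 * ((Dhat XN l n \<omega> - c * D \<omega>)\<^sup>2 + (c * (D \<omega> - \<mu>))\<^sup>2 + (c * \<mu> - sqrt v)\<^sup>2)"
      by (rule sum_square_le_three)
    also have "\<dots> \<le> 3 * (c\<^sup>2 * real (l n) * (8 * (\<Delta> \<omega>)\<^sup>2 + 2 * (H \<omega>)\<^sup>2) + c\<^sup>2 * (D \<omega> - \<mu>)\<^sup>2 + (c * \<mu> - sqrt v)\<^sup>2)"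
      using 1 by (simp add: power_mult_distrib)
    finally show ?thesis .
  qed
  let ?B = "\<lambda>\<omega>. 3 * (c\<^sup>2 * real (l n) * (8 * (\<Delta> \<omega>)\<^sup>2 + 2 * (H \<omega>)\<^sup>2) + c\<^sup>2 * (D \<omega> - \<mu>)\<^sup>2 + (c * \<mu> - sqrt v)\<^sup>2)"
  have iB: "integrable M ?B" using \<Delta>i Hi Di by simp
  have "expectation (\<lambda>\<omega>. (Dhat XN l n \<omega> - sqrt v)\<^sup>2) \<le> expectation ?B"
  proof (rule integral_mono[OF _ iB pt])
    show "integrable M (\<lambda>\<omega>. (Dhat XN l n \<omega> - sqrt v)\<^sup>2)"
    proof (rule Bochner_Integration.integrable_bound[OF iB])
      show "(\<lambda>\<omega>. (Dhat XN l n \<omega> - sqrt v)\<^sup>2) \<in> borel_measurable M"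
        using Dhat_measurable by measurable
      show "AE \<omega> in M. norm ((Dhat XN l n \<omega> - sqrt v)\<^sup>2) \<le> norm (?B \<omega>)"
        using order.trans[OF pt abs_ge_self] by (intro AE_I2) simp
    qed
  qed
  also have "expectation ?B = 3 * (c\<^sup>2 * real (l n) * (8 * expectation (\<lambda>\<omega>. (\<Delta> \<omega>)\<^sup>2) + 2 * expectation (\<lambda>\<omega>. (H \<omega>)\<^sup>2))
      + c\<^sup>2 * expectation (\<lambda>\<omega>. (D \<omega> - \<mu>)\<^sup>2) + (c * \<mu> - sqrt v)\<^sup>2)"
    using \<Delta>i Hi Di by (simp add: prob_space)
  also have "\<dots> \<le> 3 * (c\<^sup>2 * ((32 * A' + 64 + 2 * A) * \<rho>)
      + c\<^sup>2 * (6 * A * \<rho> + 20 * (L * K + K) / real (l n div 3)) + (c * \<mu> - sqrt v)\<^sup>2)"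
  proof (intro mult_left_mono add_mono order.refl VD)
    \<comment> \<open>The constants arise as \<open>32 = 8 * 2 * 2\<close> from the grid points,
      with the last 2 from \<open>N <= 2 * sqrt n\<close>, as \<open>64 = 8 * 8\<close> from the
      grid width, and 2 from the square of the overall average.\<close>
    have "real (l n) * (8 * expectation (\<lambda>\<omega>. (\<Delta> \<omega>)\<^sup>2) + 2 * expectation (\<lambda>\<omega>. (H \<omega>)\<^sup>2))
        \<le> real (l n) * (8 * (2 * real N * A' / real n + 8 / (real N)\<^sup>2) + 2 * (A / real n))"
      using E\<Delta> EH by (intro mult_left_mono add_mono) auto
    also have "\<dots> \<le> real (l n) * (8 * (2 * (2 * sqrt (real n)) * A' / real n + 8 / real n) + 2 * (A / real n))"
    proof (intro mult_left_mono add_mono order.refl)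
      show "2 * real N * A' / real n \<le> 2 * (2 * sqrt (real n)) * A' / real n"
        using N(2) A by (intro divide_right_mono mult_right_mono) auto
      have "real n \<le> (real N)\<^sup>2" using power_mono[OF N(1), of 2] by simp
      then show "8 / (real N)\<^sup>2 \<le> 8 / real n" using n N(3) by (intro divide_left_mono) auto
    qed auto
    also have "\<dots> = 32 * A' * (real (l n) * (sqrt (real n) / real n)) + (64 + 2 * A) * (real (l n) / real n)"
      by (simp add: algebra_simps add_divide_distrib)
    also have "sqrt (real n) / real n = 1 / sqrt (real n)" using n by (simp add: sqrt_divide_self_eq inverse_eq_divide)
    also have "32 * A' * (real (l n) * (1 / sqrt (real n))) + (64 + 2 * A) * (real (l n) / real n)
        \<le> 32 * A' * \<rho> + (64 + 2 * A) * \<rho>"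
      using ln_n A by (intro add_mono mult_left_mono) (auto simp: \<rho>_def)
    finally have "real (l n) * (8 * expectation (\<lambda>\<omega>. (\<Delta> \<omega>)\<^sup>2) + 2 * expectation (\<lambda>\<omega>. (H \<omega>)\<^sup>2))
        \<le> (32 * A' + 64 + 2 * A) * \<rho>" by (simp add: algebra_simps)
    from mult_left_mono[OF this, of "c\<^sup>2"]
    show "c\<^sup>2 * real (l n) * (8 * expectation (\<lambda>\<omega>. (\<Delta> \<omega>)\<^sup>2) + 2 * expectation (\<lambda>\<omega>. (H \<omega>)\<^sup>2))
        \<le> c\<^sup>2 * ((32 * A' + 64 + 2 * A) * \<rho>)" by (simp add: mult.assoc)
  qed auto
  finally show ?thesis unfolding c2 by (simp only: A_def A'_def \<mu>_def c_def mult.assoc)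
qed

lemma Dhat_mean_square_limit:
  assumes l_inf: "filterlim l at_top at_top"
    and l_small: "(\<lambda>n. real (l n)) \<in> o(\<lambda>n. sqrt (real n))"
  shows "(\<lambda>n. expectation (\<lambda>\<omega>. (Dhat XN l n \<omega> - sqrt (sigmaF2 M XN))\<^sup>2)) \<longlonglongrightarrow> 0"
proof -
  define v where "v = long_run_variance F"
  define \<rho> where "\<rho> n = real (l n) / sqrt (real n)" for n
  have \<rho>: "\<rho> \<longlonglongrightarrow> 0" unfolding \<rho>_def using l_small by (rule smalloD_tendsto)
  define a where "a = (pi / 2) * (32 * moment_const (L + K) + 64 + 2 * moment_const (L * K))"
  define b where "b = 6 * moment_const (L * K)"
  define d where "d = 20 * (L * K + K)"
  have m: "filterlim (\<lambda>n. l n div 3) at_top at_top"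
  proof (rule filterlim_compose[OF _ l_inf])
    show "filterlim (\<lambda>n::nat. n div 3) at_top at_top"
      unfolding filterlim_at_top
    proof
      fix Z :: nat
      show "\<forall>\<^sub>F n in sequentially. Z \<le> n div 3"
        using eventually_ge_at_top[of "3 * Z"] by eventually_elim simp
    qed
  qed
  have third: "(\<lambda>n. d / real (l n div 3)) \<longlonglongrightarrow> 0"
    by (rule filterlim_compose[OF lim_const_over_n m])
  have "(\<lambda>n. expectation (block_abs F (l n) 0)) \<longlonglongrightarrow> sqrt v * sqrt (2 / pi)"
    using filterlim_compose[OF abs_sum_limit[OF approximable_cdf] l_inf] by (simp add: block_abs_def[abs_def] v_def)
  then have "(\<lambda>n. sqrt (pi / 2) * expectation (block_abs F (l n) 0) - sqrt v)
      \<longlonglongrightarrow> sqrt (pi / 2) * (sqrt v * sqrt (2 / pi)) - sqrt v"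
    by (intro tendsto_intros)
  \<comment> \<open>The normalising factor of \<open>Dhat\<close> cancels the absolute moment of the
    normal law, which makes the estimator asymptotically unbiased.\<close>
  moreover have "sqrt (pi / 2) * (sqrt v * sqrt (2 / pi)) = sqrt v"
  proof -
    have "sqrt (pi / 2) * sqrt (2 / pi) = 1" by (simp flip: real_sqrt_mult)
    then show ?thesis by (metis mult.left_commute mult.right_neutral)
  qed
  ultimately have bias: "(\<lambda>n. sqrt (pi / 2) * expectation (block_abs F (l n) 0) - sqrt v) \<longlonglongrightarrow> 0" by simp
  define u where "u n = 3 * (a * \<rho> n + (pi / 2) * (b * \<rho> n + d / real (l n div 3))
      + (sqrt (pi / 2) * expectation (block_abs F (l n) 0) - sqrt v)\<^sup>2)" for n
  have "u \<longlonglongrightarrow> 3 * (a * 0 + (pi / 2) * (b * 0 + 0) + 0\<^sup>2)"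
    unfolding u_def[abs_def] by (intro tendsto_intros \<rho> third bias)
  then have u0: "u \<longlonglongrightarrow> 0" by simp
  have "(\<lambda>n. expectation (\<lambda>\<omega>. (Dhat XN l n \<omega> - sqrt v)\<^sup>2)) \<longlonglongrightarrow> 0"
  proof (rule tendsto_sandwich[OF _ _ tendsto_const u0])
    have "\<forall>\<^sub>F n in sequentially. 3 \<le> l n" using l_inf unfolding filterlim_at_top by blast
    moreover have "\<forall>\<^sub>F n in sequentially. \<rho> n < 1" using \<rho> by (rule order_tendstoD) simp
    ultimately show "\<forall>\<^sub>F n in sequentially. expectation (\<lambda>\<omega>. (Dhat XN l n \<omega> - sqrt v)\<^sup>2) \<le> u n"
      using eventually_ge_at_top[of 1]
    proof eventually_elim
      case (elim n)
      have "real (l n) \<le> sqrt (real n)" using elim by (simp add: \<rho>_def divide_less_eq)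
      from mean_square_error_bound[where l = l, OF elim(3,1) this] show ?case
        by (simp only: u_def v_def a_def b_def d_def \<rho>_def)
    qed
  qed simp
  then show ?thesis by (simp add: sigmaF2_eq v_def)
qed

end

theorem theorem2:
  fixes M :: "'a measure" and S :: "'s measure" and Y :: "int \<Rightarrow> 'a \<Rightarrow> 's"
    and f :: "(int \<Rightarrow> 's) \<Rightarrow> real" and \<delta> :: real and l :: "nat \<Rightarrow> nat"
  assumes "prob_space M"
    and Y_meas: "\<And>j. Y j \<in> measurable M S"
    and stationary: "\<And>h. distr M (PiM UNIV (\<lambda>_. S)) (\<lambda>\<omega> k. Y (k + h) \<omega>)
                          = distr M (PiM UNIV (\<lambda>_. S)) (\<lambda>\<omega> k. Y k \<omega>)"
    and mixing: "alpha_mix M S Y \<longlonglongrightarrow> 0"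
    and f_meas: "f \<in> borel_measurable (PiM UNIV (\<lambda>_. S))"
    and delta_pos: "\<delta> > 0"
    and moment: "integrable M (\<lambda>\<omega>. \<bar>Xproc f Y 1 \<omega>\<bar> powr (2 + \<delta>))"
    and psi_sum: "summable (\<lambda>k. psi_coef M S Y f \<delta> (Suc k) powr ((1 + \<delta>) / (2 + \<delta>)))"
    and alpha_rate: "\<exists>\<mu>. \<mu> > (2 + \<delta>)\<^sup>2 / \<delta> \<and> alpha_mix M S Y \<in> O(\<lambda>k. real k powr (-\<mu>))"
    and alpha_8: "alpha_mix M S Y \<in> O(\<lambda>n. real n powr (-8))"
    and phi_12: "phi_coef M S Y f \<in> O(\<lambda>m. real m powr (-12))"
    and F_lip: "\<exists>L. L-lipschitz_on UNIV (distF M (Xproc f Y 1))"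
    and l_pos: "\<And>n. l n > 0"
    and l_inf: "filterlim l at_top at_top"
    and l_small: "(\<lambda>n. real (l n)) \<in> o(\<lambda>n. sqrt (real n))"
  shows "(\<lambda>n. \<integral>\<omega>. (Dhat (\<lambda>i. Xproc f Y (int i)) l n \<omega>
                     - sqrt (sigmaF2 M (\<lambda>i. Xproc f Y (int i))))\<^sup>2 \<partial>M) \<longlonglongrightarrow> 0"
proof -
  interpret prob_space M by fact
  interpret mixing_functional M S Y f
    by unfold_locales (use Y_meas stationary f_meas in auto)
  obtain K1 where K1: "\<And>k. 1 \<le> k \<Longrightarrow> alpha_mix M S Y k \<le> K1 / real k ^ 8"
    using bigo_powr_bound[of "alpha_mix M S Y" 8] alpha_8 by auto
  obtain K2 where K2: "\<And>m. 1 \<le> m \<Longrightarrow> phi_coef M S Y f m \<le> K2 / real m ^ 12"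
    using bigo_powr_bound[of "phi_coef M S Y f" 12] phi_12 by auto
  obtain L where L: "L-lipschitz_on UNIV (distF M (Xproc f Y 1))" using F_lip by blast
  \<comment> \<open>The summand 1 in the dominating function covers the region
    \<open>|X| <= 1\<close>, where the higher power may be smaller than \<open>|X|\<close>.\<close>
  have X1: "integrable M (Xproc f Y 1)"
  proof (rule Bochner_Integration.integrable_bound)
    show "integrable M (\<lambda>\<omega>. 1 + \<bar>Xproc f Y 1 \<omega>\<bar> powr (2 + \<delta>))" using moment by simp
    show "AE \<omega> in M. norm (Xproc f Y 1 \<omega>) \<le> norm (1 + \<bar>Xproc f Y 1 \<omega>\<bar> powr (2 + \<delta>))"
    proof (rule AE_I2)
      fix \<omega>
      have "\<bar>Xproc f Y 1 \<omega>\<bar> \<le> 1 + \<bar>Xproc f Y 1 \<omega>\<bar> powr (2 + \<delta>)"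
      proof (cases "\<bar>Xproc f Y 1 \<omega>\<bar> \<le> 1")
        case False
        then have "\<bar>Xproc f Y 1 \<omega>\<bar> powr 1 \<le> \<bar>Xproc f Y 1 \<omega>\<bar> powr (2 + \<delta>)"
          using delta_pos by (intro powr_mono) auto
        then show ?thesis by simp
      qed (simp add: add_increasing2)
      then show "norm (Xproc f Y 1 \<omega>) \<le> norm (1 + \<bar>Xproc f Y 1 \<omega>\<bar> powr (2 + \<delta>))" by simp
    qed
  qed measurable
  \<comment> \<open>One constant has to serve both decay rates, and the maximum of the two
    does.\<close>
  interpret lipschitz_mixing_functional M S Y f "max K1 K2" L
  proof unfold_locales
    show "alpha_mix M S Y k \<le> max K1 K2 / real k ^ 8" if "1 \<le> k" for k
      using K1[OF that] by (rule order.trans) (simp add: divide_right_mono)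
    show "phi_coef M S Y f m \<le> max K1 K2 / real m ^ 12" if "1 \<le> m" for m
      using K2[OF that] by (rule order.trans) (simp add: divide_right_mono)
  qed (use X1 L in auto)
  show ?thesis by (rule Dhat_mean_square_limit[OF l_inf l_small])
qed

end
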